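(* Let $\varphi:X\to X$ be an expanding open map on a compact metrizable space $X$ and let $c:X\to[0,\infty)$ be continuous. Let $\mathcal L_c:C(X)\to C(X)$ be the Ruelle–Perron–Frobenius operator $\mathcal L_cf(y)=\sum_{x\in\varphi^{-1}(y)}c(x)f(x)$. Then $h_\varphi(\mu)<\infty$ for all $\mu\in\mathrm{Inv}(X,\varphi)$ and $$\ln r(\mathcal L_c)=\max_{\mu\in\mathrm{Inv}(X,\varphi)}\Big(\int_X\ln c\,d\mu+h_\varphi(\mu)\Big)=\max_{\mu\in\mathrm{Erg}(X,\varphi)}\Big(\int_X\ln c\,d\mu+h_\varphi(\mu)\Big),$$ where $r(\mathcal L_c)$ is the spectral radius of $\mathcal L_c$ (in particular both maxima are attained).
   Context: A continuous map $\varphi$ on a compact space $X$ is expanding if $X$ admits a compatible metric $d$ and constants $\varepsilon>0$, $\theta>1$ with $d(\varphi(x),\varphi(y))\ge\theta d(x,y)$ whenever $d(x,y)<\varepsilon$. An open expanding map is a local homeomorphism, so $\varphi^{-1}(y)$ is finite for each $y$. $\mathrm{Inv}(X,\varphi)$, $\mathrm{Erg}(X,\varphi)$: $\varphi$-invariant, resp. ergodic, Borel probability measures; $h_\varphi(\mu)$: Kolmogorov–Sinai entropy; convention $\ln0=-\infty$. *)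

theory Defs
  imports "HOL-Probability.Probability"
begin

definition expanding :: "'a topology \<Rightarrow> ('a \<Rightarrow> 'a) \<Rightarrow> bool" where
  "expanding X \<phi> \<longleftrightarrow>
     (\<exists>d. Metric_space (topspace X) d \<and> Metric_space.mtopology (topspace X) d = X \<and>
          (\<exists>\<epsilon>>0. \<exists>\<theta>>1. \<forall>x\<in>topspace X. \<forall>y\<in>topspace X.
              d x y < \<epsilon> \<longrightarrow> d (\<phi> x) (\<phi> y) \<ge> \<theta> * d x y))"

definition borel_of :: "'a topology \<Rightarrow> 'a measure" where
  "borel_of X = sigma (topspace X) {U. openin X U}"

definition invariant_measures :: "'a topology \<Rightarrow> ('a \<Rightarrow> 'a) \<Rightarrow> 'a measure set" where
  "invariant_measures X \<phi> =
     {M. prob_space M \<and> sets M = sets (borel_of X) \<and> \<phi> \<in> measurable M M \<and>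
         (\<forall>A\<in>sets M. emeasure M (\<phi> -` A \<inter> space M) = emeasure M A)}"

definition ergodic_measures :: "'a topology \<Rightarrow> ('a \<Rightarrow> 'a) \<Rightarrow> 'a measure set" where
  "ergodic_measures X \<phi> =
     {M \<in> invariant_measures X \<phi>.
        \<forall>A\<in>sets M. \<phi> -` A \<inter> space M = A \<longrightarrow> measure M A = 0 \<or> measure M A = 1}"

definition finite_meas_partitions :: "'a measure \<Rightarrow> 'a set set set" where
  "finite_meas_partitions M =
     {P. finite P \<and> P \<subseteq> sets M \<and> \<Union>P = space M \<and> disjoint P}"

definition partition_entropy :: "'a measure \<Rightarrow> 'a set set \<Rightarrow> real" where
  "partition_entropy M P =
     (\<Sum>A\<in>P. if measure M A = 0 then 0 else - measure M A * ln (measure M A))"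

definition iterated_join :: "'a measure \<Rightarrow> ('a \<Rightarrow> 'a) \<Rightarrow> 'a set set \<Rightarrow> nat \<Rightarrow> 'a set set" where
  "iterated_join M \<phi> P n =
     {(\<Inter>i<n. (\<phi> ^^ i) -` (f i)) \<inter> space M | f. \<forall>i<n. f i \<in> P}"

definition entropy_wrt_partition :: "'a measure \<Rightarrow> ('a \<Rightarrow> 'a) \<Rightarrow> 'a set set \<Rightarrow> real" where
  "entropy_wrt_partition M \<phi> P =
     lim (\<lambda>n. partition_entropy M (iterated_join M \<phi> P n) / real n)"

definition ks_entropy :: "'a measure \<Rightarrow> ('a \<Rightarrow> 'a) \<Rightarrow> ereal" where
  "ks_entropy M \<phi> = (SUP P\<in>finite_meas_partitions M. ereal (entropy_wrt_partition M \<phi> P))"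

definition integral_ln :: "'a measure \<Rightarrow> ('a \<Rightarrow> real) \<Rightarrow> ereal" where
  "integral_ln M c =
     enn2ereal (\<integral>\<^sup>+x. ennreal (max 0 (ln (c x))) \<partial>M)
   - enn2ereal (\<integral>\<^sup>+x. (if c x = 0 then \<infinity> else ennreal (max 0 (- ln (c x)))) \<partial>M)"

definition ln_ereal :: "real \<Rightarrow> ereal" where
  "ln_ereal r = (if r = 0 then - \<infinity> else ereal (ln r))"

definition CX :: "'a topology \<Rightarrow> ('a \<Rightarrow> complex) set" where
  "CX X = {f. continuous_map X euclidean f \<and> (\<forall>y. y \<notin> topspace X \<longrightarrow> f y = 0)}"

definition RPF :: "'a topology \<Rightarrow> ('a \<Rightarrow> 'a) \<Rightarrow> ('a \<Rightarrow> real) \<Rightarrow> ('a \<Rightarrow> complex) \<Rightarrow> ('a \<Rightarrow> complex)" where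
  "RPF X \<phi> c f = (\<lambda>y. \<Sum>x\<in>{x\<in>topspace X. \<phi> x = y}. complex_of_real (c x) * f x)"

text \<open>Spectrum of the bounded operator L on the Banach space C(X): the lambda for which
  lambda I - L is not bijective on C(X) (by the open mapping theorem, this is the same as
  not being invertible in B(C(X))).\<close>
definition op_spectrum :: "('a \<Rightarrow> complex) set \<Rightarrow> (('a \<Rightarrow> complex) \<Rightarrow> ('a \<Rightarrow> complex)) \<Rightarrow> complex set" where
  "op_spectrum V L = {z. \<not> bij_betw (\<lambda>f y. z * f y - L f y) V V}"

definition spectral_radius :: "('a \<Rightarrow> complex) set \<Rightarrow> (('a \<Rightarrow> complex) \<Rightarrow> ('a \<Rightarrow> complex)) \<Rightarrow> real" where
  "spectral_radius V L = Sup (cmod ` op_spectrum V L)"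

end

theory Submission imports Defs begin

text \<open>Write R for the spectral radius; it is the exponential growth rate of the iterates of the operator on
  the constant 1. An expanding map separates nearby points, so every partition of small diameter generates
  and the itineraries along a single finite partition determine the entropy.

  Upper bound: nearby points have unique nearby inverse branches, so an itinerary can be compared with the
  point of a fibre that shadows it, and the Gibbs inequality against the weights of the n-th iterate of the
  operator bounds entropy plus integral by ln R. The logarithm of c is first cut off at 1/m, with m tending
  to infinity.

  Attainment (Misiurewicz): weight the points of a fibre of the n-th iterate of the map by the normalised
  weights of the operator, average along orbits, and pass to a weak limit. Partitions with null boundaries
  make the entropies pass to the limit. The maximising measures thus form a weakly compact set, which is a
  face because the entropy of a mixture is at most the mixture of the entropies; the maximiser of a strictly
  convex continuous functional on it is ergodic.\<close>

subsection \<open>Shannon entropy of simple functions\<close>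

text \<open>The obstacle is the zeros of \<open>c\<close>. There \<open>ln c\<close> is
  -\<infinity>, so its integral may be infinite and does not pass to weak limits, and ratios of
  \<open>c\<close> at nearby points are not controlled. For the upper bound the weight becomes
  \<open>c + \<delta>\<close>; \<open>growth_perturbed\<close> shows that this raises the growth
  rate arbitrarily little. For attainment one equality is replaced by the inequalities \<open>ln
  (rad c) \<le> ks_real M + (\<integral>x. ln_cut m x \<partial>M)\<close> for all \<open>m\<close>.
  Each of them has a continuous integrand, so together they define a closed set, and the limit in
  \<open>m\<close> is taken only at the very end. Entropy is upper semicontinuous here because the
  rate along a generator is an infimum of finite-stage entropies, each of which is continuous at a
  measure that does not charge the boundaries of the cells. If \<open>rad c = 0\<close>, the weights
  on fibres have no positive rate to start from. Every invariant measure then has the value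
  -\<infinity>, and what remains is the existence of an ergodic measure, which comes from the same
  theory for the weight 1.\<close>

definition eta :: "real \<Rightarrow> real" where "eta p = - p * ln p"

text \<open>The entropy of the partition into level sets. With labellings in place of set partitions
  a join is a pair of functions and a refinement is a factorisation;
  \<open>partition_entropy_join\<close> makes the link to \<open>partition_entropy\<close>.\<close>

definition ent :: "'a measure \<Rightarrow> ('a \<Rightarrow> 'b) \<Rightarrow> real" where
  "ent M X = (\<Sum>v\<in>X ` space M. eta (measure M (X -` {v} \<inter> space M)))"

lemma eta_0[simp]: "eta 0 = 0" and eta_1[simp]: "eta 1 = 0"
  by (auto simp: eta_def)

text \<open>Termwise \<open>ln u \<le> u - 1\<close> at \<open>u = w i / (p i * W)\<close>; the
  errors add up to \<open>sum w I / W - 1 \<le> 0\<close>. The free bound \<open>W\<close> lets a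
  crude estimate of the total weight be inserted. Strong subadditivity, the bound by the number of
  cells and the upper bound for the pressure all rest on this inequality.\<close>

lemma gibbs_ineq:
  fixes p w :: "'i \<Rightarrow> real"
  assumes "finite I" and p: "\<And>i. i \<in> I \<Longrightarrow> p i \<ge> 0" and p1: "sum p I = 1"
    and w: "\<And>i. i \<in> I \<Longrightarrow> w i \<ge> 0" "\<And>i. i \<in> I \<Longrightarrow> p i > 0 \<Longrightarrow> w i > 0"
    and W: "sum w I \<le> W"
  shows "(\<Sum>i\<in>I. eta (p i)) \<le> ln W - (\<Sum>i\<in>I. p i * ln (w i))"
proof -
  obtain j where j: "j \<in> I" "p j > 0"
    using p p1 by (metis less_eq_real_def sum.neutral zero_neq_one)
  have "0 < w j" using w j by auto
  also have "\<dots> \<le> sum w I" using j w assms(1) by (intro member_le_sum) auto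
  finally have W0: "W > 0" using W by simp
  have "eta (p i) + p i * ln (w i) - p i * ln W \<le> w i / W - p i" if i: "i \<in> I" for i
  proof (cases "p i = 0")
    case True then show ?thesis using w i W0 by (simp add: eta_def)
  next
    case False
    hence pi: "p i > 0" using p i by force
    have wi: "w i > 0" using w pi i by auto
    have "ln (w i / (p i * W)) \<le> w i / (p i * W) - 1" using pi wi W0 by (intro ln_le_minus_one) auto
    hence "p i * ln (w i / (p i * W)) \<le> p i * (w i / (p i * W) - 1)" using pi by (intro mult_left_mono) auto
    also have "\<dots> = w i / W - p i" using pi W0 by (simp add: field_simps)
    finally show ?thesis using pi wi W0 by (simp add: eta_def ln_div ln_mult algebra_simps)
  qed
  hence "(\<Sum>i\<in>I. eta (p i) + p i * ln (w i) - p i * ln W) \<le> (\<Sum>i\<in>I. w i / W - p i)"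
    by (rule sum_mono)
  also have "\<dots> = sum w I / W - 1" by (simp add: sum_subtractf p1 sum_divide_distrib)
  also have "\<dots> \<le> 0" using W W0 by simp
  finally show ?thesis by (simp add: sum_subtractf sum.distrib sum_distrib_right[symmetric] p1)
qed

lemma ent_superset:
  assumes "finite F" "X ` space M \<subseteq> F"
  shows "ent M X = (\<Sum>v\<in>F. eta (measure M (X -` {v} \<inter> space M)))"
proof -
  have *: "measure M (X -` {v} \<inter> space M) = 0" if "v \<notin> X ` space M" for v
  proof -
    have "X -` {v} \<inter> space M = {}" using that by auto
    thus ?thesis by simp
  qed
  show ?thesis unfolding ent_def using assms by (intro sum.mono_neutral_left) (auto simp: *)
qed

context prob_space
begin

abbreviation pr where "pr X v \<equiv> prob (X -` {v} \<inter> space M)"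

lemma simple_sets: "simple_function M X \<Longrightarrow> X -` A \<inter> space M \<in> events"
  by (rule simple_functionD)

lemma pr_marginal:
  assumes T: "simple_function M T"
  shows "(\<Sum>t\<in>{t\<in>T ` space M. g t = v}. pr T t) = pr (\<lambda>x. g (T x)) v"
proof -
  have fin: "finite (T ` space M)" using T simple_functionD by auto
  have "pr (\<lambda>x. g (T x)) v = prob (\<Union>t\<in>{t\<in>T ` space M. g t = v}. T -` {t} \<inter> space M)"
    by (rule arg_cong[where f=prob]) auto
  also have "\<dots> = (\<Sum>t\<in>{t\<in>T ` space M. g t = v}. pr T t)"
    using fin T by (intro finite_measure_finite_Union) (auto simp: disjoint_family_on_def simple_functionD)
  finally show ?thesis by simp
qed

lemma pr_sum_1: "simple_function M T \<Longrightarrow> (\<Sum>t\<in>T ` space M. pr T t) = 1"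
proof -
  assume T: "simple_function M T"
  have "{t \<in> T ` space M. ()=()} = T ` space M" by auto
  then show ?thesis using pr_marginal[OF T, of "\<lambda>_. ()" "()"] by (simp add: prob_space)
qed

lemma sum_pr_fun:
  assumes T: "simple_function M T"
  shows "(\<Sum>t\<in>T ` space M. pr T t * h (g t)) = (\<Sum>v\<in>(\<lambda>x. g (T x)) ` space M. pr (\<lambda>x. g (T x)) v * h v)"
proof -
  have fin: "finite (T ` space M)" using T simple_functionD by auto
  have im: "(\<lambda>x. g (T x)) ` space M = g ` (T ` space M)" by auto
  have "(\<Sum>t\<in>T ` space M. pr T t * h (g t)) = (\<Sum>v\<in>g ` T ` space M. \<Sum>t\<in>{t\<in>T ` space M. g t = v}. pr T t * h (g t))"
    by (rule sum.image_gen[OF fin])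
  also have "\<dots> = (\<Sum>v\<in>g ` T ` space M. (\<Sum>t\<in>{t\<in>T ` space M. g t = v}. pr T t) * h v)"
    by (auto intro!: sum.cong simp: sum_distrib_right)
  also have "\<dots> = (\<Sum>v\<in>g ` T ` space M. pr (\<lambda>x. g (T x)) v * h v)"
    by (simp only: pr_marginal[OF T])
  finally show ?thesis by (simp add: im)
qed

lemma ent_fun_sum:
  assumes T: "simple_function M T"
  shows "ent M (\<lambda>x. g (T x)) = - (\<Sum>t\<in>T ` space M. pr T t * ln (pr (\<lambda>x. g (T x)) (g t)))"
  unfolding sum_pr_fun[OF T, where h="\<lambda>v. ln (pr (\<lambda>x. g (T x)) v)"] ent_def eta_def
  by (simp add: sum_negf)

lemma pr_le_pr_fun:
  assumes T: "simple_function M T" shows "pr T t \<le> pr (\<lambda>x. g (T x)) (g t)"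
proof (rule finite_measure_mono)
  have "simple_function M (\<lambda>x. g (T x))" using simple_function_compose[OF T, of g] by (simp add: comp_def)
  thus "(\<lambda>x. g (T x)) -` {g t} \<inter> space M \<in> events" by (rule simple_sets)
qed auto

text \<open>Gibbs inequality for the law of \<open>(X, Y, Z)\<close> against the weights
  \<open>w\<close>, the law with the same \<open>(X, Z)\<close> and \<open>(Y, Z)\<close> marginals
  under which \<open>X\<close> and \<open>Y\<close> are independent given \<open>Z\<close>. Its
  logarithm splits into the three other entropies.\<close>

lemma ent_strong_subadditive:
  assumes X: "simple_function M X" and Y: "simple_function M Y" and Z: "simple_function M Z"
  shows "ent M (\<lambda>x. (X x, Y x, Z x)) + ent M Z \<le> ent M (\<lambda>x. (X x, Z x)) + ent M (\<lambda>x. (Y x, Z x))"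
proof -
  let ?T = "\<lambda>x. (X x, Y x, Z x)" and ?XZ = "\<lambda>x. (X x, Z x)" and ?YZ = "\<lambda>x. (Y x, Z x)"
  let ?g1 = "\<lambda>(a::'b,b::'c,c::'d). (a,c)" and ?g2 = "\<lambda>(a::'b,b::'c,c::'d). (b,c)" and ?g3 = "\<lambda>(a::'b,b::'c,c::'d). c"
  have XZ: "simple_function M ?XZ" and YZ: "simple_function M ?YZ" and T: "simple_function M ?T"
    using X Y Z by (auto intro!: simple_function_Pair)
  define R where "R = ?T ` space M"
  have finR: "finite R" using T simple_functionD unfolding R_def by blast
  have fin: "finite (X ` space M)" "finite (Y ` space M)" "finite (Z ` space M)" using X Y Z simple_functionD by blast+
  define w where "w t = pr ?XZ (?g1 t) * pr ?YZ (?g2 t) / pr Z (?g3 t)" for t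
  have pos: "pr ?XZ (?g1 t) > 0" "pr ?YZ (?g2 t) > 0" "pr Z (?g3 t) > 0" if "pr ?T t > 0" for t
    using that pr_le_pr_fun[OF T, of t ?g1] pr_le_pr_fun[OF T, of t ?g2] pr_le_pr_fun[OF T, of t ?g3] by simp_all
  have m1: "(\<Sum>a\<in>X ` space M. pr ?XZ (a,c)) = pr Z c" for c
  proof -
    have "pr Z c = (\<Sum>t\<in>{t\<in>?XZ ` space M. snd t = c}. pr ?XZ t)" using pr_marginal[OF XZ, of snd c] by simp
    also have "\<dots> = (\<Sum>t\<in>(\<lambda>a. (a,c)) ` X ` space M. pr ?XZ t)"
    proof (rule sum.mono_neutral_left)
      show "\<forall>i\<in>(\<lambda>a. (a, c)) ` X ` space M - {t \<in> ?XZ ` space M. snd t = c}. pr ?XZ i = 0"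
      proof
        fix i assume "i\<in>(\<lambda>a. (a, c)) ` X ` space M - {t \<in> ?XZ ` space M. snd t = c}"
        hence "i \<notin> ?XZ ` space M" by auto
        hence "?XZ -` {i} \<inter> space M = {}" by blast
        thus "pr ?XZ i = 0" by (simp only: measure_empty)
      qed
    qed (use fin in auto)
    also have "\<dots> = (\<Sum>a\<in>X ` space M. pr ?XZ (a,c))" by (subst sum.reindex) (auto simp: inj_on_def)
    finally show ?thesis by simp
  qed
  have m2: "(\<Sum>a\<in>Y ` space M. pr ?YZ (a,c)) = pr Z c" for c
  proof -
    have "pr Z c = (\<Sum>t\<in>{t\<in>?YZ ` space M. snd t = c}. pr ?YZ t)" using pr_marginal[OF YZ, of snd c] by simp
    also have "\<dots> = (\<Sum>t\<in>(\<lambda>a. (a,c)) ` Y ` space M. pr ?YZ t)"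
    proof (rule sum.mono_neutral_left)
      show "\<forall>i\<in>(\<lambda>a. (a, c)) ` Y ` space M - {t \<in> ?YZ ` space M. snd t = c}. pr ?YZ i = 0"
      proof
        fix i assume "i\<in>(\<lambda>a. (a, c)) ` Y ` space M - {t \<in> ?YZ ` space M. snd t = c}"
        hence "i \<notin> ?YZ ` space M" by auto
        hence "?YZ -` {i} \<inter> space M = {}" by blast
        thus "pr ?YZ i = 0" by (simp only: measure_empty)
      qed
    qed (use fin in auto)
    also have "\<dots> = (\<Sum>a\<in>Y ` space M. pr ?YZ (a,c))" by (subst sum.reindex) (auto simp: inj_on_def)
    finally show ?thesis by simp
  qed
  have "sum w R \<le> sum w (X ` space M \<times> Y ` space M \<times> Z ` space M)"
    using fin by (intro sum_mono2) (auto simp: R_def w_def)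
  also have "\<dots> = (\<Sum>a\<in>X ` space M. \<Sum>b\<in>Y ` space M. \<Sum>c\<in>Z ` space M. pr ?XZ (a,c) * pr ?YZ (b,c) / pr Z c)"
    unfolding w_def by (simp add: sum.cartesian_product split_def)
  also have "\<dots> = (\<Sum>c\<in>Z ` space M. (\<Sum>a\<in>X ` space M. pr ?XZ (a,c)) * (\<Sum>b\<in>Y ` space M. pr ?YZ (b,c)) / pr Z c)"
    (is "?L = ?R")
  proof -
    let ?f = "\<lambda>a b c. pr ?XZ (a,c) * pr ?YZ (b,c) / pr Z c"
    have "?L = (\<Sum>a\<in>X ` space M. \<Sum>c\<in>Z ` space M. \<Sum>b\<in>Y ` space M. ?f a b c)"
      by (intro sum.cong refl sum.swap)
    also have "\<dots> = (\<Sum>c\<in>Z ` space M. \<Sum>a\<in>X ` space M. \<Sum>b\<in>Y ` space M. ?f a b c)"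
      by (rule sum.swap)
    finally show ?thesis by (simp add: sum_product sum_divide_distrib)
  qed
  \<comment> \<open>Both marginal sums equal \<open>pr Z c\<close>. If that number is 0, the
    quotient is 0 as well, division by zero being zero.\<close>
  also have "\<dots> = (\<Sum>c\<in>Z ` space M. pr Z c)"
    unfolding m1 m2 by (intro sum.cong) auto
  also have "\<dots> = 1" by (rule pr_sum_1[OF Z])
  finally have w1: "sum w R \<le> 1" .
  have "(\<Sum>t\<in>R. eta (pr ?T t)) \<le> ln 1 - (\<Sum>t\<in>R. pr ?T t * ln (w t))"
  proof (rule gibbs_ineq[OF finR])
    show "sum (pr ?T) R = 1" unfolding R_def by (rule pr_sum_1[OF T])
  qed (use pos w1 in \<open>auto simp: w_def\<close>)
  also have "(\<Sum>t\<in>R. pr ?T t * ln (w t)) = (\<Sum>t\<in>R. pr ?T t * ln (pr ?XZ (?g1 t)) + pr ?T t * ln (pr ?YZ (?g2 t)) - pr ?T t * ln (pr Z (?g3 t)))"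
  proof (rule sum.cong[OF refl])
    fix t
    show "pr ?T t * ln (w t) = pr ?T t * ln (pr ?XZ (?g1 t)) + pr ?T t * ln (pr ?YZ (?g2 t)) - pr ?T t * ln (pr Z (?g3 t))"
    proof (cases "pr ?T t = 0")
      case False
      hence "pr ?T t > 0" using measure_nonneg[of M "?T -` {t} \<inter> space M"] by linarith
      from pos[OF this] show ?thesis unfolding w_def by (simp add: ln_div ln_mult algebra_simps)
    qed simp
  qed
  also have "\<dots> = - ent M ?XZ - ent M ?YZ + ent M Z"
    using ent_fun_sum[OF T, of ?g1] ent_fun_sum[OF T, of ?g2] ent_fun_sum[OF T, of ?g3]
    unfolding R_def by (simp add: sum.distrib sum_subtractf)
  finally show ?thesis unfolding ent_def[of M ?T] R_def by simp
qed

lemma eta_nonneg: "0 \<le> p \<Longrightarrow> p \<le> 1 \<Longrightarrow> 0 \<le> eta p"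
  unfolding eta_def by (cases "p = 0") (auto simp: mult_le_0_iff)

lemma ent_nonneg: "0 \<le> ent M X"
  unfolding ent_def by (intro sum_nonneg eta_nonneg) auto

lemma ent_fun_le:
  assumes T: "simple_function M T" shows "ent M (\<lambda>x. g (T x)) \<le> ent M T"
proof -
  have "pr T t * ln (pr T t) \<le> pr T t * ln (pr (\<lambda>x. g (T x)) (g t))" for t
  proof (cases "pr T t = 0")
    case False
    hence "pr T t > 0" using measure_nonneg[of M "T -` {t} \<inter> space M"] by linarith
    thus ?thesis using pr_le_pr_fun[OF T, of t g] by (intro mult_left_mono) auto
  qed simp
  hence "(\<Sum>t\<in>T ` space M. pr T t * ln (pr T t)) \<le> (\<Sum>t\<in>T ` space M. pr T t * ln (pr (\<lambda>x. g (T x)) (g t)))"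
    by (intro sum_mono)
  thus ?thesis unfolding ent_fun_sum[OF T] ent_def[of M T] eta_def by (simp add: sum_negf)
qed

lemma ent_cong: "(\<And>x. x \<in> space M \<Longrightarrow> X x = Y x) \<Longrightarrow> ent M X = ent M Y"
proof -
  assume *: "\<And>x. x \<in> space M \<Longrightarrow> X x = Y x"
  hence "X ` space M = Y ` space M" "X -` {v} \<inter> space M = Y -` {v} \<inter> space M" for v by auto
  thus ?thesis by (simp add: ent_def)
qed

text \<open>Monotonicity in a form that asks only for an implication between equalities of labels.
  The factor map is chosen through preimages, so that applications never have to write one
  down.\<close>

lemma ent_le_of_determined:
  assumes T: "simple_function M T" and det: "\<And>x y. x \<in> space M \<Longrightarrow> y \<in> space M \<Longrightarrow> T x = T y \<Longrightarrow> V x = V y"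
  shows "ent M V \<le> ent M T"
proof -
  define g where "g t = V (SOME x. x \<in> space M \<and> T x = t)" for t
  have "V x = g (T x)" if "x \<in> space M" for x
  proof -
    have "\<exists>y. y \<in> space M \<and> T y = T x" using that by auto
    from someI_ex[OF this] show ?thesis unfolding g_def using det that by metis
  qed
  hence "ent M V = ent M (\<lambda>x. g (T x))" by (intro ent_cong) auto
  thus ?thesis using ent_fun_le[OF T] by simp
qed

lemma ent_eq_of_determined:
  assumes "simple_function M T" "simple_function M V"
    "\<And>x y. x \<in> space M \<Longrightarrow> y \<in> space M \<Longrightarrow> T x = T y \<longleftrightarrow> V x = V y"
  shows "ent M V = ent M T"
  using ent_le_of_determined[of T V] ent_le_of_determined[of V T] assms by (metis antisym)

lemma ent_const: "ent M (\<lambda>_. c) = 0"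
proof -
  have "(\<lambda>_. c) ` space M = {c}" using not_empty by auto
  thus ?thesis by (simp add: ent_def prob_space)
qed

lemma ent_Pair_le:
  assumes X: "simple_function M X" and Y: "simple_function M Y"
  shows "ent M (\<lambda>x. (X x, Y x)) \<le> ent M X + ent M Y"
proof -
  have "ent M (\<lambda>x. (X x, Y x, ())) + ent M (\<lambda>x. ()) \<le> ent M (\<lambda>x. (X x, ())) + ent M (\<lambda>x. (Y x, ()))"
    using X Y by (intro ent_strong_subadditive) auto
  moreover have "ent M (\<lambda>x. (X x, Y x)) \<le> ent M (\<lambda>x. (X x, Y x, ()))"
    using X Y by (intro ent_le_of_determined simple_function_Pair) auto
  moreover have "ent M (\<lambda>x. (X x, ())) \<le> ent M X" "ent M (\<lambda>x. (Y x, ())) \<le> ent M Y"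
    using ent_fun_le[OF X, of "\<lambda>a. (a, ())"] ent_fun_le[OF Y, of "\<lambda>a. (a, ())"] by auto
  ultimately show ?thesis using ent_const[of "()"] by simp
qed

lemma ent_le_ln_card:
  assumes X: "simple_function M X" and F: "finite F" "X ` space M \<subseteq> F"
  shows "ent M X \<le> ln (card F)"
proof -
  have ne: "X ` space M \<noteq> {}" using not_empty by auto
  have "ent M X \<le> ln (card (X ` space M)) - (\<Sum>v\<in>X ` space M. pr X v * ln 1)"
    unfolding ent_def using pr_sum_1[OF X] simple_functionD(1)[OF X] by (intro gibbs_ineq) auto
  also have "\<dots> = ln (card (X ` space M))" by simp
  also have "\<dots> \<le> ln (card F)" using F ne simple_functionD(1)[OF X]
    by (subst ln_le_cancel_iff) (auto intro!: card_mono simp: card_gt_0_iff simp del: ln_le_cancel_iff dest: finite_subset)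
  finally show ?thesis .
qed

end

subsection \<open>Itineraries and entropy rates\<close>

text \<open>Fekete's lemma. The limit is the infimum of the quotients, hence the second conclusion,
  which bounds it at every finite stage.\<close>

lemma subadditive_converges:
  fixes f :: "nat \<Rightarrow> real"
  assumes sub: "\<And>m n. f (m + n) \<le> f m + f n" and nn: "\<And>n. f n \<ge> 0"
  obtains l where "(\<lambda>n. f n / real n) \<longlonglongrightarrow> l" "\<And>n. n > 0 \<Longrightarrow> l \<le> f n / real n"
proof -
  define l where "l = (INF n\<in>{1..}. f n / real n)"
  have bdd: "bdd_below ((\<lambda>n. f n / real n) ` {1..})"
    using nn by (intro bdd_belowI[of _ 0]) auto
  have le: "l \<le> f n / real n" if "n > 0" for n
    unfolding l_def using that by (intro cINF_lower[OF bdd]) auto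
  have mult: "f (q * m) \<le> real q * f m + f 0" for q m
  proof (induction q)
    case (Suc q)
    have "f (Suc q * m) \<le> f m + f (q * m)" using sub[of m "q * m"] by simp
    with Suc show ?case by (simp add: algebra_simps)
  qed simp
  have "(\<lambda>n. f n / real n) \<longlonglongrightarrow> l"
  proof (rule LIMSEQ_I)
    fix e :: real assume e: "e > 0"
    have "\<exists>m\<in>{1..}. f m / real m < l + e / 2"
      using e bdd by (subst cINF_less_iff[symmetric]) (auto simp: l_def)
    then obtain m where m: "m \<ge> 1" "f m / real m < l + e / 2" by auto
    \<comment> \<open>Absorbs the remainder \<open>n mod m < m\<close> and the \<open>f 0\<close>
      with which the iteration of subadditivity starts; subadditivity alone does not make
      \<open>f 0\<close> vanish.\<close>
    define B where "B = (\<Sum>i<m. f i) + f 0"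
    obtain N where N: "real N > 2 * B / e" using reals_Archimedean2 by blast
    show "\<exists>no. \<forall>n\<ge>no. norm (f n / real n - l) < e"
    proof (intro exI allI impI)
      fix n assume n: "n \<ge> max 1 N"
      have "f n = f (n div m * m + n mod m)" by simp
      also have "\<dots> \<le> f (n div m * m) + f (n mod m)" by (rule sub)
      also have "f (n mod m) \<le> (\<Sum>i<m. f i)" using m nn by (intro member_le_sum) auto
      also have "f (n div m * m) \<le> real (n div m) * f m + f 0" by (rule mult)
      finally have "f n \<le> real (n div m) * f m + B" by (simp add: B_def)
      also have "real (n div m) * f m \<le> real n / real m * f m"
        using nn by (intro mult_right_mono of_nat_div_le_of_nat) auto
      finally have 1: "f n / real n \<le> f m / real m + B / real n"
        using n m by (simp add: field_simps)
      have "2 * B / e < real n" using N n by linarith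
      hence "B / real n < e / 2" using n e by (simp add: field_simps)
      with 1 m have "f n / real n < l + e" by linarith
      with le[of n] n show "norm (f n / real n - l) < e" by (simp add: abs_if)
    qed
  qed
  with le show ?thesis using that by blast
qed

text \<open>The level sets of the itinerary are the nonempty cells of the join of the first
  \<open>n\<close> pullbacks of the labelling.\<close>

definition itin :: "('a \<Rightarrow> 'a) \<Rightarrow> ('a \<Rightarrow> 'b) \<Rightarrow> nat \<Rightarrow> 'a \<Rightarrow> 'b list" where
  "itin \<phi> k n x = map (\<lambda>i. k ((\<phi> ^^ i) x)) [0..<n]"

lemma itin_eq_iff: "itin \<phi> k n x = itin \<phi> k n y \<longleftrightarrow> (\<forall>i<n. k ((\<phi> ^^ i) x) = k ((\<phi> ^^ i) y))"
  by (auto simp: itin_def)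

definition cell :: "'a set set \<Rightarrow> 'a \<Rightarrow> 'a set" where
  "cell P x = (THE A. A \<in> P \<and> x \<in> A)"

text \<open>Invariance is split off into \<open>pmp_system\<close>, because the discrete measures on
  a fibre are not assumed invariant and the window estimate below has to cover them.\<close>

locale measurable_system = prob_space M for M :: "'a measure" +
  fixes \<phi> :: "'a \<Rightarrow> 'a"
  assumes meas[measurable]: "\<phi> \<in> measurable M M"
begin

lemma iter_meas[measurable]: "\<phi> ^^ n \<in> measurable M M"
  by (induction n) auto

lemma iter_in_space: "x \<in> space M \<Longrightarrow> (\<phi> ^^ n) x \<in> space M"
  using measurable_space[OF iter_meas] .

lemma simple_comp:
  assumes "simple_function M X" "f \<in> measurable M M" shows "simple_function M (\<lambda>x. X (f x))"
  unfolding simple_function_def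
proof (intro conjI ballI)
  have "(\<lambda>x. X (f x)) ` space M \<subseteq> X ` space M" using measurable_space[OF assms(2)] by auto
  thus "finite ((\<lambda>x. X (f x)) ` space M)" using assms(1) simple_functionD(1) finite_subset by blast
  fix v
  have "(\<lambda>x. X (f x)) -` {v} \<inter> space M = f -` (X -` {v} \<inter> space M) \<inter> space M"
    using measurable_space[OF assms(2)] by auto
  thus "(\<lambda>x. X (f x)) -` {v} \<inter> space M \<in> events"
    using assms simple_sets measurable_sets by metis
qed

lemma simple_iter: "simple_function M X \<Longrightarrow> simple_function M (\<lambda>x. X ((\<phi> ^^ n) x))"
  by (rule simple_comp) auto

lemma simple_itin: "simple_function M k \<Longrightarrow> simple_function M (itin \<phi> k n)"
proof (induction n)
  case 0 show ?case by (simp add: itin_def[abs_def])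
next
  case (Suc n)
  have eq: "itin \<phi> k (Suc n) = (\<lambda>(a,b). a @ [b]) \<circ> (\<lambda>x. (itin \<phi> k n x, k ((\<phi> ^^ n) x)))"
    by (auto simp: itin_def)
  show ?case unfolding eq
    using Suc simple_iter[of k n] by (intro simple_function_compose simple_function_Pair) auto
qed

lemma simple_shift_itin: "simple_function M k \<Longrightarrow> simple_function M (\<lambda>x. itin \<phi> k n ((\<phi> ^^ j) x))"
  by (intro simple_iter simple_itin)

text \<open>The starting time \<open>j\<close> stays visible: without invariance the entropy of a
  block of the orbit depends on when the block begins.\<close>

lemma ent_itin_add:
  assumes k: "simple_function M k"
  shows "ent M (\<lambda>x. itin \<phi> k (m + n) ((\<phi> ^^ j) x))
    \<le> ent M (\<lambda>x. itin \<phi> k m ((\<phi> ^^ j) x)) + ent M (\<lambda>x. itin \<phi> k n ((\<phi> ^^ (j + m)) x))"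
proof -
  let ?A = "\<lambda>x. itin \<phi> k m ((\<phi> ^^ j) x)" and ?B = "\<lambda>x. itin \<phi> k n ((\<phi> ^^ (j + m)) x)"
  have "ent M (\<lambda>x. itin \<phi> k (m + n) ((\<phi> ^^ j) x)) \<le> ent M (\<lambda>x. (?A x, ?B x))"
  proof (rule ent_le_of_determined)
    show "simple_function M (\<lambda>x. (?A x, ?B x))" using k by (intro simple_function_Pair simple_shift_itin)
    fix x y assume "(?A x, ?B x) = (?A y, ?B y)"
    hence 1: "\<forall>i<m. k ((\<phi> ^^ (i + j)) x) = k ((\<phi> ^^ (i + j)) y)"
      and 2: "\<forall>i<n. k ((\<phi> ^^ (i + (j + m))) x) = k ((\<phi> ^^ (i + (j + m))) y)"
      unfolding funpow_add by (auto simp: itin_eq_iff)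
    have "k ((\<phi> ^^ (i + j)) x) = k ((\<phi> ^^ (i + j)) y)" if "i < m + n" for i
    proof (cases "i < m")
      case False
      hence "i - m < n" "i - m + (j + m) = i + j" using that by auto
      thus ?thesis using 2 by metis
    qed (use 1 in auto)
    thus "itin \<phi> k (m + n) ((\<phi> ^^ j) x) = itin \<phi> k (m + n) ((\<phi> ^^ j) y)"
      unfolding itin_eq_iff by (auto simp: funpow_add)
  qed
  also have "\<dots> \<le> ent M ?A + ent M ?B" using k by (intro ent_Pair_le simple_shift_itin)
  finally show ?thesis .
qed

text \<open>Cutting the first n steps of an orbit into windows of length q in all q possible
  phases, which is Misiurewicz's device for passing to the averaged measure.\<close>
lemma ent_itin_windows:
  assumes k: "simple_function M k" and B: "\<And>j. ent M (\<lambda>x. k ((\<phi> ^^ j) x)) \<le> B" and q: "q > 0" "q \<le> n"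
  shows "real q * ent M (itin \<phi> k n) \<le> (\<Sum>i<n. ent M (\<lambda>x. itin \<phi> k q ((\<phi> ^^ i) x))) + 3 * (real q)\<^sup>2 * B"
proof -
  define W where "W j m = ent M (\<lambda>x. itin \<phi> k m ((\<phi> ^^ j) x))" for j m
  have W_add: "W j (m + m') \<le> W j m + W (j + m) m'" for j m m'
    unfolding W_def by (rule ent_itin_add[OF k])
  have B0: "B \<ge> 0" using B[of 0] ent_nonneg order_trans by blast
  have Wnn: "W j m \<ge> 0" for j m unfolding W_def by (rule ent_nonneg)
  have W1: "W j m \<le> real m * B" for j m
  proof (induction m arbitrary: j)
    case 0
    have "W j 0 = 0" unfolding W_def itin_def using ent_const by simp
    thus ?case by simp
  next
    case (Suc m)
    have "W (j + m) 1 \<le> ent M (\<lambda>x. k ((\<phi> ^^ (j + m)) x))"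
      unfolding W_def by (rule ent_le_of_determined) (use k simple_iter in \<open>auto simp: itin_def\<close>)
    with W_add[of j m 1] Suc[of j] B[of "j+m"] show ?case by (simp add: algebra_simps)
  qed
  have Wq: "W j (t * q) \<le> (\<Sum>u<t. W (j + u * q) q)" for j t
  proof (induction t)
    case 0 show ?case using W1[of j 0] by simp
  next
    case (Suc t)
    have "W j (Suc t * q) = W j (t * q + q)" by (simp add: add.commute)
    also have "\<dots> \<le> W j (t * q) + W (j + t * q) q" by (rule W_add)
    finally show ?case using Suc by simp
  qed
  \<comment> \<open>One window fewer than fits into \<open>n\<close>, so that \<open>t\<close>
    consecutive windows end before time \<open>n\<close> from every phase
    \<open>j < q\<close>.\<close>
  define t where "t = n div q - 1"
  have tq: "t * q + q \<le> n" and tq2: "n < t * q + 2 * q"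
  proof -
    have "n div q > 0" using q by (simp add: div_greater_zero_iff)
    hence *: "t + 1 = n div q" unfolding t_def by simp
    have "(t + 1) * q \<le> n" unfolding * by simp
    thus "t * q + q \<le> n" by simp
    have "n < (n div q + 1) * q" using q by (metis dividend_less_div_times mult.commute Suc_eq_plus1 add.commute mult_Suc_right)
    thus "n < t * q + 2 * q" unfolding *[symmetric] by simp
  qed
  \<comment> \<open>A head of \<open>j < q\<close> steps and a tail of at most \<open>2 * q\<close>
    steps are not covered by full windows. Each such step costs at most \<open>B\<close>, whence the
    constant 3.\<close>
  have each: "W 0 n \<le> (\<Sum>u<t. W (j + u * q) q) + 3 * real q * B" if j: "j < q" for j
  proof -
    define l where "l = n - j - t * q"
    have n: "n = j + (t * q + l)" using tq j unfolding l_def by simp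
    have l: "l \<le> 2 * q" using tq2 unfolding l_def by simp
    have "W 0 n \<le> W 0 j + W j (t * q + l)" unfolding n using W_add[of 0 j "t * q + l"] by simp
    also have "W j (t * q + l) \<le> W j (t * q) + W (j + t * q) l" by (rule W_add)
    also have "W (j + t * q) l \<le> real l * B" by (rule W1)
    also have "W 0 j \<le> real j * B" by (rule W1)
    also have "real j * B \<le> real q * B" using B0 j by (intro mult_right_mono) auto
    also have "real l * B \<le> 2 * real q * B" using B0 l by (intro mult_right_mono) linarith+
    also have "W j (t * q) \<le> (\<Sum>u<t. W (j + u * q) q)" by (rule Wq)
    finally show ?thesis by (simp add: algebra_simps)
  qed
  have "real q * W 0 n = (\<Sum>j<q. W 0 n)" by simp
  also have "\<dots> \<le> (\<Sum>j<q. (\<Sum>u<t. W (j + u * q) q) + 3 * real q * B)" by (intro sum_mono each) auto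
  also have "\<dots> = (\<Sum>u<t. \<Sum>j<q. W (j + u * q) q) + 3 * (real q)\<^sup>2 * B"
    by (simp add: sum.distrib power2_eq_square) (rule sum.swap)
  also have "(\<Sum>u<t. \<Sum>j<q. W (j + u * q) q) = (\<Sum>u<t. \<Sum>i\<in>{u*q..<u*q+q}. W i q)"
  proof (rule sum.cong[OF refl])
    fix u
    show "(\<Sum>j<q. W (j + u * q) q) = (\<Sum>i\<in>{u*q..<u*q+q}. W i q)"
      using sum.shift_bounds_nat_ivl[of "\<lambda>i. W i q" 0 "u*q" q] by (simp add: lessThan_atLeast0 add.commute)
  qed
  also have "\<dots> = (\<Sum>i<t*q. W i q)" using sum.nat_group[of "\<lambda>i. W i q" q t] by simp
  also have "\<dots> \<le> (\<Sum>i<n. W i q)" using tq Wnn by (intro sum_mono2) auto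
  finally show ?thesis unfolding W_def by simp
qed

lemma cell_props:
  assumes P: "P \<in> finite_meas_partitions M" and x: "x \<in> space M"
  shows "cell P x \<in> P" "x \<in> cell P x" "\<And>A. A \<in> P \<Longrightarrow> x \<in> A \<Longrightarrow> cell P x = A"
proof -
  from P x obtain A where A: "A \<in> P" "x \<in> A" unfolding finite_meas_partitions_def by blast
  have *: "B = A" if "B \<in> P \<and> x \<in> B" for B
    using P A that unfolding finite_meas_partitions_def disjoint_def by blast
  have "cell P x = A" unfolding cell_def using A * by (intro the_equality) blast+
  thus "cell P x \<in> P" "x \<in> cell P x" using A by simp_all
  fix B assume "B \<in> P" "x \<in> B"
  with * \<open>cell P x = A\<close> show "cell P x = B" by blast
qed

lemma simple_cell:
  assumes P: "P \<in> finite_meas_partitions M" shows "simple_function M (cell P)"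
  unfolding simple_function_def
proof (intro conjI ballI)
  have sub: "cell P ` space M \<subseteq> P" using cell_props[OF P] by auto
  thus "finite (cell P ` space M)" using P finite_subset unfolding finite_meas_partitions_def by auto
  fix A assume "A \<in> cell P ` space M"
  hence A: "A \<in> P" using sub by auto
  hence "A \<subseteq> space M" using P unfolding finite_meas_partitions_def by auto
  hence "cell P -` {A} \<inter> space M = A" using cell_props[OF P] A by (auto simp: set_eq_iff)
  thus "cell P -` {A} \<inter> space M \<in> events" using A P unfolding finite_meas_partitions_def by auto
qed

text \<open>The join consists of the level sets of the itinerary and possibly the empty set, to
  which \<open>eta\<close> assigns 0.\<close>

lemma partition_entropy_join:
  assumes P: "P \<in> finite_meas_partitions M"
  shows "partition_entropy M (iterated_join M \<phi> P n) = ent M (itin \<phi> (cell P) n)"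
proof -
  let ?I = "itin \<phi> (cell P) n" and ?J = "iterated_join M \<phi> P n"
  define G where "G l = ?I -` {l} \<inter> space M" for l
  have GI: "G ` ?I ` space M \<subseteq> ?J"
  proof (clarify)
    fix x assume x: "x \<in> space M"
    have "G (?I x) = (\<Inter>i<n. (\<phi> ^^ i) -` cell P ((\<phi> ^^ i) x)) \<inter> space M"
    proof (intro set_eqI iffI)
      fix y assume "y \<in> G (?I x)"
      hence y: "y \<in> space M" "\<forall>i<n. cell P ((\<phi> ^^ i) y) = cell P ((\<phi> ^^ i) x)" unfolding G_def by (auto simp: itin_eq_iff)
      thus "y \<in> (\<Inter>i<n. (\<phi> ^^ i) -` cell P ((\<phi> ^^ i) x)) \<inter> space M"
        using cell_props(2)[OF P iter_in_space[OF y(1)]] by auto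
    next
      fix y assume y: "y \<in> (\<Inter>i<n. (\<phi> ^^ i) -` cell P ((\<phi> ^^ i) x)) \<inter> space M"
      hence "\<forall>i<n. cell P ((\<phi> ^^ i) y) = cell P ((\<phi> ^^ i) x)"
        using cell_props(3)[OF P iter_in_space[of y] cell_props(1)[OF P iter_in_space[OF x]]] by auto
      thus "y \<in> G (?I x)" using y unfolding G_def by (auto simp: itin_eq_iff)
    qed
    moreover have "\<forall>i<n. cell P ((\<phi> ^^ i) x) \<in> P" using cell_props(1)[OF P iter_in_space[OF x]] by auto
    ultimately show "G (?I x) \<in> ?J" unfolding iterated_join_def mem_Collect_eq by (intro exI conjI)
  qed
  have JG: "A = {} \<or> A \<in> G ` ?I ` space M" if "A \<in> ?J" for A
  proof (cases "A = {}")
    case False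
    from that have "\<exists>f. A = (\<Inter>i<n. (\<phi> ^^ i) -` (f i)) \<inter> space M \<and> (\<forall>i<n. f i \<in> P)"
      by (simp add: iterated_join_def)
    then obtain f where f: "A = (\<Inter>i<n. (\<phi> ^^ i) -` (f i)) \<inter> space M" "\<forall>i<n. f i \<in> P"
      by (elim exE conjE) (rule that)
    obtain x where x: "x \<in> A" "x \<in> space M" using False f by auto
    have c: "cell P ((\<phi> ^^ i) y) = f i" if "y \<in> A" "i < n" for y i
      using that f cell_props(3)[OF P iter_in_space] by auto
    have "A = G (?I x)"
    proof (intro set_eqI iffI)
      fix y assume "y \<in> A" thus "y \<in> G (?I x)" using c[of y] c[OF x(1)] f unfolding G_def by (auto simp: itin_eq_iff)
    next
      fix y assume "y \<in> G (?I x)"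
      hence y: "y \<in> space M" "\<forall>i<n. cell P ((\<phi> ^^ i) y) = f i" unfolding G_def using c[OF x(1)] by (auto simp: itin_eq_iff)
      thus "y \<in> A" unfolding f(1) using cell_props(2)[OF P iter_in_space[OF y(1)]] by auto
    qed
    thus ?thesis using x by auto
  qed simp
  have "simple_function M ?I" by (intro simple_itin simple_cell P)
  hence fin: "finite (?I ` space M)" by (rule simple_functionD)
  have finJ: "finite ?J" using fin JG by (intro finite_subset[of ?J "insert {} (G ` ?I ` space M)"]) auto
  have inj: "inj_on G (?I ` space M)" unfolding G_def inj_on_def by blast
  have "partition_entropy M ?J = (\<Sum>A\<in>?J. eta (prob A))"
    unfolding partition_entropy_def eta_def by (intro sum.cong) auto
  also have "\<dots> = (\<Sum>A\<in>G ` ?I ` space M. eta (prob A))"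
  proof (rule sum.mono_neutral_right[OF finJ GI])
    show "\<forall>A\<in>?J - G ` ?I ` space M. eta (prob A) = 0" using JG by fastforce
  qed
  also have "\<dots> = ent M ?I" unfolding ent_def using inj by (simp add: sum.reindex) (simp add: G_def)
  finally show ?thesis .
qed

end

locale pmp_system = measurable_system +
  assumes inv: "\<And>A. A \<in> sets M \<Longrightarrow> emeasure M (\<phi> -` A \<inter> space M) = emeasure M A"
begin

lemma distr_iter: "distr M M (\<phi> ^^ n) = M"
proof (induction n)
  case 0
  have "distr M M (\<phi> ^^ 0) = distr M M (\<lambda>x. x)" by (rule distr_cong) auto
  thus ?case by (simp add: distr_id)
next
  case (Suc n)
  have 1: "distr M M \<phi> = M" by (rule measure_eqI) (auto simp: emeasure_distr inv)
  have "distr M M (\<phi> ^^ Suc n) = distr M M (\<phi> \<circ> (\<phi> ^^ n))" by simp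
  also have "\<dots> = distr (distr M M (\<phi> ^^ n)) M \<phi>"
    by (rule distr_distr[symmetric]) auto
  also have "\<dots> = M" unfolding Suc by (rule 1)
  finally show ?case .
qed

lemma prob_iter: "A \<in> events \<Longrightarrow> prob ((\<phi> ^^ n) -` A \<inter> space M) = prob A"
  using measure_distr[OF iter_meas, of A n] distr_iter[of n] by simp

lemma integral_iter:
  fixes f :: "'a \<Rightarrow> real"
  assumes "f \<in> borel_measurable M" shows "(\<integral>x. f ((\<phi> ^^ n) x) \<partial>M) = (\<integral>x. f x \<partial>M)"
  using integral_distr[OF iter_meas assms, of n] distr_iter[of n] by simp

lemma ent_iter:
  assumes X: "simple_function M X" shows "ent M (\<lambda>x. X ((\<phi> ^^ n) x)) = ent M X"
proof -
  have sub: "(\<lambda>x. X ((\<phi> ^^ n) x)) ` space M \<subseteq> X ` space M" using iter_in_space by auto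
  have eq: "(\<lambda>x. X ((\<phi> ^^ n) x)) -` {v} \<inter> space M = (\<phi> ^^ n) -` (X -` {v} \<inter> space M) \<inter> space M" for v
    using iter_in_space by auto
  show ?thesis
    unfolding ent_superset[OF simple_functionD(1)[OF X] sub] ent_def[of M X] eq
    using prob_iter[OF simple_sets[OF X]] by simp
qed

lemma entropy_rate:
  assumes k: "simple_function M k"
  obtains l where "(\<lambda>n. ent M (itin \<phi> k n) / real n) \<longlonglongrightarrow> l" "\<And>n. n > 0 \<Longrightarrow> l \<le> ent M (itin \<phi> k n) / real n"
proof (rule subadditive_converges[of "\<lambda>n. ent M (itin \<phi> k n)"])
  fix m n
  show "ent M (itin \<phi> k (m + n)) \<le> ent M (itin \<phi> k m) + ent M (itin \<phi> k n)"
    using ent_itin_add[OF k, of m n 0] ent_iter[OF simple_itin[OF k, of n], of m] by simp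
qed (use ent_nonneg that in auto)

definition erate :: "('a \<Rightarrow> 'b) \<Rightarrow> real" where "erate k = lim (\<lambda>n. ent M (itin \<phi> k n) / real n)"

lemma erate_lim: "simple_function M k \<Longrightarrow> (\<lambda>n. ent M (itin \<phi> k n) / real n) \<longlonglongrightarrow> erate k"
  unfolding erate_def by (metis entropy_rate limI)

text \<open>The rate is an infimum over \<open>n\<close>. This bound at each finite stage is what
  lets lower bounds for entropy survive weak limits in \<open>equilibrium_closed\<close>.\<close>

lemma erate_le: "simple_function M k \<Longrightarrow> n > 0 \<Longrightarrow> erate k \<le> ent M (itin \<phi> k n) / real n"
  by (metis entropy_rate erate_lim LIMSEQ_unique)

lemma entropy_wrt_partition_eq:
  "P \<in> finite_meas_partitions M \<Longrightarrow> entropy_wrt_partition M \<phi> P = erate (cell P)"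
  unfolding entropy_wrt_partition_def erate_def by (simp add: partition_entropy_join)

lemma erate_cell_le_ks: "P \<in> finite_meas_partitions M \<Longrightarrow> ereal (erate (cell P)) \<le> ks_entropy M \<phi>"
  unfolding ks_entropy_def by (metis SUP_upper entropy_wrt_partition_eq)

lemma ks_le_iff:
  "ks_entropy M \<phi> \<le> a \<longleftrightarrow> (\<forall>P\<in>finite_meas_partitions M. ereal (erate (cell P)) \<le> a)"
  unfolding ks_entropy_def SUP_le_iff by (auto simp: entropy_wrt_partition_eq)

text \<open>The supremum runs over set partitions, while labels may have any type. A labelling and
  its partition into level sets distinguish the same orbits, so their rates agree.\<close>

lemma erate_le_ks:
  assumes k: "simple_function M k" shows "ereal (erate k) \<le> ks_entropy M \<phi>"
proof -
  define P where "P = (\<lambda>v. k -` {v} \<inter> space M) ` k ` space M"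
  have P: "P \<in> finite_meas_partitions M"
    unfolding finite_meas_partitions_def P_def disjoint_def using simple_functionD(1)[OF k] simple_sets[OF k] by auto
  have c: "cell P x = k -` {k x} \<inter> space M" if "x \<in> space M" for x
    using that by (intro cell_props(3)[OF P that]) (auto simp: P_def)
  have "ent M (itin \<phi> k n) = ent M (itin \<phi> (cell P) n)" for n
  proof (rule ent_eq_of_determined)
    fix x y assume xy: "x \<in> space M" "y \<in> space M"
    have "cell P ((\<phi> ^^ i) x) = cell P ((\<phi> ^^ i) y) \<longleftrightarrow> k ((\<phi> ^^ i) x) = k ((\<phi> ^^ i) y)" for i
      using c[OF iter_in_space[OF xy(1), of i]] c[OF iter_in_space[OF xy(2), of i]] iter_in_space[OF xy(1), of i] by auto
    thus "itin \<phi> (cell P) n x = itin \<phi> (cell P) n y \<longleftrightarrow> itin \<phi> k n x = itin \<phi> k n y"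
      by (simp add: itin_eq_iff)
  qed (intro simple_itin simple_cell P k)+
  hence "erate k = erate (cell P)" by (simp add: erate_def)
  thus ?thesis using erate_cell_le_ks[OF P] by simp
qed

end

subsection \<open>Mixtures and conditional entropy\<close>

text \<open>Only the limit 0 needs care, as \<open>ln\<close> is not continuous there. On [0, 1] the
  bound \<open>2 * sqrt p\<close> for \<open>eta p\<close> follows from
  \<open>ln u \<le> u - 1\<close> at \<open>u = 1 / sqrt p\<close>.\<close>

lemma tendsto_eta:
  assumes f: "(f \<longlongrightarrow> a) F" and nn: "\<And>x. f x \<ge> 0" and a: "a \<ge> 0"
  shows "((\<lambda>x. eta (f x)) \<longlongrightarrow> eta a) F"
proof (cases "a = 0")
  case False
  thus ?thesis unfolding eta_def using f by (intro tendsto_intros) auto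
next
  case True
  have bound: "norm (eta p) \<le> 2 * sqrt p" if "0 \<le> p" "p \<le> 1" for p
  proof (cases "p = 0")
    case False
    with that have p: "p > 0" by simp
    have "ln (1 / sqrt p) \<le> 1 / sqrt p - 1" using p by (intro ln_le_minus_one) auto
    hence "- ln p \<le> 2 * (1 / sqrt p)" using p by (simp add: ln_div ln_sqrt)
    hence "p * (- ln p) \<le> p * (2 * (1 / sqrt p))" using p by (intro mult_left_mono) auto
    also have "\<dots> = 2 * (p / sqrt p)" by simp
    also have "\<dots> = 2 * sqrt p" using p by (simp add: real_div_sqrt)
    finally show ?thesis using eta_def that p by (simp add: abs_mult mult_nonneg_nonpos)
  qed simp
  have "eventually (\<lambda>x. f x < 1) F" using order_tendstoD(2)[OF f, of 1] True by simp
  hence ev: "eventually (\<lambda>x. norm (eta (f x)) \<le> 2 * sqrt (f x)) F"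
    by eventually_elim (use bound nn in auto)
  have "((\<lambda>x. 2 * sqrt (f x)) \<longlongrightarrow> 2 * sqrt a) F" by (intro tendsto_intros f)
  hence "((\<lambda>x. 2 * sqrt (f x)) \<longlongrightarrow> 0) F" using True by simp
  from Lim_null_comparison[OF ev this] show ?thesis using True by simp
qed

lemma eta_subadditive: "0 \<le> a \<Longrightarrow> 0 \<le> b \<Longrightarrow> eta (a + b) \<le> eta a + eta b"
proof (cases "a = 0 \<or> b = 0")
  case False
  assume "0 \<le> a" "0 \<le> b"
  with False have ab: "a > 0" "b > 0" by auto
  hence "a * ln a \<le> a * ln (a + b)" "b * ln b \<le> b * ln (a + b)" by (auto intro!: mult_left_mono)
  thus ?thesis by (simp add: eta_def algebra_simps)
qed auto

lemma eta_mult: "0 \<le> a \<Longrightarrow> 0 \<le> b \<Longrightarrow> eta (a * b) = a * eta b + b * eta a"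
  by (cases "a = 0 \<or> b = 0") (auto simp: eta_def ln_mult algebra_simps)

text \<open>The defect \<open>eta t + eta (1 - t)\<close> is the entropy of the coin that decides
  between \<open>M1\<close> and \<open>M2\<close>. It does not depend on \<open>X\<close>, so for
  itineraries it disappears after division by the length.\<close>

lemma ent_mixture_le:
  assumes M: "prob_space M" "prob_space M1" "prob_space M2" and s: "sets M1 = sets M" "sets M2 = sets M"
    and t: "0 \<le> t" "t \<le> 1" and mix: "\<And>A. A \<in> sets M \<Longrightarrow> measure M A = t * measure M1 A + (1 - t) * measure M2 A"
    and X: "simple_function M X"
  shows "ent M X \<le> t * ent M1 X + (1 - t) * ent M2 X + (eta t + eta (1 - t))"
proof -
  interpret M: prob_space M by fact
  interpret M1: prob_space M1 by fact
  interpret M2: prob_space M2 by fact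
  note sp = sets_eq_imp_space_eq[OF s(1)] sets_eq_imp_space_eq[OF s(2)]
  have X1: "simple_function M1 X" and X2: "simple_function M2 X"
    using X s sp by (auto simp: simple_function_def)
  let ?A = "\<lambda>v. X -` {v} \<inter> space M"
  have ev: "?A v \<in> sets M" for v using M.simple_sets[OF X] .
  have "ent M X \<le> (\<Sum>v\<in>X ` space M. (t * eta (measure M1 (?A v)) + measure M1 (?A v) * eta t)
       + ((1 - t) * eta (measure M2 (?A v)) + measure M2 (?A v) * eta (1 - t)))"
    unfolding ent_def
  proof (rule sum_mono)
    fix v
    have "eta (measure M (?A v)) \<le> eta (t * measure M1 (?A v)) + eta ((1 - t) * measure M2 (?A v))"
      unfolding mix[OF ev] using t by (intro eta_subadditive) auto
    thus "eta (measure M (?A v)) \<le> (t * eta (measure M1 (?A v)) + measure M1 (?A v) * eta t)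
       + ((1 - t) * eta (measure M2 (?A v)) + measure M2 (?A v) * eta (1 - t))" using t by (simp add: eta_mult)
  qed
  also have "\<dots> = t * ent M1 X + (1 - t) * ent M2 X + (eta t + eta (1 - t))"
    using M1.pr_sum_1[OF X1] M2.pr_sum_1[OF X2] unfolding sp
    by (simp add: sum.distrib ent_def sum_distrib_left[symmetric] sum_distrib_right[symmetric] sp)
  finally show ?thesis .
qed

text \<open>Concavity of \<open>eta\<close>, used through its tangent at the mean
  \<open>?p v\<close>. In the application \<open>N\<close> is the law of the starting point, the
  \<open>f i\<close> are the iterates of the map, and \<open>M\<close> is the orbit average.\<close>

lemma ent_average_ge:
  assumes sp: "space N = space M" and X: "finite (X ` space M)" and f: "\<And>i x. x \<in> space M \<Longrightarrow> f i x \<in> space M"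
    and avg: "\<And>v. real n * measure M (X -` {v} \<inter> space M) = (\<Sum>i<n. measure N ((\<lambda>x. X (f i x)) -` {v} \<inter> space N))"
  shows "(\<Sum>i<n. ent N (\<lambda>x. X (f i x))) \<le> real n * ent M X"
proof -
  let ?q = "\<lambda>i v. measure N ((\<lambda>x. X (f i x)) -` {v} \<inter> space N)" and ?p = "\<lambda>v. measure M (X -` {v} \<inter> space M)"
  have "ent N (\<lambda>x. X (f i x)) = (\<Sum>v\<in>X ` space M. eta (?q i v))" for i
    using X f sp by (intro ent_superset) auto
  hence "(\<Sum>i<n. ent N (\<lambda>x. X (f i x))) = (\<Sum>v\<in>X ` space M. \<Sum>i<n. eta (?q i v))"
    by (simp add: sum.swap[of _ "{..<n}"])
  also have "\<dots> \<le> (\<Sum>v\<in>X ` space M. real n * eta (?p v))"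
  proof (rule sum_mono)
    fix v
    show "(\<Sum>i<n. eta (?q i v)) \<le> real n * eta (?p v)"
    proof (cases "?p v = 0")
      case True
      hence "\<forall>i\<in>{..<n}. ?q i v = 0" using avg[of v] by (subst sum_nonneg_eq_0_iff[symmetric]) auto
      thus ?thesis using True by simp
    next
      case False
      hence p: "?p v > 0" using measure_nonneg[of M "X -` {v} \<inter> space M"] by linarith
      have "eta q \<le> - q * ln (?p v) - q + ?p v" if "q \<ge> 0" for q
      proof (cases "q = 0")
        case False
        with that have q: "q > 0" by simp
        have "q * ln (?p v / q) \<le> q * (?p v / q - 1)"
          using p q by (intro mult_left_mono ln_le_minus_one) auto
        thus ?thesis using p q by (simp add: eta_def ln_div algebra_simps)
      qed (use p in simp)
      hence "(\<Sum>i<n. eta (?q i v)) \<le> (\<Sum>i<n. - ?q i v * ln (?p v) - ?q i v + ?p v)"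
        by (intro sum_mono) auto
      also have "\<dots> = - (\<Sum>i<n. ?q i v) * ln (?p v) - (\<Sum>i<n. ?q i v) + real n * ?p v"
        by (simp add: sum.distrib sum_subtractf sum_distrib_right sum_negf)
      also have "\<dots> = real n * eta (?p v)" unfolding avg[symmetric] by (simp add: eta_def)
      finally show ?thesis .
    qed
  qed
  also have "\<dots> = real n * ent M X" by (simp add: ent_def sum_distrib_left)
  finally show ?thesis .
qed

section \<open>Conditional entropy given a sequence of partitions\<close>

context prob_space begin

definition cond_ent :: "('a \<Rightarrow> 'b) \<Rightarrow> ('a \<Rightarrow> 'c) \<Rightarrow> real" where
  "cond_ent X Y = ent M (\<lambda>x. (X x, Y x)) - ent M Y"

lemma cond_ent_nonneg: "simple_function M X \<Longrightarrow> simple_function M Y \<Longrightarrow> 0 \<le> cond_ent X Y"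
  unfolding cond_ent_def using ent_le_of_determined[OF simple_function_Pair, of X Y Y] by simp

lemma cond_ent_mono_determined:
  assumes s: "simple_function M X" "simple_function M Y" "simple_function M Z"
    and det: "\<And>x y. x \<in> space M \<Longrightarrow> y \<in> space M \<Longrightarrow> Y x = Y y \<Longrightarrow> Z x = Z y"
  shows "cond_ent X Y \<le> cond_ent X Z"
proof -
  have "ent M (\<lambda>x. (X x, Y x)) \<le> ent M (\<lambda>x. (X x, Y x, Z x))"
    using s by (intro ent_le_of_determined simple_function_Pair) auto
  moreover have "ent M (\<lambda>x. (Y x, Z x)) \<le> ent M Y"
    by (rule ent_le_of_determined[OF s(2)]) (metis det)
  ultimately show ?thesis using ent_strong_subadditive[OF s] unfolding cond_ent_def by linarith
qed

text \<open>The set \<open>V\<close> of labels is arbitrary, so its preimage is any union of level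
  sets of \<open>S m\<close>. The condition is required for all large \<open>m\<close>, because the
  partitions \<open>S m\<close> are not assumed to refine one another.\<close>

definition approximable :: "(nat \<Rightarrow> 'a \<Rightarrow> 'c) \<Rightarrow> 'a set \<Rightarrow> bool" where
  "approximable S A \<longleftrightarrow> (\<forall>e>0. \<forall>\<^sub>F m in sequentially. \<exists>V. prob (sym_diff A (S m -` V \<inter> space M)) < e)"

text \<open>The approximable sets form a sigma-algebra. For a complement the set of labels is
  complemented. A countable union is first cut to \<open>N\<close> members up to measure
  \<open>e / 2\<close>, and each member is then approximated within
  \<open>e / (2 * (real N + 1))\<close>.\<close>

lemma approximable_sigma:
  assumes S: "\<And>m. simple_function M (S m)" and gen: "sets M = sigma_sets (space M) G"
    and G: "\<And>A. A \<in> G \<Longrightarrow> approximable S A" and A: "A \<in> events"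
  shows "approximable S A"
proof -
  have Sev: "S m -` V \<inter> space M \<in> events" for m V using simple_sets[OF S] .
  from A have "A \<in> sigma_sets (space M) G" using gen by simp
  thus ?thesis
  proof (induction rule: sigma_sets.induct)
    case Empty
    show ?case unfolding approximable_def
      by (intro allI impI always_eventually exI[of _ "{}"]) simp
  next
    case (Compl A)
    hence A: "A \<in> events" using gen by simp
    have eq: "sym_diff (space M - A) (S m -` (- V) \<inter> space M) = sym_diff A (S m -` V \<inter> space M)" for m V
      using sets.sets_into_space[OF A] by auto
    show ?case unfolding approximable_def
    proof (intro allI impI)
      fix e :: real assume "e > 0"
      with Compl.IH have "\<forall>\<^sub>F m in sequentially. \<exists>V. prob (sym_diff A (S m -` V \<inter> space M)) < e"
        unfolding approximable_def by blast
      thus "\<forall>\<^sub>F m in sequentially. \<exists>V. prob (sym_diff (space M - A) (S m -` V \<inter> space M)) < e"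
      proof eventually_elim
        case (elim m)
        then obtain V where "prob (sym_diff A (S m -` V \<inter> space M)) < e" by blast
        thus ?case by (intro exI[of _ "- V"]) (simp only: eq)
      qed
    qed
  next
    case (Union A)
    hence A: "A i \<in> events" for i using gen by simp
    show ?case unfolding approximable_def
    proof (intro allI impI)
      fix e :: real assume e: "e > 0"
      have "(\<lambda>n. prob (\<Union>i<n. A i)) \<longlonglongrightarrow> prob (\<Union>n. \<Union>i<n. A i)"
        using A by (intro finite_Lim_measure_incseq incseq_SucI) (auto simp: lessThan_Suc)
      moreover have "(\<Union>n. \<Union>i<n. A i) = (\<Union>i. A i)" by auto
      ultimately have "(\<lambda>n. prob (\<Union>i<n. A i)) \<longlonglongrightarrow> prob (\<Union>i. A i)" by simp
      hence "\<forall>\<^sub>F n in sequentially. prob (\<Union>i. A i) - e / 2 < prob (\<Union>i<n. A i)"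
        using e by (intro order_tendstoD(1)) auto
      then obtain N where N: "prob (\<Union>i. A i) - e / 2 < prob (\<Union>i<N. A i)"
        unfolding eventually_sequentially by blast
      have d: "prob ((\<Union>i. A i) - (\<Union>i<N. A i)) < e / 2"
        using N A by (subst finite_measure_Diff) auto
      have "\<forall>\<^sub>F m in sequentially. \<forall>i\<in>{..<N}. \<exists>V. prob (sym_diff (A i) (S m -` V \<inter> space M)) < e / (2 * (real N + 1))"
        using Union.IH e unfolding approximable_def by (intro eventually_ball_finite) auto
      thus "\<forall>\<^sub>F m in sequentially. \<exists>V. prob (sym_diff (\<Union> (range A)) (S m -` V \<inter> space M)) < e"
      proof eventually_elim
        case (elim m)
        then obtain V where V: "\<forall>i\<in>{..<N}. prob (sym_diff (A i) (S m -` V i \<inter> space M)) < e / (2 * (real N + 1))"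
          using bchoice[OF elim] by (elim exE) (rule that)
        define E where "E i = sym_diff (A i) (S m -` V i \<inter> space M)" for i
        have Eev: "E i \<in> events" for i unfolding E_def using A Sev by (intro sets.Un sets.Diff)
        have T: "(\<Union>i. A i) - (\<Union>i<N. A i) \<in> events" "(\<Union>i<N. E i) \<in> events" using A Eev by auto
        have sub: "sym_diff (\<Union> (range A)) (S m -` (\<Union>i<N. V i) \<inter> space M)
            \<subseteq> ((\<Union>i. A i) - (\<Union>i<N. A i)) \<union> (\<Union>i<N. E i)"
          unfolding E_def by blast
        have "prob (sym_diff (\<Union> (range A)) (S m -` (\<Union>i<N. V i) \<inter> space M))
          \<le> prob (((\<Union>i. A i) - (\<Union>i<N. A i)) \<union> (\<Union>i<N. E i))"
          by (rule finite_measure_mono[OF sub sets.Un[OF T]])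
        also have "\<dots> \<le> prob ((\<Union>i. A i) - (\<Union>i<N. A i)) + prob (\<Union>i<N. E i)"
          by (rule measure_Un_le[OF T])
        also have "prob (\<Union>i<N. E i) \<le> (\<Sum>i<N. prob (E i))"
          using Eev by (intro finite_measure_subadditive_finite) auto
        also have "\<dots> \<le> (\<Sum>i<N. e / (2 * (real N + 1)))" by (rule sum_mono) (use V in \<open>auto simp: E_def intro: less_imp_le\<close>)
        also have "\<dots> \<le> e / 2" using e by (simp add: field_simps)
        finally have "prob (sym_diff (\<Union> (range A)) (S m -` (\<Union>i<N. V i) \<inter> space M)) < e" using d by simp
        thus ?case by (rule exI)
      qed
    qed
  qed (use G in auto)
qed

text \<open>A guess \<open>r m\<close> of \<open>R\<close> is read off from \<open>S m\<close>; it
  is wrong only on \<open>Er m\<close>, whose measure tends to 0. Hence the entropies of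
  \<open>r m\<close> and of the pair of \<open>R\<close> and \<open>r m\<close> both tend to that of
  \<open>R\<close>, and their difference bounds \<open>cond_ent R (S m)\<close>. Nestedness of the
  partitions does not enter, in contrast to a martingale argument.\<close>

lemma cond_ent_tendsto_0:
  assumes S: "\<And>m. simple_function M (S m)" and R: "simple_function M R"
    and app: "\<And>A. A \<in> events \<Longrightarrow> approximable S A"
  shows "(\<lambda>m. cond_ent R (S m)) \<longlonglongrightarrow> 0"
proof -
  define J where "J = R ` space M"
  have finJ: "finite J" unfolding J_def using R by (rule simple_functionD)
  obtain j0 where j0: "j0 \<in> J" unfolding J_def using not_empty by auto
  define D where "D m j V = sym_diff (R -` {j} \<inter> space M) (S m -` V \<inter> space M)" for m j V
  have Dev: "D m j V \<in> events" for m j V unfolding D_def using simple_sets[OF R] simple_sets[OF S] by auto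
  \<comment> \<open>The infimum over label sets need not be attained; a choice within
    \<open>1 / (real m + 1)\<close> of it gives one family of sets that is good for every tolerance
    simultaneously.\<close>
  have "\<exists>V. prob (D m j V) < (INF V. prob (D m j V)) + 1 / (real m + 1)" for m j
    using cInf_lessD[of "range (\<lambda>V. prob (D m j V))" "(INF V. prob (D m j V)) + 1 / (real m + 1)"] by auto
  then obtain V where V: "\<And>m j. prob (D m j (V m j)) < (INF V. prob (D m j V)) + 1 / (real m + 1)"
    by metis
  have lim1: "(\<lambda>m. prob (D m j (V m j))) \<longlonglongrightarrow> 0" for j
  proof (rule tendstoI)
    fix e :: real assume e: "e > 0"
    have "\<forall>\<^sub>F m in sequentially. \<exists>V. prob (D m j V) < e / 2"
      using app[OF simple_sets[OF R, of "{j}"]] half_gt_zero[OF e] unfolding approximable_def D_def by blast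
    moreover have "\<forall>\<^sub>F m in sequentially. 1 / (real m + 1) < e / 2"
      using e by real_asymp
    ultimately show "\<forall>\<^sub>F m in sequentially. dist (prob (D m j (V m j))) 0 < e"
    proof eventually_elim
      case (elim m)
      then obtain V' where V': "prob (D m j V') < e / 2" by blast
      have "(INF V. prob (D m j V)) \<le> prob (D m j V')" by (intro cINF_lower bdd_belowI2[of _ 0]) auto
      with V[of m j] V' elim(2) have "prob (D m j (V m j)) < e" by linarith
      thus ?case by simp
    qed
  qed
  define \<delta> where "\<delta> m = (\<Sum>j\<in>J. prob (D m j (V m j)))" for m
  have \<delta>: "\<delta> \<longlonglongrightarrow> 0" unfolding \<delta>_def by (intro tendsto_null_sum lim1)
  \<comment> \<open>Decodes a label of \<open>S m\<close>: some \<open>j\<close> whose approximating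
    set contains it, with the default \<open>j0\<close> if there is none. Off \<open>Er m\<close>
    exactly one \<open>j\<close> qualifies.\<close>
  define \<psi> where "\<psi> m s = (if \<exists>j\<in>J. s \<in> V m j then SOME j. j \<in> J \<and> s \<in> V m j else j0)" for m s
  define r where "r m x = \<psi> m (S m x)" for m x
  have \<psi>J: "\<psi> m s \<in> J" for m s
  proof (cases "\<exists>j\<in>J. s \<in> V m j")
    case True
    hence "(SOME j. j \<in> J \<and> s \<in> V m j) \<in> J" by (metis (mono_tags, lifting) someI_ex)
    thus ?thesis using True by (simp add: \<psi>_def)
  qed (simp add: \<psi>_def j0)
  have r: "simple_function M (r m)" for m unfolding r_def using simple_function_compose[OF S[of m], of "\<psi> m"] by (simp add: comp_def)
  define Er where "Er m = (\<Union>j\<in>J. D m j (V m j))" for m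
  have Erev: "Er m \<in> events" for m unfolding Er_def using finJ Dev by auto
  have Er: "prob (Er m) \<le> \<delta> m" for m unfolding Er_def \<delta>_def using finJ Dev
    by (intro finite_measure_subadditive_finite) auto
  have eqr: "r m x = R x" if x: "x \<in> space M" "x \<notin> Er m" for m x
  proof -
    have iff: "S m x \<in> V m j \<longleftrightarrow> R x = j" if "j \<in> J" for j
      using x that unfolding Er_def D_def by blast
    have RJ: "R x \<in> J" using x unfolding J_def by auto
    have "(SOME j. j \<in> J \<and> S m x \<in> V m j) = R x"
      by (rule some_equality) (use iff RJ in auto)
    thus ?thesis unfolding r_def \<psi>_def using iff RJ by auto
  qed
  have close: "\<bar>prob A - prob B\<bar> \<le> \<delta> m" if "A \<in> events" "B \<in> events" "sym_diff A B \<subseteq> Er m" for A B m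
  proof -
    have "prob A \<le> prob (B \<union> Er m)" "prob B \<le> prob (A \<union> Er m)"
      using that Erev by (auto intro!: finite_measure_mono)
    moreover have "prob (B \<union> Er m) \<le> prob B + prob (Er m)" "prob (A \<union> Er m) \<le> prob A + prob (Er m)"
      using that Erev by (auto intro!: measure_Un_le)
    ultimately show ?thesis using Er[of m] by linarith
  qed
  have lim_close: "(\<lambda>m. prob (A m)) \<longlonglongrightarrow> prob B"
    if "\<And>m. A m \<in> events" "B \<in> events" "\<And>m. sym_diff (A m) B \<subseteq> Er m" for A B
  proof -
    have "(\<lambda>m. prob (A m) - prob B) \<longlonglongrightarrow> 0"
      by (rule Lim_null_comparison[OF _ \<delta>]) (use close that in auto)
    thus ?thesis by (simp add: LIM_zero_iff)
  qed
  have e1: "(\<lambda>m. ent M (r m)) \<longlonglongrightarrow> ent M R"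
  proof -
    have "ent M (r m) = (\<Sum>v\<in>J. eta (pr (r m) v))" for m
      using finJ \<psi>J by (intro ent_superset) (auto simp: r_def)
    moreover have "(\<lambda>m. \<Sum>v\<in>J. eta (pr (r m) v)) \<longlonglongrightarrow> (\<Sum>v\<in>J. eta (pr R v))"
      using eqr by (intro tendsto_sum tendsto_eta lim_close simple_sets r R) (auto simp: measure_nonneg)
    ultimately show ?thesis by (simp add: ent_def J_def)
  qed
  have e2: "(\<lambda>m. ent M (\<lambda>x. (R x, r m x))) \<longlonglongrightarrow> ent M R"
  proof -
    have Rr: "simple_function M (\<lambda>x. (R x, r m x))" for m using R r by (intro simple_function_Pair)
    have RR: "simple_function M (\<lambda>x. (R x, R x))" using R by (intro simple_function_Pair)
    have "ent M (\<lambda>x. (R x, r m x)) = (\<Sum>v\<in>J \<times> J. eta (pr (\<lambda>x. (R x, r m x)) v))" for m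
      using finJ \<psi>J by (intro ent_superset) (auto simp: r_def J_def)
    moreover have "(\<lambda>m. \<Sum>v\<in>J\<times>J. eta (pr (\<lambda>x. (R x, r m x)) v)) \<longlonglongrightarrow> (\<Sum>v\<in>J\<times>J. eta (pr (\<lambda>x. (R x, R x)) v))"
      using eqr by (intro tendsto_sum tendsto_eta lim_close simple_sets Rr RR) (auto simp: measure_nonneg)
    moreover have "(\<Sum>v\<in>J\<times>J. eta (pr (\<lambda>x. (R x, R x)) v)) = ent M (\<lambda>x. (R x, R x))"
      using finJ by (intro ent_superset[symmetric]) (auto simp: J_def)
    moreover have "\<dots> = ent M R" using R RR by (intro ent_eq_of_determined) auto
    ultimately show ?thesis by simp
  qed
  have ub: "cond_ent R (S m) \<le> ent M (\<lambda>x. (R x, r m x)) - ent M (r m)" for m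
    using cond_ent_mono_determined[OF R S[of m] r[of m]] unfolding cond_ent_def r_def by auto
  have "(\<lambda>m. ent M (\<lambda>x. (R x, r m x)) - ent M (r m)) \<longlonglongrightarrow> ent M R - ent M R"
    by (intro tendsto_diff e1 e2)
  hence "(\<lambda>m. ent M (\<lambda>x. (R x, r m x)) - ent M (r m)) \<longlonglongrightarrow> 0" by simp
  from tendsto_sandwich[OF _ _ tendsto_const[of 0] this] show ?thesis
    using ub cond_ent_nonneg[OF R S] by auto
qed

end

section \<open>Entropy rates bounded by a sequence of partitions\<close>

context pmp_system begin

text \<open>The labels of \<open>R\<close> are revealed one at a time beside \<open>S n\<close>.
  Since \<open>S n\<close> determines \<open>S (n - j)\<close> at the \<open>j\<close>-th image, the
  \<open>j\<close>-th label costs at most the conditional entropy of \<open>R\<close> given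
  \<open>S (n - j)\<close>, after a shift by invariance.\<close>

lemma ent_itin_le_cond_ent_sum:
  fixes R :: "'a \<Rightarrow> 'b" and S :: "nat \<Rightarrow> 'a \<Rightarrow> 'c"
  assumes R: "simple_function M R" and S: "\<And>n. simple_function M (S n)"
    and det: "\<And>n i x y. i \<le> n \<Longrightarrow> x \<in> space M \<Longrightarrow> y \<in> space M \<Longrightarrow> S n x = S n y \<Longrightarrow>
        S (n - i) ((\<phi> ^^ i) x) = S (n - i) ((\<phi> ^^ i) y)"
  shows "ent M (itin \<phi> R n) \<le> ent M (S n) + (\<Sum>m=1..n. cond_ent R (S m))"
proof -
  have step: "ent M (\<lambda>x. (itin \<phi> R j x, S n x)) \<le> ent M (S n) + (\<Sum>i<j. cond_ent R (S (n - i)))" if "j \<le> n" for j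
    using that
  proof (induction j)
    case 0
    have "ent M (\<lambda>x. (itin \<phi> R 0 x, S n x)) \<le> ent M (S n)"
      by (rule ent_le_of_determined[OF S]) (auto simp: itin_def)
    thus ?case by simp
  next
    case (Suc j)
    let ?R = "\<lambda>x. R ((\<phi> ^^ j) x)"
    have sR: "simple_function M ?R" and sI: "simple_function M (itin \<phi> R j)" and sS: "simple_function M (\<lambda>x. S (n - j) ((\<phi> ^^ j) x))"
      using R S simple_iter simple_itin by auto
    have "ent M (\<lambda>x. (itin \<phi> R (Suc j) x, S n x)) \<le> ent M (\<lambda>x. (?R x, itin \<phi> R j x, S n x))"
    proof (rule ent_le_of_determined)
      show "simple_function M (\<lambda>x. (?R x, itin \<phi> R j x, S n x))" by (intro simple_function_Pair sR sI S)
    qed (auto simp: itin_def)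
    also have "\<dots> \<le> cond_ent ?R (S n) + ent M (\<lambda>x. (itin \<phi> R j x, S n x))"
      using ent_strong_subadditive[OF sR sI S[of n]] by (simp add: cond_ent_def)
    also have "cond_ent ?R (S n) \<le> cond_ent ?R (\<lambda>x. S (n - j) ((\<phi> ^^ j) x))"
    proof (rule cond_ent_mono_determined[OF sR S sS])
      fix x y assume "x \<in> space M" "y \<in> space M" "S n x = S n y"
      thus "S (n - j) ((\<phi> ^^ j) x) = S (n - j) ((\<phi> ^^ j) y)" using Suc.prems by (intro det) auto
    qed
    also have "\<dots> = cond_ent R (S (n - j))"
      unfolding cond_ent_def using ent_iter[OF simple_function_Pair[OF R S[of "n-j"]], of j] ent_iter[OF S[of "n-j"], of j] by simp
    finally show ?case using Suc by simp
  qed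
  have "ent M (itin \<phi> R n) \<le> ent M (\<lambda>x. (itin \<phi> R n x, S n x))"
    using simple_itin[OF R] S by (intro ent_le_of_determined simple_function_Pair) auto
  also have "\<dots> \<le> ent M (S n) + (\<Sum>i<n. cond_ent R (S (n - i)))" by (rule step) simp
  also have "(\<Sum>i<n. cond_ent R (S (n - i))) = (\<Sum>m=1..n. cond_ent R (S m))"
    by (rule sum.reindex_bij_witness[of _ "\<lambda>m. n - m" "\<lambda>i. n - i"]) auto
  finally show ?thesis .
qed

text \<open>The conditional entropies tend to 0, hence so do their averages, and the rate of
  \<open>R\<close> is governed by \<open>ent M (S n)\<close> alone. With \<open>S n\<close> an
  itinerary this is the generator theorem; the upper bound for the pressure uses partitions
  \<open>S n\<close> that are not itineraries.\<close>

lemma erate_le_of_refining: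
  fixes R :: "'a \<Rightarrow> 'b" and S :: "nat \<Rightarrow> 'a \<Rightarrow> 'c"
  assumes R: "simple_function M R" and S: "\<And>n. simple_function M (S n)"
    and det: "\<And>n i x y. i \<le> n \<Longrightarrow> x \<in> space M \<Longrightarrow> y \<in> space M \<Longrightarrow> S n x = S n y \<Longrightarrow>
        S (n - i) ((\<phi> ^^ i) x) = S (n - i) ((\<phi> ^^ i) y)"
    and app: "\<And>A. A \<in> events \<Longrightarrow> approximable S A"
    and L: "\<And>n. n \<ge> N0 \<Longrightarrow> ent M (S n) \<le> a + real n * L"
  shows "erate R \<le> L"
proof (rule field_le_epsilon)
  fix e :: real assume e: "e > 0"
  have "\<forall>\<^sub>F m in sequentially. cond_ent R (S m) < e"
    using cond_ent_tendsto_0[OF S R app] e by (intro order_tendstoD(2)) auto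
  then obtain N where N: "\<And>m. m \<ge> N \<Longrightarrow> cond_ent R (S m) \<le> e" unfolding eventually_sequentially by (meson less_imp_le)
  define C where "C = (\<Sum>m\<le>N. cond_ent R (S m))"
  have Csum: "(\<Sum>m=1..n. cond_ent R (S m)) \<le> C + real n * e" for n
  proof -
    have "(\<Sum>m=1..n. cond_ent R (S m)) \<le> (\<Sum>m=1..n. (if m \<le> N then cond_ent R (S m) else 0) + e)"
      using N e by (intro sum_mono) auto
    also have "\<dots> = (\<Sum>m=1..n. if m \<le> N then cond_ent R (S m) else 0) + real n * e" by (simp add: sum.distrib)
    also have "(\<Sum>m=1..n. if m \<le> N then cond_ent R (S m) else 0) = (\<Sum>m\<in>{1..n} \<inter> {..N}. cond_ent R (S m))"
      by (subst sum.inter_restrict) auto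
    also have "\<dots> \<le> C" unfolding C_def using cond_ent_nonneg[OF R S] by (intro sum_mono2) auto
    finally show ?thesis by simp
  qed
  have bd: "ent M (itin \<phi> R n) / real n \<le> (a + C) / real n + (L + e)" if "n \<ge> max 1 N0" for n
  proof -
    have "ent M (itin \<phi> R n) \<le> ent M (S n) + (\<Sum>m=1..n. cond_ent R (S m))"
      by (rule ent_itin_le_cond_ent_sum[OF R S]) (rule det)
    hence "ent M (itin \<phi> R n) \<le> a + C + real n * (L + e)"
      using Csum[of n] L[of n] that by (simp add: algebra_simps)
    thus ?thesis using that by (simp add: field_simps)
  qed
  have "(\<lambda>n. (a + C) / real n + (L + e)) \<longlonglongrightarrow> 0 + (L + e)"
    by (intro tendsto_intros lim_const_over_n)
  hence lim: "(\<lambda>n. (a + C) / real n + (L + e)) \<longlonglongrightarrow> L + e" by simp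
  show "erate R \<le> L + e"
    by (rule LIMSEQ_le[OF erate_lim[OF R] lim]) (use bd in blast)
qed

end

subsection \<open>Expanding maps\<close>

locale compact_metric = Metric_space S d for S :: "'a set" and d +
  assumes compact: "compact_space mtopology" and nonempty: "S \<noteq> {}"
begin

lemma continuous_map_metric_iff:
  fixes f :: "'a \<Rightarrow> 'b::real_normed_vector"
  shows "continuous_map mtopology euclidean f \<longleftrightarrow>
    (\<forall>x\<in>S. \<forall>\<epsilon>>0. \<exists>\<delta>>0. \<forall>y\<in>S. d x y < \<delta> \<longrightarrow> dist (f x) (f y) < \<epsilon>)"
  using metric_continuous_map[OF Met_TC.Metric_space_axioms, of f] by (simp add: image_subset_iff imp_conjL Ball_def)

lemma uniformly_continuous:
  fixes f :: "'a \<Rightarrow> 'b::real_normed_vector"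
  assumes f: "continuous_map mtopology euclidean f" and \<epsilon>: "\<epsilon> > 0"
  obtains \<delta> where "\<delta> > 0" "\<And>x y. x \<in> S \<Longrightarrow> y \<in> S \<Longrightarrow> d x y < \<delta> \<Longrightarrow> dist (f x) (f y) < \<epsilon>"
proof -
  have "uniformly_continuous_map Self euclidean_metric f"
    using f compact by (intro continuous_imp_uniformly_continuous_map) (auto simp: mtopology_of_def)
  then obtain \<delta> where "\<delta> > 0" "\<forall>x\<in>S. \<forall>y\<in>S. d y x < \<delta> \<longrightarrow> dist (f y) (f x) < \<epsilon>"
    unfolding uniformly_continuous_map_def using \<epsilon> by auto
  thus ?thesis using that[of \<delta>] by metis
qed

lemma continuous_bounded:
  fixes f :: "'a \<Rightarrow> 'b::real_normed_vector"
  assumes f: "continuous_map mtopology euclidean f"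
  obtains B where "B > 0" "\<And>x. x \<in> S \<Longrightarrow> norm (f x) \<le> B"
proof -
  have "compactin euclidean (f ` S)"
    using image_compactin[OF _ f, of S] compact by (simp add: compact_space_def)
  hence "bounded (f ` S)" using compact_imp_bounded by auto
  then obtain B where "B > 0" "\<forall>y\<in>f ` S. norm y \<le> B" unfolding bounded_pos by blast
  thus ?thesis using that[of B] by auto
qed

lemma finite_net:
  assumes "\<epsilon> > 0" obtains K where "finite K" "K \<subseteq> S" "\<And>x. x \<in> S \<Longrightarrow> \<exists>k\<in>K. d k x < \<epsilon>"
proof -
  have "compactin mtopology S" using compact by (simp add: compact_space_def)
  from compactin_imp_mtotally_bounded[OF this, unfolded mtotally_bounded_def, rule_format, OF assms]
  obtain K where K: "finite K" "K \<subseteq> S" "S \<subseteq> (\<Union>x\<in>K. mball x \<epsilon>)"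
    by (elim exE conjE) (rule that)
  have "\<exists>k\<in>K. d k x < \<epsilon>" if "x \<in> S" for x
    using subsetD[OF K(3) that] by (auto simp: in_mball)
  from that[OF K(1,2) this] show ?thesis by simp
qed

end

locale expanding_system = compact_metric S d for S :: "'a set" and d +
  fixes \<phi> :: "'a \<Rightarrow> 'a" and e \<theta> :: real
  assumes cont: "continuous_map mtopology mtopology \<phi>" and openm: "open_map mtopology mtopology \<phi>"
    and e_pos: "e > 0" and \<theta>_gt1: "\<theta> > 1"
    and expand: "\<And>x y. x \<in> S \<Longrightarrow> y \<in> S \<Longrightarrow> d x y < e \<Longrightarrow> \<theta> * d x y \<le> d (\<phi> x) (\<phi> y)"
begin

lemma \<phi>_S: "x \<in> S \<Longrightarrow> \<phi> x \<in> S"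
  using continuous_map_image_subset_topspace[OF cont] by auto

lemma iter_S: "x \<in> S \<Longrightarrow> (\<phi> ^^ n) x \<in> S"
  by (induction n) (auto simp: \<phi>_S)

lemma cont_iter: "continuous_map mtopology mtopology (\<phi> ^^ n)"
proof (induction n)
  case 0 show ?case by (simp add: id_def)
next
  case (Suc n) show ?case using continuous_map_compose[OF Suc cont] by (simp add: o_def)
qed

text \<open>Openness gives a lifting radius at each point and compactness makes it uniform. Bad
  pairs would accumulate at some \<open>l\<close>; the image of a small ball about \<open>l\<close>
  contains a ball about its image, and this lifts a late \<open>y n\<close> close to
  \<open>x n\<close>.\<close>

lemma ex_lift_radius:
  assumes \<eta>: "\<eta> > 0"
  shows "\<exists>\<delta>>0. \<forall>x\<in>S. \<forall>y\<in>S. d (\<phi> x) y < \<delta> \<longrightarrow> (\<exists>x'\<in>S. \<phi> x' = y \<and> d x x' < \<eta>)"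
proof (rule ccontr)
  assume not: "\<not> ?thesis"
  have "\<exists>x y. x \<in> S \<and> y \<in> S \<and> d (\<phi> x) y < 1 / (real n + 1) \<and> (\<forall>x'\<in>S. \<phi> x' = y \<longrightarrow> \<not> d x x' < \<eta>)" for n
  proof -
    have "1 / (real n + 1) > 0" by simp
    with not show ?thesis by blast
  qed
  then obtain x y where xy: "\<And>n. x n \<in> S" "\<And>n. y n \<in> S" "\<And>n. d (\<phi> (x n)) (y n) < 1 / (real n + 1)"
      "\<And>n x'. x' \<in> S \<Longrightarrow> \<phi> x' = y n \<Longrightarrow> \<not> d (x n) x' < \<eta>" by metis
  from compact xy(1) obtain l r where lift_radius: "l \<in> S" "strict_mono r" "limitin mtopology (x \<circ> r) l sequentially"
    unfolding compact_space_sequentially by blast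
  have "openin mtopology (\<phi> ` mball l (\<eta> / 2))" using openm unfolding open_map_def by auto
  moreover have "\<phi> l \<in> \<phi> ` mball l (\<eta> / 2)" using lift_radius(1) \<eta> by (intro imageI) (simp add: in_mball)
  ultimately obtain \<rho> where \<rho>: "\<rho> > 0" "mball (\<phi> l) \<rho> \<subseteq> \<phi> ` mball l (\<eta> / 2)"
    unfolding openin_mtopology by blast
  have 1: "\<forall>\<^sub>F n in sequentially. d (x (r n)) l < \<eta> / 2"
    using lift_radius(3) \<eta> unfolding limitin_metric by (auto elim!: allE[of _ "\<eta> / 2"] eventually_mono)
  have 2: "\<forall>\<^sub>F n in sequentially. d (\<phi> (x (r n))) (\<phi> l) < \<rho> / 2"
    using continuous_map_limit[OF cont lift_radius(3)] \<rho> unfolding limitin_metric by (auto elim!: allE[of _ "\<rho> / 2"] eventually_mono)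
  have 3: "\<forall>\<^sub>F n in sequentially. 1 / (real n + 1) < \<rho> / 2" using \<rho>(1) by real_asymp
  have "\<forall>\<^sub>F n in sequentially. False" using 1 2 eventually_subseq[OF lift_radius(2) 3]
  proof eventually_elim
    case (elim n)
    have "d (\<phi> l) (y (r n)) \<le> d (\<phi> l) (\<phi> (x (r n))) + d (\<phi> (x (r n))) (y (r n))"
      using xy lift_radius \<phi>_S by (intro triangle) auto
    also have "\<dots> < \<rho>" using elim xy(3)[of "r n"] by (simp add: commute)
    finally have "y (r n) \<in> mball (\<phi> l) \<rho>" using xy lift_radius \<phi>_S by (simp add: in_mball)
    hence "y (r n) \<in> \<phi> ` mball l (\<eta> / 2)" using \<rho>(2) by blast
    then obtain x' where x': "x' \<in> S" "d l x' < \<eta> / 2" "\<phi> x' = y (r n)" by (auto simp: in_mball)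
    have "d (x (r n)) x' \<le> d (x (r n)) l + d l x'" using xy lift_radius x' by (intro triangle) auto
    hence "d (x (r n)) x' < \<eta>" using elim x' by simp
    thus False using xy(4)[OF x'(1) x'(3)] by simp
  qed
  thus False by simp
qed

text \<open>The cap \<open>e / 2\<close> makes close lifts unique: two lifts of the same point that
  lie within this radius of one point are less than \<open>e\<close> apart, and the map is injective
  at that scale.\<close>

definition lift_radius :: real where
  "lift_radius = (SOME \<delta>. \<delta> > 0 \<and> \<delta> \<le> e / 2 \<and> (\<forall>x\<in>S. \<forall>y\<in>S. d (\<phi> x) y < \<delta> \<longrightarrow> (\<exists>x'\<in>S. \<phi> x' = y \<and> d x x' < e)))"

lemma lift_radius: "lift_radius > 0" "lift_radius \<le> e / 2"
  and lift_radius_lift: "\<And>x y. x \<in> S \<Longrightarrow> y \<in> S \<Longrightarrow> d (\<phi> x) y < lift_radius \<Longrightarrow> \<exists>x'\<in>S. \<phi> x' = y \<and> d x x' < e"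
proof -
  from ex_lift_radius[OF e_pos] obtain \<delta> where \<delta>: "\<delta> > 0"
    "\<forall>x\<in>S. \<forall>y\<in>S. d (\<phi> x) y < \<delta> \<longrightarrow> (\<exists>x'\<in>S. \<phi> x' = y \<and> d x x' < e)" by blast
  let ?P = "\<lambda>\<delta>. \<delta> > 0 \<and> \<delta> \<le> e / 2 \<and> (\<forall>x\<in>S. \<forall>y\<in>S. d (\<phi> x) y < \<delta> \<longrightarrow> (\<exists>x'\<in>S. \<phi> x' = y \<and> d x x' < e))"
  have "?P (min \<delta> (e / 2))" using \<delta> e_pos by auto
  hence "?P lift_radius" unfolding lift_radius_def by (rule someI)
  thus "lift_radius > 0" "lift_radius \<le> e / 2" "\<And>x y. x \<in> S \<Longrightarrow> y \<in> S \<Longrightarrow> d (\<phi> x) y < lift_radius \<Longrightarrow> \<exists>x'\<in>S. \<phi> x' = y \<and> d x x' < e" by blast+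
qed

lemma lift:
  assumes "x \<in> S" "y \<in> S" "d (\<phi> x) y < lift_radius"
  obtains x' where "x' \<in> S" "\<phi> x' = y" "d x x' \<le> d (\<phi> x) y / \<theta>"
proof -
  obtain x' where x': "x' \<in> S" "\<phi> x' = y" "d x x' < e" using lift_radius_lift assms by blast
  have "\<theta> * d x x' \<le> d (\<phi> x) y" using expand[of x x'] x' assms by auto
  hence "d x x' \<le> d (\<phi> x) y / \<theta>" using \<theta>_gt1 by (simp add: field_simps)
  with x' that show ?thesis by blast
qed

lemma div_\<theta>_le: "0 \<le> a \<Longrightarrow> a / \<theta> \<le> a"
  using \<theta>_gt1 by (simp add: divide_le_eq mult_le_cancel_left1)

lemma separation:
  assumes "x \<in> S" "y \<in> S" "\<And>i. i < n \<Longrightarrow> d ((\<phi> ^^ i) x) ((\<phi> ^^ i) y) < e"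
  shows "\<theta> ^ n * d x y \<le> d ((\<phi> ^^ n) x) ((\<phi> ^^ n) y)"
  using assms(3)
proof (induction n)
  case (Suc n)
  have "\<theta> ^ Suc n * d x y = \<theta> * (\<theta> ^ n * d x y)" by simp
  also have "\<dots> \<le> \<theta> * d ((\<phi> ^^ n) x) ((\<phi> ^^ n) y)" using Suc \<theta>_gt1 by (intro mult_left_mono) auto
  also have "\<dots> \<le> d (\<phi> ((\<phi> ^^ n) x)) (\<phi> ((\<phi> ^^ n) y))" using Suc assms iter_S by (intro expand) auto
  finally show ?case by simp
qed simp

lemma separation_eq:
  assumes "x \<in> S" "y \<in> S" "\<And>i. i < n \<Longrightarrow> d ((\<phi> ^^ i) x) ((\<phi> ^^ i) y) < e" "(\<phi> ^^ n) x = (\<phi> ^^ n) y"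
  shows "x = y"
proof -
  have "\<theta> ^ n * d x y \<le> d ((\<phi> ^^ n) x) ((\<phi> ^^ n) y)"
    by (rule separation) (use assms in auto)
  hence "\<theta> ^ n * d x y \<le> 0" using assms iter_S by simp
  moreover have "\<theta> ^ n > 0" using \<theta>_gt1 by simp
  ultimately have "d x y \<le> 0" by (simp add: mult_le_0_iff)
  thus ?thesis using assms by (simp add: order_antisym_conv)
qed

text \<open>The inverse branch is followed backwards along the orbit of \<open>x\<close>. Every step
  contracts by \<open>\<theta>\<close>, so the distance stays below \<open>lift_radius\<close> and
  the next lift exists.\<close>

lemma lift_iter:
  assumes "x \<in> S" "y \<in> S" "d ((\<phi> ^^ n) x) y < lift_radius"
  shows "\<exists>z\<in>S. (\<phi> ^^ n) z = y \<and> (\<forall>i\<le>n. d ((\<phi> ^^ i) x) ((\<phi> ^^ i) z) \<le> d ((\<phi> ^^ n) x) y / \<theta> ^ (n - i))"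
  using assms(2,3)
proof (induction n arbitrary: y)
  case 0 thus ?case using assms by (intro bexI[of _ y]) auto
next
  case (Suc n)
  let ?D = "d ((\<phi> ^^ Suc n) x) y"
  obtain w where w: "w \<in> S" "\<phi> w = y" "d ((\<phi> ^^ n) x) w \<le> ?D / \<theta>"
    using lift[of "(\<phi> ^^ n) x" y] Suc assms iter_S by auto
  have "?D / \<theta> \<le> ?D" by (rule div_\<theta>_le) simp
  hence "d ((\<phi> ^^ n) x) w < lift_radius" using w Suc by linarith
  from Suc.IH[OF w(1) this] obtain z where z: "z \<in> S" "(\<phi> ^^ n) z = w"
     "\<forall>i\<le>n. d ((\<phi> ^^ i) x) ((\<phi> ^^ i) z) \<le> d ((\<phi> ^^ n) x) w / \<theta> ^ (n - i)" by blast
  show ?case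
  proof (intro bexI conjI allI impI)
    show "(\<phi> ^^ Suc n) z = y" using z w by simp
    fix i assume i: "i \<le> Suc n"
    show "d ((\<phi> ^^ i) x) ((\<phi> ^^ i) z) \<le> ?D / \<theta> ^ (Suc n - i)"
    proof (cases "i = Suc n")
      case True
      have "(\<phi> ^^ Suc n) z = y" using z w by simp
      thus ?thesis using True by simp
    next
      case False
      hence "d ((\<phi> ^^ i) x) ((\<phi> ^^ i) z) \<le> d ((\<phi> ^^ n) x) w / \<theta> ^ (n - i)" using z i by auto
      also have "\<dots> \<le> ?D / \<theta> / \<theta> ^ (n - i)" using w \<theta>_gt1 by (intro divide_right_mono) auto
      also have "\<dots> = ?D / \<theta> ^ (Suc n - i)" using False i by (simp add: Suc_diff_le)
      finally show ?thesis .
    qed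
  qed (use z in auto)
qed

subsection \<open>Fibres and the transfer operator\<close>

definition fib :: "nat \<Rightarrow> 'a \<Rightarrow> 'a set" where "fib n y = {x \<in> S. (\<phi> ^^ n) x = y}"

lemma fib_subset: "fib n y \<subseteq> S" by (auto simp: fib_def)

definition pre :: "'a \<Rightarrow> 'a set" where "pre y = {x \<in> S. \<phi> x = y}"

lemma pre_subset: "pre y \<subseteq> S" by (auto simp: pre_def)

text \<open>Distinct points with the same image are at least \<open>e\<close> apart, so sending each
  to a net point within \<open>e / 2\<close> is injective. The successor of the size of the net
  serves as \<open>K\<close> to keep it positive.\<close>

lemma fib_bound: "\<exists>K>0. \<forall>y. finite (pre y) \<and> card (pre y) \<le> K"
proof -
  obtain K where K: "finite K" "K \<subseteq> S" "\<And>x. x \<in> S \<Longrightarrow> \<exists>k\<in>K. d k x < e / 2"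
    using finite_net[of "e / 2"] e_pos by auto
  then obtain f where f: "\<And>x. x \<in> S \<Longrightarrow> f x \<in> K \<and> d (f x) x < e / 2" by metis
  have inj: "inj_on f (pre y)" for y
  proof (rule inj_onI)
    fix a b assume ab: "a \<in> pre y" "b \<in> pre y" "f a = f b"
    hence S: "a \<in> S" "b \<in> S" using pre_subset by auto
    hence S': "f a \<in> S" using f K by auto
    have "d a b \<le> d a (f a) + d (f a) b" using S S' by (intro triangle) auto
    also have "\<dots> < e" using f[of a] f[of b] S ab by (simp add: commute)
    finally show "a = b" using separation_eq[of a b 1] S ab by (auto simp: pre_def)
  qed
  have sub: "f ` pre y \<subseteq> K" for y using f pre_subset by blast
  have "finite (pre y) \<and> card (pre y) \<le> Suc (card K)" for y
    using inj_on_finite[OF inj sub K(1)] card_inj_on_le[OF inj sub K(1)] by (simp add: le_SucI)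
  thus ?thesis by (intro exI[of _ "Suc (card K)"]) auto
qed

lemma fib_Suc: "fib (Suc n) y = (\<Union>x\<in>pre y. fib n x)"
  by (auto simp: fib_def pre_def iter_S)

lemma finite_fib: "finite (fib n y)"
proof (induction n arbitrary: y)
  case 0
  have "fib 0 y \<subseteq> {y}" by (auto simp: fib_def)
  thus ?case using finite_subset by blast
next
  case (Suc n) thus ?case unfolding fib_Suc using fib_bound by blast
qed

text \<open>Close points have fibres matched by a bijection: lifts exist in both directions, and
  \<open>lift_radius \<le> e / 2\<close> makes partners unique. The value type is general in order
  to serve real and complex functions. Dividing \<open>\<epsilon>\<close> by \<open>?N + 1\<close>
  covers the empty fibre and keeps the final inequality strict.\<close>

lemma fib_sum_continuous:
  fixes f :: "'a \<Rightarrow> 'b::real_normed_vector"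
  assumes f: "continuous_map mtopology euclidean f"
  shows "continuous_map mtopology euclidean (\<lambda>y. \<Sum>x\<in>pre y. f x)"
  unfolding continuous_map_metric_iff
proof (intro ballI allI impI)
  fix y and \<epsilon> :: real assume y: "y \<in> S" and \<epsilon>: "\<epsilon> > 0"
  let ?N = "real (card (pre y))"
  have "\<epsilon> / (?N + 1) > 0" using \<epsilon> by (intro divide_pos_pos) auto
  from uniformly_continuous[OF f this] obtain \<eta> where \<eta>: "\<eta> > 0"
    "\<And>x y. x \<in> S \<Longrightarrow> y \<in> S \<Longrightarrow> d x y < \<eta> \<Longrightarrow> dist (f x) (f y) < \<epsilon> / (?N + 1)" by metis
  show "\<exists>\<delta>>0. \<forall>y'\<in>S. d y y' < \<delta> \<longrightarrow> dist (\<Sum>x\<in>pre y. f x) (\<Sum>x\<in>pre y'. f x) < \<epsilon>"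
  proof (intro exI[of _ "min lift_radius \<eta>"] conjI ballI impI)
    show "min lift_radius \<eta> > 0" using lift_radius \<eta> by simp
    fix y' assume y': "y' \<in> S" "d y y' < min lift_radius \<eta>"
    let ?R = "\<lambda>a b. a \<in> S \<and> b \<in> S \<and> \<phi> a = y \<and> \<phi> b = y' \<and> d a b \<le> d y y' / \<theta>"
    have small: "d y y' / \<theta> \<le> d y y'" by (rule div_\<theta>_le) simp
    have R1: "\<exists>b. ?R a b" if "a \<in> pre y" for a
      using lift[of a y'] that y' unfolding pre_def by (metis (mono_tags, lifting) mem_Collect_eq min_less_iff_conj)
    have R2: "\<exists>a. ?R a b" if "b \<in> pre y'" for b
    proof -
      have b: "b \<in> S" "\<phi> b = y'" using that unfolding pre_def by auto
      have "d (\<phi> b) y < lift_radius" using b y' by (simp add: commute)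
      from lift[OF b(1) y this] obtain a where "a \<in> S" "\<phi> a = y" "d b a \<le> d (\<phi> b) y / \<theta>" .
      thus ?thesis using b by (auto simp: commute)
    qed
    have lt: "d a b < e / 2" if "?R a b" for a b using that small y' lift_radius by linarith
    have U1: "b = b'" if "?R a b" "?R a b'" for a b b'
    proof -
      have "d b b' \<le> d b a + d a b'" using that by (intro triangle) auto
      hence "d b b' < e" using lt[OF that(1)] lt[OF that(2)] by (simp add: commute)
      thus ?thesis using separation_eq[of b b' 1] that by auto
    qed
    have U2: "a = a'" if "?R a b" "?R a' b" for a a' b
    proof -
      have "d a a' \<le> d a b + d b a'" using that by (intro triangle) auto
      hence "d a a' < e" using lt[OF that(1)] lt[OF that(2)] by (simp add: commute)
      thus ?thesis using separation_eq[of a a' 1] that by auto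
    qed
    define \<beta> where "\<beta> a = (SOME b. ?R a b)" for a
    have \<beta>: "?R a (\<beta> a)" if "a \<in> pre y" for a unfolding \<beta>_def by (rule someI_ex[OF R1[OF that]])
    have "bij_betw \<beta> (pre y) (pre y')"
      unfolding bij_betw_def
    proof (intro conjI equalityI subsetI)
      show "inj_on \<beta> (pre y)" by (rule inj_onI) (metis U2 \<beta>)
      show "b \<in> pre y'" if "b \<in> \<beta> ` pre y" for b
      proof -
        from that obtain a where "a \<in> pre y" "b = \<beta> a" by (rule imageE)
        with \<beta>[of a] show ?thesis unfolding pre_def by blast
      qed
      show "b \<in> \<beta> ` pre y" if "b \<in> pre y'" for b
      proof -
        obtain a where a: "?R a b" using R2[OF \<open>b \<in> pre y'\<close>] by blast
        hence "a \<in> pre y" unfolding pre_def by blast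
        with U1[OF a \<beta>[OF this]] show ?thesis by blast
      qed
    qed
    hence "(\<Sum>x\<in>pre y'. f x) = (\<Sum>x\<in>pre y. f (\<beta> x))" by (simp add: sum.reindex_bij_betw)
    hence "dist (\<Sum>x\<in>pre y. f x) (\<Sum>x\<in>pre y'. f x) = norm (\<Sum>x\<in>pre y. f x - f (\<beta> x))"
      by (simp add: dist_norm sum_subtractf)
    also have "\<dots> \<le> (\<Sum>x\<in>pre y. dist (f x) (f (\<beta> x)))" unfolding dist_norm by (rule norm_sum)
    also have "\<dots> \<le> (\<Sum>x\<in>pre y. \<epsilon> / (?N + 1))"
    proof (intro sum_mono less_imp_le \<eta>(2))
      fix x assume x: "x \<in> pre y"
      show "x \<in> S" "\<beta> x \<in> S" using \<beta>[OF x] by auto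
      show "d x (\<beta> x) < \<eta>" using \<beta>[OF x] small y' by linarith
    qed
    also have "\<dots> = ?N / (?N + 1) * \<epsilon>" by simp
    also have "\<dots> < 1 * \<epsilon>" using \<epsilon> by (intro mult_strict_right_mono) (auto simp: divide_simps)
    finally show "dist (\<Sum>x\<in>pre y. f x) (\<Sum>x\<in>pre y'. f x) < \<epsilon>" by simp
  qed
qed

text \<open>The transfer operator on real functions. Order arguments are carried out for it, while
  the complex operator \<open>RPF\<close> enters only in the identification of the spectral
  radius.\<close>

definition Lop :: "('a \<Rightarrow> real) \<Rightarrow> ('a \<Rightarrow> real) \<Rightarrow> 'a \<Rightarrow> real" where
  "Lop c f y = (\<Sum>x\<in>pre y. c x * f x)"

definition orbit_prod :: "('a \<Rightarrow> real) \<Rightarrow> nat \<Rightarrow> 'a \<Rightarrow> real" where "orbit_prod c n x = (\<Prod>i<n. c ((\<phi> ^^ i) x))"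

lemma Lop_continuous:
  assumes "continuous_map mtopology euclideanreal c" "continuous_map mtopology euclideanreal f"
  shows "continuous_map mtopology euclideanreal (Lop c f)"
  unfolding Lop_def[abs_def] using assms by (intro fib_sum_continuous continuous_intros)

lemma Lop_iter_continuous:
  assumes "continuous_map mtopology euclideanreal c" "continuous_map mtopology euclideanreal f"
  shows "continuous_map mtopology euclideanreal ((Lop c ^^ n) f)"
  by (induction n) (use assms Lop_continuous in auto)

lemma Lop_iter_eq:
  assumes "y \<in> S" shows "(Lop c ^^ n) f y = (\<Sum>x\<in>fib n y. orbit_prod c n x * f x)"
  using assms
proof (induction n arbitrary: y)
  case 0
  hence "fib 0 y = {y}" by (auto simp: fib_def)
  thus ?case by (simp add: orbit_prod_def)
next
  case (Suc n)
  have "(Lop c ^^ Suc n) f y = (\<Sum>x\<in>pre y. c x * (\<Sum>z\<in>fib n x. orbit_prod c n z * f z))"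
    unfolding funpow.simps o_apply Lop_def[of c "(Lop c ^^ n) f"]
    using Suc.IH pre_subset by (intro sum.cong refl) (auto simp: subset_iff)
  also have "\<dots> = (\<Sum>x\<in>pre y. \<Sum>z\<in>fib n x. orbit_prod c (Suc n) z * f z)"
    by (intro sum.cong refl) (auto simp: sum_distrib_left orbit_prod_def fib_def pre_def intro!: sum.cong)
  also have "\<dots> = (\<Sum>z\<in>fib (Suc n) y. orbit_prod c (Suc n) z * f z)"
    unfolding fib_Suc[of n] by (rule sum.UNION_disjoint[symmetric]) (use fib_bound finite_fib in blast, use finite_fib in blast, auto simp: fib_def)
  finally show ?case .
qed

lemma Lop_mono:
  assumes "\<And>x. x \<in> S \<Longrightarrow> c x \<ge> 0" "\<And>x. x \<in> S \<Longrightarrow> f x \<le> g x"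
  shows "Lop c f y \<le> Lop c g y"
  unfolding Lop_def using assms pre_subset by (intro sum_mono mult_left_mono) blast+

lemma Lop_iter_mono:
  assumes c: "\<And>x. x \<in> S \<Longrightarrow> c x \<ge> 0" and f: "\<And>x. x \<in> S \<Longrightarrow> f x \<le> g x" and y: "y \<in> S"
  shows "(Lop c ^^ n) f y \<le> (Lop c ^^ n) g y"
  using y
proof (induction n arbitrary: y)
  case (Suc n) thus ?case using Lop_mono[OF c, where f="(Lop c ^^ n) f" and g="(Lop c ^^ n) g"] by auto
qed (use f in auto)

lemma Lop_scale: "Lop c (\<lambda>x. a * f x) y = a * Lop c f y"
  unfolding Lop_def by (simp add: sum_distrib_left mult_ac)

lemma Lop_iter_scale: "y \<in> S \<Longrightarrow> (Lop c ^^ n) (\<lambda>x. a * f x) y = a * (Lop c ^^ n) f y"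
  by (simp add: Lop_iter_eq sum_distrib_left mult_ac)

lemma Lop_iter_nonneg:
  assumes "\<And>x. x \<in> S \<Longrightarrow> c x \<ge> 0" "\<And>x. x \<in> S \<Longrightarrow> f x \<ge> 0" "y \<in> S" shows "(Lop c ^^ n) f y \<ge> 0"
  unfolding Lop_iter_eq[OF assms(3)] orbit_prod_def
  using assms fib_subset iter_S by (intro sum_nonneg mult_nonneg_nonneg prod_nonneg) (auto simp: subset_iff)

lemma Lop_iter_subeigen:
  assumes c: "\<And>x. x \<in> S \<Longrightarrow> c x \<ge> 0" and \<rho>: "\<rho> \<ge> 0" and u: "\<And>x. x \<in> S \<Longrightarrow> Lop c u x \<le> \<rho> * u x" and y: "y \<in> S"
  shows "(Lop c ^^ n) u y \<le> \<rho> ^ n * u y"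
  using y
proof (induction n arbitrary: y)
  case (Suc n)
  have "(Lop c ^^ Suc n) u y \<le> Lop c (\<lambda>x. \<rho> ^ n * u x) y" using Lop_mono[OF c, where f="(Lop c ^^ n) u"] Suc.IH by simp
  also have "\<dots> \<le> \<rho> ^ n * (\<rho> * u y)" unfolding Lop_scale using \<rho> u Suc.prems by (intro mult_left_mono) auto
  finally show ?case by (simp add: mult_ac)
qed simp

end

section \<open>Growth rate of the transfer operator\<close>

context expanding_system begin

definition growth :: "('a \<Rightarrow> real) \<Rightarrow> real \<Rightarrow> bool" where
  "growth c \<rho> \<longleftrightarrow> (\<exists>C. \<forall>n. \<forall>y\<in>S. (Lop c ^^ n) (\<lambda>_. 1) y \<le> C * \<rho> ^ n)"

text \<open>The exponential growth rate of the sup norms of the iterates on 1, written as an infimum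
  of admissible rates so that no limit of n-th roots has to be shown to exist. By
  \<open>spectral_radius_eq\<close> it is the spectral radius.\<close>

definition rad :: "('a \<Rightarrow> real) \<Rightarrow> real" where "rad c = Inf {\<rho>. \<rho> > 0 \<and> growth c \<rho>}"

lemma RPF_eq: "RPF mtopology \<phi> c f y = (\<Sum>x\<in>pre y. complex_of_real (c x) * f x)"
  by (simp add: RPF_def pre_def)

lemma continuous_map_scaleR:
  fixes f :: "'a \<Rightarrow> real" and g :: "'a \<Rightarrow> 'b::real_normed_vector"
  assumes f: "continuous_map mtopology euclideanreal f" and g: "continuous_map mtopology euclidean g"
  shows "continuous_map mtopology euclidean (\<lambda>x. f x *\<^sub>R g x)"
proof -
  have "continuous_map mtopology (prod_topology euclidean euclidean) (\<lambda>x. (f x, g x))"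
    by (intro continuous_map_pairedI f g)
  hence "continuous_map mtopology euclidean (\<lambda>x. (f x, g x))" by simp
  moreover have "continuous_map euclidean euclidean (\<lambda>p::real \<times> 'b. fst p *\<^sub>R snd p)"
    by (auto intro!: continuous_intros)
  ultimately have "continuous_map mtopology euclidean ((\<lambda>p. fst p *\<^sub>R snd p) \<circ> (\<lambda>x. (f x, g x)))"
    by (rule continuous_map_compose)
  thus ?thesis by (simp add: o_def)
qed

lemma continuous_map_continuous_on:
  assumes f: "continuous_map mtopology euclidean f" and g: "continuous_on (range f) g"
  shows "continuous_map mtopology euclidean (\<lambda>x. g (f x))"
proof -
  have "continuous_map mtopology (subtopology euclidean (range f)) f" using f by (simp add: continuous_map_in_subtopology)
  moreover have "continuous_map (subtopology euclidean (range f)) euclidean g" using g by simp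
  ultimately have "continuous_map mtopology euclidean (g \<circ> f)" by (rule continuous_map_compose)
  thus ?thesis by (simp add: o_def)
qed

lemma pre_outside: "y \<notin> S \<Longrightarrow> pre y = {}" by (auto simp: pre_def \<phi>_S)

end

locale transfer_system = expanding_system S d \<phi> e \<theta> for S :: "'a set" and d \<phi> e \<theta> +
  fixes c :: "'a \<Rightarrow> real"
  assumes c_cont: "continuous_map mtopology euclideanreal c" and c_nonneg: "\<And>x. x \<in> S \<Longrightarrow> c x \<ge> 0"
begin

abbreviation L1 :: "nat \<Rightarrow> 'a \<Rightarrow> real" where "L1 n \<equiv> (Lop c ^^ n) (\<lambda>_. 1)"

lemma L1_nonneg: "y \<in> S \<Longrightarrow> L1 n y \<ge> 0"
  using Lop_iter_nonneg[OF c_nonneg] by auto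

lemma L1_power_bound: obtains B where "B > 0" "\<And>n y. y \<in> S \<Longrightarrow> L1 n y \<le> B ^ n"
proof -
  obtain K where K: "K > 0" "\<And>y. finite (pre y) \<and> card (pre y) \<le> K" using fib_bound by auto
  obtain C where C: "C > 0" "\<And>x. x \<in> S \<Longrightarrow> norm (c x) \<le> C" using continuous_bounded[OF c_cont] by metis
  have "Lop c (\<lambda>_. 1) x \<le> (real K * C) * 1" for x
  proof -
    have "Lop c (\<lambda>_. 1) x \<le> (\<Sum>x\<in>pre x. C)" unfolding Lop_def using C pre_subset by (intro sum_mono) force
    also have "\<dots> \<le> real K * C" using K(2)[of x] C by (simp add: mult_right_mono)
    finally show ?thesis by simp
  qed
  hence "L1 n y \<le> (real K * C) ^ n * 1" if "y \<in> S" for n y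
    using C K that by (intro Lop_iter_subeigen c_nonneg) auto
  thus ?thesis using that[of "real K * C"] C K by simp
qed

lemma growth_ex: "\<exists>\<rho>>0. growth c \<rho>"
proof -
  obtain B where "B > 0" "\<And>n y. y \<in> S \<Longrightarrow> L1 n y \<le> B ^ n" using L1_power_bound by blast
  thus ?thesis unfolding growth_def by (intro exI[of _ B] conjI exI[of _ 1]) auto
qed

lemma growth_const_nonneg: "(\<And>n y. y \<in> S \<Longrightarrow> L1 n y \<le> C * \<rho> ^ n) \<Longrightarrow> C \<ge> 0"
proof -
  assume *: "\<And>n y. y \<in> S \<Longrightarrow> L1 n y \<le> C * \<rho> ^ n"
  obtain y where y: "y \<in> S" using nonempty by blast
  have "1 \<le> C" using *[OF y, of 0] by simp
  thus ?thesis by simp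
qed

lemma growth_mono: "growth c \<rho> \<Longrightarrow> 0 \<le> \<rho> \<Longrightarrow> \<rho> \<le> \<rho>' \<Longrightarrow> growth c \<rho>'"
proof -
  assume "growth c \<rho>" and \<rho>: "0 \<le> \<rho>" "\<rho> \<le> \<rho>'"
  then obtain C where C: "\<And>n y. y \<in> S \<Longrightarrow> L1 n y \<le> C * \<rho> ^ n" unfolding growth_def by blast
  have "C * \<rho> ^ n \<le> C * \<rho>' ^ n" for n using \<rho> growth_const_nonneg[OF C] by (intro mult_left_mono power_mono) auto
  hence "L1 n y \<le> C * \<rho>' ^ n" if "y \<in> S" for n y using C[OF that, of n] order_trans by blast
  thus ?thesis unfolding growth_def by blast
qed

lemma bdd_growth: "bdd_below {\<rho>. \<rho> > 0 \<and> growth c \<rho>}"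
  by (intro bdd_belowI[of _ 0]) auto

lemma rad_nonneg: "rad c \<ge> 0"
  unfolding rad_def using growth_ex by (intro cInf_greatest) auto

lemma rad_le: "\<rho> > 0 \<Longrightarrow> growth c \<rho> \<Longrightarrow> rad c \<le> \<rho>"
  unfolding rad_def using bdd_growth by (intro cInf_lower) auto

lemma growth_gt_rad: assumes "\<rho> > rad c" shows "growth c \<rho>"
proof -
  have "\<exists>\<rho>0\<in>{\<rho>. \<rho> > 0 \<and> growth c \<rho>}. \<rho>0 < \<rho>"
    using assms growth_ex bdd_growth unfolding rad_def by (subst cInf_less_iff[symmetric]) auto
  thus ?thesis using growth_mono by auto
qed

text \<open>One good power controls all: for \<open>n = j + q * N\<close> with \<open>j < N\<close>
  the remainder costs only the factor \<open>(B / s) ^ j\<close>, and \<open>C\<close> is the sum of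
  these finitely many factors.\<close>

lemma growth_of_power:
  assumes N: "N > 0" and s: "s > 0" and le: "\<And>y. y \<in> S \<Longrightarrow> L1 N y \<le> s ^ N"
  shows "growth c s"
proof -
  obtain B where B: "B > 0" "\<And>n y. y \<in> S \<Longrightarrow> L1 n y \<le> B ^ n" using L1_power_bound by blast
  have mult: "L1 (q * N) y \<le> s ^ (q * N)" if "y \<in> S" for q y
    using that
  proof (induction q arbitrary: y)
    case (Suc q)
    have "L1 (Suc q * N) y = (Lop c ^^ N) (L1 (q * N)) y" by (simp add: funpow_add)
    also have "\<dots> \<le> (Lop c ^^ N) (\<lambda>x. s ^ (q * N) * 1) y" using Suc by (intro Lop_iter_mono c_nonneg) auto
    also have "\<dots> = s ^ (q * N) * L1 N y" by (rule Lop_iter_scale[OF Suc.prems])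
    also have "\<dots> \<le> s ^ (q * N) * s ^ N" using Suc s le by (intro mult_left_mono) auto
    finally show ?case by (simp add: power_add mult_ac)
  qed simp
  define C where "C = (\<Sum>j<N. (B / s) ^ j)"
  have "L1 n y \<le> C * s ^ n" if y: "y \<in> S" for n y
  proof -
    define q j where "q = n div N" and "j = n mod N"
    have n: "n = j + q * N" and j: "j < N" using N by (auto simp: q_def j_def)
    have "L1 n y = (Lop c ^^ j) (L1 (q * N)) y" unfolding n by (simp add: funpow_add)
    also have "\<dots> \<le> (Lop c ^^ j) (\<lambda>x. s ^ (q * N) * 1) y" using mult y by (intro Lop_iter_mono c_nonneg) auto
    also have "\<dots> = s ^ (q * N) * L1 j y" by (rule Lop_iter_scale[OF y])
    also have "\<dots> \<le> s ^ (q * N) * B ^ j" using s B y by (intro mult_left_mono) auto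
    also have "\<dots> = (B / s) ^ j * s ^ n" using s unfolding n by (simp add: power_add power_divide)
    also have "\<dots> \<le> C * s ^ n" unfolding C_def using j s B by (intro mult_right_mono member_le_sum) auto
    finally show ?thesis .
  qed
  thus ?thesis unfolding growth_def by blast
qed

text \<open>Since a single good power would bring the growth rate down to \<open>s\<close>, every
  \<open>N\<close>, and not merely a subsequence, has a heavy fibre. These fibres carry the measures
  from which the equilibrium is built.\<close>

lemma L1_large:
  assumes "0 < s" "s < rad c" "N > 0" shows "\<exists>y\<in>S. L1 N y > s ^ N"
  using growth_of_power[of N s] rad_le[of s] assms by (meson not_le)

lemma continuous_sum:
  fixes f :: "nat \<Rightarrow> 'a \<Rightarrow> 'b::real_normed_vector"
  assumes "\<And>i. continuous_map mtopology euclidean (f i)"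
  shows "continuous_map mtopology euclidean (\<lambda>x. \<Sum>i<n. f i x)"
  using assms by (induction n) (auto intro!: continuous_intros)

text \<open>A truncated Neumann series \<open>u = (\<Sum>n<N. 1 / \<rho> ^ n * L1 n y)\<close>.
  Applying the operator shifts it:
  \<open>Lop c u = \<rho> * (u - 1 + 1 / \<rho> ^ N * L1 N)\<close>, and \<open>N\<close> is taken
  so large that the last term is at most 1. The term of index 0 gives
  \<open>u \<ge> 1\<close>.\<close>

lemma ex_subeigen:
  assumes \<rho>: "\<rho> > rad c"
  obtains u where "continuous_map mtopology euclideanreal u" "\<And>x. x \<in> S \<Longrightarrow> u x \<ge> 1"
    "\<And>y. y \<in> S \<Longrightarrow> Lop c u y \<le> \<rho> * u y"
proof -
  define \<rho>0 where "\<rho>0 = (rad c + \<rho>) / 2"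
  have \<rho>0: "rad c < \<rho>0" "\<rho>0 < \<rho>" "\<rho>0 \<ge> 0" "\<rho> > 0" using \<rho> rad_nonneg unfolding \<rho>0_def by auto
  obtain C where C: "\<And>n y. y \<in> S \<Longrightarrow> L1 n y \<le> C * \<rho>0 ^ n" using growth_gt_rad[OF \<rho>0(1)] unfolding growth_def by blast
  have "(\<lambda>n. C * (\<rho>0 / \<rho>) ^ n) \<longlonglongrightarrow> C * 0" using \<rho>0 by (intro tendsto_intros LIMSEQ_power_zero) auto
  hence "\<forall>\<^sub>F n in sequentially. C * (\<rho>0 / \<rho>) ^ n < 1" by (intro order_tendstoD(2)) auto
  then obtain N0 where N0: "\<And>n. n \<ge> N0 \<Longrightarrow> C * (\<rho>0 / \<rho>) ^ n < 1" unfolding eventually_sequentially by blast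
  define N where "N = Suc N0"
  have N: "L1 N y / \<rho> ^ N \<le> 1" if "y \<in> S" for y
  proof -
    have "L1 N y / \<rho> ^ N \<le> C * \<rho>0 ^ N / \<rho> ^ N" using C[OF that] \<rho>0 by (intro divide_right_mono) auto
    also have "\<dots> \<le> 1" using N0[of N] by (simp add: N_def power_divide)
    finally show ?thesis .
  qed
  define u where "u y = (\<Sum>n<N. 1 / \<rho> ^ n * L1 n y)" for y
  show ?thesis
  proof (rule that[of u])
    show "continuous_map mtopology euclideanreal u" unfolding u_def[abs_def]
      by (intro continuous_sum continuous_intros Lop_iter_continuous c_cont)
    show "u x \<ge> 1" if x: "x \<in> S" for x
    proof -
      have "1 / \<rho> ^ 0 * L1 0 x \<le> u x" unfolding u_def
        using \<rho>0 L1_nonneg[OF x] by (intro member_le_sum) (auto simp: N_def)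
      thus ?thesis by simp
    qed
    show "Lop c u y \<le> \<rho> * u y" if y: "y \<in> S" for y
    proof -
      have "Lop c u y = (\<Sum>n<N. 1 / \<rho> ^ n * Lop c (L1 n) y)"
        unfolding Lop_def u_def by (simp add: sum_distrib_left sum_distrib_right mult_ac) (rule sum.swap)
      also have "\<dots> = \<rho> * (\<Sum>n<N. 1 / \<rho> ^ Suc n * L1 (Suc n) y)"
        unfolding sum_distrib_left using \<rho>0 by (intro sum.cong) auto
      also have "(\<Sum>n<N. 1 / \<rho> ^ Suc n * L1 (Suc n) y) = u y + 1 / \<rho> ^ N * L1 N y - 1"
        using sum.lessThan_Suc_shift[of "\<lambda>n. 1 / \<rho> ^ n * L1 n y" N] unfolding u_def by simp
      also have "\<rho> * \<dots> \<le> \<rho> * u y" using N[OF y] \<rho>0 by (intro mult_left_mono) auto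
      finally show ?thesis .
    qed
  qed
qed

text \<open>Take a subeigenfunction \<open>u\<close> at the intermediate rate
  \<open>\<rho>1\<close>. Adding \<open>\<delta>\<close> to the weight adds at most
  \<open>\<delta> * (real K * B)\<close>, which equals \<open>\<rho> - \<rho>1\<close> by the choice
  of \<open>\<delta>\<close>; as \<open>u \<ge> 1\<close>, the gap between the rates absorbs it. The
  gain is a strictly positive weight.\<close>

lemma growth_perturbed:
  assumes \<rho>: "\<rho> > rad c"
  obtains \<delta> where "\<delta> > 0" "growth (\<lambda>x. c x + \<delta>) \<rho>"
proof -
  define \<rho>1 where "\<rho>1 = (rad c + \<rho>) / 2"
  have \<rho>1: "rad c < \<rho>1" "\<rho>1 < \<rho>" "\<rho>1 \<ge> 0" "\<rho> > 0" using \<rho> rad_nonneg unfolding \<rho>1_def by auto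
  obtain u where u: "continuous_map mtopology euclideanreal u" "\<And>x. x \<in> S \<Longrightarrow> u x \<ge> 1"
    "\<And>y. y \<in> S \<Longrightarrow> Lop c u y \<le> \<rho>1 * u y" using ex_subeigen[OF \<rho>1(1)] by blast
  obtain B where B: "B > 0" "\<And>x. x \<in> S \<Longrightarrow> norm (u x) \<le> B" using continuous_bounded[OF u(1)] by metis
  obtain K where K: "K > 0" "\<And>y. finite (pre y) \<and> card (pre y) \<le> K" using fib_bound by auto
  define \<delta> where "\<delta> = (\<rho> - \<rho>1) / (real K * B)"
  have \<delta>: "\<delta> > 0" using \<rho>1 K B unfolding \<delta>_def by simp
  let ?c = "\<lambda>x. c x + \<delta>"
  have sub: "Lop ?c u y \<le> \<rho> * u y" if y: "y \<in> S" for y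
  proof -
    have "Lop ?c u y = Lop c u y + \<delta> * (\<Sum>x\<in>pre y. u x)"
      unfolding Lop_def by (simp add: sum.distrib algebra_simps sum_distrib_left)
    also have "(\<Sum>x\<in>pre y. u x) \<le> (\<Sum>x\<in>pre y. B)" using B(2) pre_subset by (intro sum_mono) force
    also have "\<dots> \<le> real K * B" using K(2)[of y] B by (simp add: mult_right_mono)
    finally have "Lop ?c u y \<le> Lop c u y + \<delta> * (real K * B)" using \<delta> by (simp add: mult_left_mono)
    also have "\<dots> \<le> \<rho>1 * u y + (\<rho> - \<rho>1) * 1" using u(3)[OF y] K B unfolding \<delta>_def by simp
    also have "\<dots> \<le> \<rho>1 * u y + (\<rho> - \<rho>1) * u y" using u(2)[OF y] \<rho>1 by (intro add_left_mono mult_left_mono) auto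
    finally show ?thesis by (simp add: algebra_simps)
  qed
  have c'nn: "?c x \<ge> 0" if "x \<in> S" for x using c_nonneg[OF that] \<delta> by simp
  have "(Lop ?c ^^ n) (\<lambda>_. 1) y \<le> B * \<rho> ^ n" if y: "y \<in> S" for n y
  proof -
    have "(Lop ?c ^^ n) (\<lambda>_. 1) y \<le> (Lop ?c ^^ n) u y" using u c'nn y by (intro Lop_iter_mono) auto
    also have "\<dots> \<le> \<rho> ^ n * u y" using sub c'nn y \<rho>1 by (intro Lop_iter_subeigen) auto
    also have "\<dots> \<le> \<rho> ^ n * B" using B(2)[OF y] \<rho>1 by (intro mult_left_mono) auto
    finally show ?thesis by (simp add: mult.commute)
  qed
  hence "growth ?c \<rho>" unfolding growth_def by blast
  with \<delta> that show ?thesis by blast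
qed

subsection \<open>The spectral radius\<close>

abbreviation RC :: "('a \<Rightarrow> complex) \<Rightarrow> 'a \<Rightarrow> complex" where "RC \<equiv> RPF mtopology \<phi> c"

lemma CX_iff: "f \<in> CX mtopology \<longleftrightarrow> continuous_map mtopology euclidean f \<and> (\<forall>y. y \<notin> S \<longrightarrow> f y = 0)"
  by (simp add: CX_def)

lemma RC_CX: assumes "f \<in> CX mtopology" shows "RC f \<in> CX mtopology"
proof -
  have "continuous_map mtopology euclidean (\<lambda>x. c x *\<^sub>R f x)"
    using c_cont assms unfolding CX_iff by (intro continuous_map_scaleR) auto
  hence "continuous_map mtopology euclidean (\<lambda>y. \<Sum>x\<in>pre y. c x *\<^sub>R f x)"
    by (rule fib_sum_continuous)
  hence "continuous_map mtopology euclidean (RC f)"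
    by (simp add: RPF_eq[abs_def] scaleR_conv_of_real)
  thus ?thesis unfolding CX_iff by (simp add: RPF_eq pre_outside)
qed

lemma RC_iter_CX: "f \<in> CX mtopology \<Longrightarrow> (RC ^^ n) f \<in> CX mtopology"
  by (induction n) (auto simp: RC_CX)

text \<open>As \<open>c\<close> is nonnegative, the iterates on 1 dominate those on every bounded
  complex function, so that \<open>growth\<close> controls the norms of the powers of the complex
  operator.\<close>

lemma RC_iter_norm:
  assumes G: "\<And>x. x \<in> S \<Longrightarrow> norm (f x) \<le> G" and y: "y \<in> S"
  shows "norm ((RC ^^ n) f y) \<le> G * L1 n y"
  using y
proof (induction n arbitrary: y)
  case (Suc n)
  have "norm ((RC ^^ Suc n) f y) \<le> (\<Sum>x\<in>pre y. norm (complex_of_real (c x) * (RC ^^ n) f x))"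
    by (simp add: RPF_eq norm_sum)
  also have "\<dots> \<le> (\<Sum>x\<in>pre y. c x * (G * L1 n x))"
    using Suc.IH c_nonneg pre_subset by (intro sum_mono) (force simp: norm_mult intro!: mult_mono)
  also have "\<dots> = G * L1 (Suc n) y"
    using Lop_scale[of c G "L1 n" y] by (simp add: Lop_def)
  finally show ?case .
qed (use G in simp)

lemma CX_diff: "f \<in> CX mtopology \<Longrightarrow> g \<in> CX mtopology \<Longrightarrow> (\<lambda>x. f x - g x) \<in> CX mtopology"
  unfolding CX_iff by (auto intro!: continuous_intros)

lemma CX_scale: "f \<in> CX mtopology \<Longrightarrow> (\<lambda>x. z * f x) \<in> CX mtopology"
  unfolding CX_iff by (auto intro!: continuous_map_continuous_on[where g="\<lambda>w. z * w"] continuous_intros)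

text \<open>Injectivity: an element of the kernel is an eigenfunction for \<open>z\<close>, whose
  iterates would outgrow the rate \<rho>. Surjectivity: the Neumann series converges uniformly by
  the geometric bound with ratio \<open>?q\<close>, so its sum is continuous.\<close>

lemma not_in_spectrum:
  assumes z: "norm z > rad c"
  shows "z \<notin> op_spectrum (CX mtopology) RC"
proof -
  define \<rho> where "\<rho> = (rad c + norm z) / 2"
  have \<rho>: "rad c < \<rho>" "\<rho> < norm z" "\<rho> \<ge> 0" and z0: "norm z > 0" "z \<noteq> 0" using z rad_nonneg unfolding \<rho>_def by auto
  obtain C where C: "\<And>n y. y \<in> S \<Longrightarrow> L1 n y \<le> C * \<rho> ^ n" using growth_gt_rad[OF \<rho>(1)] unfolding growth_def by blast
  have Cnn: "C \<ge> 0" by (rule growth_const_nonneg[OF C])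
  let ?q = "\<rho> / norm z"
  have q: "0 \<le> ?q" "?q < 1" using \<rho> z0 by auto
  have bound: "norm ((RC ^^ n) f y / z ^ n) \<le> G * C * ?q ^ n" if "\<And>x. x \<in> S \<Longrightarrow> norm (f x) \<le> G" "y \<in> S" for f G n y
  proof -
    have G0: "G \<ge> 0" using that norm_ge_zero order_trans by blast
    have "norm ((RC ^^ n) f y) \<le> G * L1 n y" using RC_iter_norm that by blast
    also have "\<dots> \<le> G * (C * \<rho> ^ n)" using G0 C that by (intro mult_left_mono) auto
    finally show ?thesis using z0 by (simp add: norm_divide norm_power power_divide divide_right_mono)
  qed
  let ?T = "\<lambda>f y. z * f y - RC f y"
  have "bij_betw ?T (CX mtopology) (CX mtopology)"
    unfolding bij_betw_def
  proof (intro conjI equalityI)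
    show "?T ` CX mtopology \<subseteq> CX mtopology" using CX_diff CX_scale RC_CX by blast
    show "inj_on ?T (CX mtopology)"
    proof (rule inj_onI)
      fix f g assume fg: "f \<in> CX mtopology" "g \<in> CX mtopology" "?T f = ?T g"
      define h where "h = (\<lambda>x. f x - g x)"
      have h: "h \<in> CX mtopology" unfolding h_def using fg by (intro CX_diff)
      have "RC h y = z * h y" for y
        using fun_cong[OF fg(3), of y] unfolding h_def by (simp add: RPF_eq algebra_simps sum_subtractf)
      hence eig: "RC h = (\<lambda>y. z * h y)" by auto
      have iter: "(RC ^^ n) h = (\<lambda>y. z ^ n * h y)" for n
      proof (induction n)
        case (Suc n)
        have "(RC ^^ Suc n) h y = z ^ n * RC h y" for y unfolding funpow.simps o_apply Suc
          by (simp add: RPF_eq sum_distrib_left mult_ac)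
        thus ?case using eig by (auto simp: mult_ac)
      qed simp
      obtain G where G: "G > 0" "\<And>x. x \<in> S \<Longrightarrow> norm (h x) \<le> G"
        using h continuous_bounded[of h] unfolding CX_iff by metis
      have "h y = 0" for y
      proof (cases "y \<in> S")
        case True
        have le: "norm (h y) \<le> G * C * ?q ^ n" for n using bound[of h G y n, OF G(2) True] z0 by (simp add: iter)
        have "(\<lambda>n. G * C * ?q ^ n) \<longlonglongrightarrow> G * C * 0" using q by (intro tendsto_intros LIMSEQ_power_zero) auto
        hence "norm (h y) \<le> 0" using le LIMSEQ_le_const[of "\<lambda>n. G * C * ?q ^ n" 0 "norm (h y)"] by simp
        thus ?thesis by simp
      qed (use h CX_iff in blast)
      thus "f = g" unfolding h_def by auto
    qed
    show "CX mtopology \<subseteq> ?T ` CX mtopology"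
    proof
      fix g assume g: "g \<in> CX mtopology"
      obtain G where G: "G > 0" "\<And>x. x \<in> S \<Longrightarrow> norm (g x) \<le> G"
        using g continuous_bounded[of g] unfolding CX_iff by metis
      define t where "t n y = (RC ^^ n) g y / z ^ n" for n y
      have tCX: "t n \<in> CX mtopology" for n
        using CX_scale[OF RC_iter_CX[OF g], of "1 / z ^ n" n] unfolding t_def[abs_def] by simp
      have t_out: "t n y = 0" if "y \<notin> S" for n y using tCX that unfolding CX_iff by blast
      have t_b: "norm (t n y) \<le> G * C * ?q ^ n" if "y \<in> S" for n y unfolding t_def by (rule bound[OF G(2) that])
      have Msum: "summable (\<lambda>n. G * C * ?q ^ n)" using q by (intro summable_mult summable_geometric) auto
      have sm: "summable (\<lambda>n. t n y)" for y
      proof (cases "y \<in> S")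
        case True thus ?thesis using t_b Msum by (intro summable_comparison_test'[OF Msum, of 0]) auto
      qed (simp add: t_out)
      define F where "F y = (\<Sum>n. t n y)" for y
      define f where "f y = F y / z" for y
      have unif: "uniform_limit S (\<lambda>n y. \<Sum>i<n. t i y) F sequentially"
        unfolding F_def by (rule Weierstrass_m_test[OF _ Msum]) (use t_b in auto)
      have "continuous_map mtopology Met_TC.mtopology F"
      proof (rule Met_TC.continuous_map_uniform_limit)
        show "\<forall>\<^sub>F n in sequentially. continuous_map mtopology Met_TC.mtopology (\<lambda>y. \<Sum>i<n. t i y)"
          using tCX continuous_sum[of t] unfolding CX_iff by (auto intro!: always_eventually)
        show "\<forall>\<^sub>F n in sequentially. \<forall>x\<in>topspace mtopology. F x \<in> UNIV \<and> dist (\<Sum>i<n. t i x) (F x) < \<epsilon>" if "\<epsilon> > 0" for \<epsilon>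
          using uniform_limitD[OF unif that] by simp
      qed simp
      hence "continuous_map mtopology euclidean F" by simp
      hence FCX: "F \<in> CX mtopology" unfolding CX_iff by (simp add: F_def t_out)
      have f: "f \<in> CX mtopology" using CX_scale[OF FCX, of "1 / z"] unfolding f_def[abs_def] by simp
      have "?T f y = g y" for y
      proof -
        have "RC F y = (\<Sum>x\<in>pre y. \<Sum>n. complex_of_real (c x) * t n x)"
          unfolding RPF_eq F_def by (simp add: suminf_mult sm)
        also have "\<dots> = (\<Sum>n. \<Sum>x\<in>pre y. complex_of_real (c x) * t n x)"
          by (rule suminf_sum[symmetric]) (intro summable_mult sm)
        also have "\<dots> = (\<Sum>n. z * t (Suc n) y)"
        proof (rule suminf_cong)
          fix n
          show "(\<Sum>x\<in>pre y. complex_of_real (c x) * t n x) = z * t (Suc n) y"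
            using z0 by (simp add: t_def RPF_eq sum_divide_distrib sum_distrib_left)
        qed
        also have "\<dots> = z * (\<Sum>n. t (Suc n) y)" using summable_ignore_initial_segment[OF sm[of y], of 1] by (intro suminf_mult) simp
        also have "(\<Sum>n. t (Suc n) y) = F y - t 0 y" unfolding F_def by (rule suminf_split_head[OF sm])
        finally have "RC F y = z * (F y - g y)" by (simp add: t_def)
        moreover have "RC f y = RC F y / z" unfolding RPF_eq f_def by (simp add: sum_divide_distrib)
        ultimately show ?thesis using z0 by (simp add: f_def)
      qed
      hence "g = ?T f" by auto
      with f show "g \<in> ?T ` CX mtopology" by blast
    qed
  qed
  thus ?thesis unfolding op_spectrum_def by simp
qed

text \<open>If r - L were onto, a bounded solution h of r h - L h = 1 would be positive and satisfy
  L h \<le> (r - 1/G) h with G a bound of h, so the iterates of L would grow at a rate below r.\<close>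
lemma rad_in_spectrum: "complex_of_real (rad c) \<in> op_spectrum (CX mtopology) RC"
proof (rule ccontr)
  assume "\<not> ?thesis"
  hence bij: "bij_betw (\<lambda>f y. complex_of_real (rad c) * f y - RC f y) (CX mtopology) (CX mtopology)"
    unfolding op_spectrum_def by simp
  define g0 where "g0 = (\<lambda>y. if y \<in> S then 1 else 0 :: complex)"
  have "continuous_map mtopology euclidean g0"
    using continuous_map_eq[of mtopology euclidean "\<lambda>_. 1" g0] by (simp add: g0_def)
  hence "g0 \<in> CX mtopology" unfolding CX_iff by (simp add: g0_def)
  then obtain f where f: "f \<in> CX mtopology" "g0 = (\<lambda>y. complex_of_real (rad c) * f y - RC f y)"
    using bij unfolding bij_betw_def by blast
  define h where "h = (\<lambda>y. Re (f y))"
  have eq: "rad c * h y - Lop c h y = 1" if "y \<in> S" for y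
  proof -
    have "1 = Re (g0 y)" using that by (simp add: g0_def)
    also have "\<dots> = rad c * h y - Lop c h y" unfolding f(2) RPF_eq Lop_def h_def by simp
    finally show ?thesis by simp
  qed
  obtain G where G: "G > 0" "\<And>x. x \<in> S \<Longrightarrow> norm (f x) \<le> G"
    using f(1) continuous_bounded[of f] unfolding CX_iff by metis
  have hG: "\<bar>h x\<bar> \<le> G" if "x \<in> S" for x using G(2)[OF that] abs_Re_le_cmod[of "f x"] unfolding h_def by linarith
  \<comment> \<open>Raising the rate by \<open>1 / (2 * G)\<close> costs at most half of the
    right-hand side 1, because \<open>\<bar>h\<bar> \<le> G\<close>, and leaves room above
    \<open>rad c\<close> for the iterates to decay relative to \<open>\<kappa> ^ n\<close>.\<close>
  define \<kappa> where "\<kappa> = rad c + 1 / (2 * G)"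
  have \<kappa>: "\<kappa> > rad c" "\<kappa> > 0" using G rad_nonneg unfolding \<kappa>_def by (auto intro: add_nonneg_pos)
  have step: "\<kappa> * h y - Lop c h y \<ge> 1 / 2" if y: "y \<in> S" for y
  proof -
    have "- (1 / 2) \<le> 1 / (2 * G) * h y" using hG[OF y] G by (simp add: field_simps abs_le_iff)
    thus ?thesis using eq[OF y] unfolding \<kappa>_def by (simp add: algebra_simps)
  qed
  define \<rho> where "\<rho> = (rad c + \<kappa>) / 2"
  have \<rho>: "rad c < \<rho>" "\<rho> < \<kappa>" "\<rho> \<ge> 0" using \<kappa> rad_nonneg unfolding \<rho>_def by auto
  obtain C where C: "\<And>n y. y \<in> S \<Longrightarrow> L1 n y \<le> C * \<rho> ^ n" using growth_gt_rad[OF \<rho>(1)] unfolding growth_def by blast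
  \<comment> \<open>The n-th iterate on \<open>h\<close> is at most \<open>\<kappa> ^ n * h\<close>
    and at least \<open>- G * C * \<rho> ^ n\<close>. Division by \<open>\<kappa> ^ n\<close> leaves
    a lower bound for \<open>h\<close> that tends to 0.\<close>
  have h0: "h y \<ge> 0" if y: "y \<in> S" for y
  proof -
    have "- (G * C * (\<rho> / \<kappa>) ^ n) \<le> h y" for n
    proof -
      have "(Lop c ^^ n) (\<lambda>x. - G * 1) y \<le> (Lop c ^^ n) h y"
        using hG y by (intro Lop_iter_mono c_nonneg) (auto simp: abs_le_iff minus_le_iff)
      hence "- G * L1 n y \<le> (Lop c ^^ n) h y" using Lop_iter_scale[OF y, of n c "- G" "\<lambda>_. 1"] by simp
      also have "\<dots> \<le> \<kappa> ^ n * h y"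
      proof (rule Lop_iter_subeigen[OF c_nonneg _ _ y])
        show "Lop c h x \<le> \<kappa> * h x" if "x \<in> S" for x using step[OF that] by linarith
      qed (use \<kappa> in auto)
      finally have "- G * L1 n y \<le> \<kappa> ^ n * h y" .
      moreover have "G * L1 n y \<le> G * (C * \<rho> ^ n)" using G C[OF y] by (intro mult_left_mono) auto
      ultimately have "- (G * C * \<rho> ^ n) \<le> \<kappa> ^ n * h y" by linarith
      thus ?thesis using \<kappa> by (simp add: power_divide field_simps)
    qed
    moreover have "(\<lambda>n. - (G * C * (\<rho> / \<kappa>) ^ n)) \<longlonglongrightarrow> - (G * C * 0)"
      using \<rho> \<kappa> by (intro tendsto_intros LIMSEQ_power_zero) auto
    ultimately show ?thesis by (intro LIMSEQ_le_const2[of "\<lambda>n. - (G * C * (\<rho> / \<kappa>) ^ n)" 0]) auto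
  qed
  have Lh0: "Lop c h y \<ge> 0" if "y \<in> S" for y
    unfolding Lop_def using h0 c_nonneg pre_subset by (intro sum_nonneg mult_nonneg_nonneg) blast+
  have hlow: "h y \<ge> 1 / (2 * \<kappa>)" if y: "y \<in> S" for y
  proof -
    have "\<kappa> * h y \<ge> 1 / 2" using step[OF y] Lh0[OF y] by linarith
    thus ?thesis using \<kappa> by (simp add: field_simps)
  qed
  define \<rho>' where "\<rho>' = rad c - 1 / G"
  have sub: "Lop c h y \<le> \<rho>' * h y" if y: "y \<in> S" for y
  proof -
    have "h y / G \<le> 1" using hG[OF y] G by (simp add: abs_le_iff)
    thus ?thesis using eq[OF y] unfolding \<rho>'_def by (simp add: algebra_simps)
  qed
  have \<rho>'0: "\<rho>' \<ge> 0"
  proof -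
    obtain y where y: "y \<in> S" using nonempty by blast
    have "h y > 0" using hlow[OF y] \<kappa> by (auto intro: less_le_trans[of _ "1 / (2 * \<kappa>)"])
    thus ?thesis using order_trans[OF Lh0[OF y] sub[OF y]] by (simp add: zero_le_mult_iff)
  qed
  \<comment> \<open>\<open>rad_le\<close> asks for a positive rate and \<rho>' may be 0; the
    midpoint is positive and still below \<open>rad c\<close>.\<close>
  define s where "s = (\<rho>' + rad c) / 2"
  have s: "\<rho>' \<le> s" "s < rad c" "s > 0" using \<rho>'0 G unfolding s_def \<rho>'_def by (auto simp: field_simps)
  have "L1 n y \<le> (2 * \<kappa> * G) * \<rho>' ^ n" if y: "y \<in> S" for n y
  proof -
    have "L1 n y \<le> (Lop c ^^ n) (\<lambda>x. 2 * \<kappa> * h x) y"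
      using hlow \<kappa> y by (intro Lop_iter_mono c_nonneg) (auto simp: field_simps)
    also have "\<dots> = 2 * \<kappa> * (Lop c ^^ n) h y" by (rule Lop_iter_scale[OF y])
    also have "\<dots> \<le> 2 * \<kappa> * (\<rho>' ^ n * h y)"
      using Lop_iter_subeigen[OF c_nonneg \<rho>'0 sub y] \<kappa> by (intro mult_left_mono) auto
    also have "\<dots> \<le> 2 * \<kappa> * (\<rho>' ^ n * G)"
      using hG[OF y] \<kappa> \<rho>'0 by (intro mult_left_mono) (auto simp: abs_le_iff)
    finally show ?thesis by (simp add: mult_ac)
  qed
  hence "growth c \<rho>'" unfolding growth_def by blast
  hence "growth c s" using growth_mono \<rho>'0 s by blast
  hence "rad c \<le> s" using rad_le s by blast
  thus False using s by simp
qed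

theorem spectral_radius_eq: "spectral_radius (CX mtopology) RC = rad c"
  unfolding spectral_radius_def
proof (rule cSup_eq_maximum)
  show "rad c \<in> cmod ` op_spectrum (CX mtopology) RC"
    using rad_in_spectrum rad_nonneg by (intro image_eqI[of _ _ "complex_of_real (rad c)"]) auto
  show "x \<le> rad c" if "x \<in> cmod ` op_spectrum (CX mtopology) RC" for x
    using that not_in_spectrum by force
qed

end

subsection \<open>Generators and the upper entropy bound\<close>

text \<open>Makes a finite cover disjoint while keeping its index as label; at each insertion the
  new index takes precedence. It is stated for an algebra so as to apply both to events and to the
  sets with null boundary.\<close>

lemma (in algebra) ex_selector:
  assumes "finite K" "\<And>k. k \<in> K \<Longrightarrow> A k \<in> M"
  shows "\<exists>\<kappa>. (\<forall>x\<in>\<Omega>. (\<exists>k\<in>K. x \<in> A k) \<longrightarrow> \<kappa> x \<in> K \<and> x \<in> A (\<kappa> x)) \<and> finite (\<kappa> ` \<Omega>) \<and> (\<forall>v. \<kappa> -` {v} \<inter> \<Omega> \<in> M)"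
  using assms
proof (induction K)
  case empty
  have "finite ((\<lambda>_. undefined) ` \<Omega>)" by (rule finite_subset[of _ "{undefined}"]) auto
  moreover have "(\<lambda>_. undefined) -` {v} \<inter> \<Omega> \<in> M" for v by (cases "v = undefined") auto
  ultimately show ?case by (intro exI[of _ "\<lambda>_. undefined"]) auto
next
  case (insert k K)
  have "\<exists>\<kappa>. (\<forall>x\<in>\<Omega>. (\<exists>k\<in>K. x \<in> A k) \<longrightarrow> \<kappa> x \<in> K \<and> x \<in> A (\<kappa> x)) \<and> finite (\<kappa> ` \<Omega>) \<and> (\<forall>v. \<kappa> -` {v} \<inter> \<Omega> \<in> M)"
    by (rule insert.IH) (use insert.prems in auto)
  then obtain \<kappa> where \<kappa>0: "\<forall>x\<in>\<Omega>. (\<exists>k\<in>K. x \<in> A k) \<longrightarrow> \<kappa> x \<in> K \<and> x \<in> A (\<kappa> x)"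
    and \<kappa>: "finite (\<kappa> ` \<Omega>)" "\<forall>v. \<kappa> -` {v} \<inter> \<Omega> \<in> M"
    by (elim exE conjE) (rule that)
  let ?\<kappa> = "\<lambda>x. if x \<in> A k then k else \<kappa> x"
  have Ak: "A k \<in> M" using insert by auto
  have "?\<kappa> ` \<Omega> \<subseteq> insert k (\<kappa> ` \<Omega>)" by auto
  hence "finite (?\<kappa> ` \<Omega>)" using \<kappa>(1) by (meson finite_insert finite_subset)
  moreover have "?\<kappa> -` {v} \<inter> \<Omega> \<in> M" for v
  proof -
    have "?\<kappa> -` {v} \<inter> \<Omega> = (if v = k then A k else {}) \<union> (\<kappa> -` {v} \<inter> \<Omega> - A k)" using sets_into_space[OF Ak] by auto
    thus ?thesis using Ak \<kappa>(2)[rule_format, of v] by (auto simp: Un Diff)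
  qed
  moreover have "\<forall>x\<in>\<Omega>. (\<exists>j\<in>insert k K. x \<in> A j) \<longrightarrow> ?\<kappa> x \<in> insert k K \<and> x \<in> A (?\<kappa> x)" using \<kappa>0 by auto
  ultimately show ?case by (intro exI[of _ ?\<kappa>] conjI allI)
qed

context compact_metric begin

lemma sets_borel: "sets (borel_of mtopology) = sigma_sets S {U. openin mtopology U}"
  and space_borel: "space (borel_of mtopology) = S"
proof -
  have "{U. openin mtopology U} \<subseteq> Pow S" using openin_subset by fastforce
  thus "sets (borel_of mtopology) = sigma_sets S {U. openin mtopology U}" "space (borel_of mtopology) = S"
    unfolding borel_of_def by simp_all
qed

lemma continuous_map_measurable:
  fixes f :: "'a \<Rightarrow> 'b::topological_space"
  assumes M: "sets M = sets (borel_of mtopology)" and f: "continuous_map mtopology euclidean f"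
  shows "f \<in> borel_measurable M"
proof (rule borel_measurableI)
  fix U :: "'b set" assume "open U"
  hence "openin mtopology {x \<in> topspace mtopology. f x \<in> U}" using f by (intro openin_continuous_map_preimage[of _ euclidean]) auto
  moreover have "f -` U \<inter> space M = {x \<in> topspace mtopology. f x \<in> U}"
    using sets_eq_imp_space_eq[OF M] space_borel by auto
  ultimately show "f -` U \<inter> space M \<in> sets M" unfolding M sets_borel by auto
qed

lemma continuous_map_d: "x \<in> S \<Longrightarrow> continuous_map mtopology euclideanreal (\<lambda>y. d y x)"
  unfolding continuous_map_metric_iff
proof (intro ballI allI impI)
  fix a \<epsilon> assume x: "x \<in> S" "a \<in> S" and \<epsilon>: "0 < (\<epsilon>::real)"
  show "\<exists>\<delta>>0. \<forall>y\<in>S. d a y < \<delta> \<longrightarrow> dist (d a x) (d y x) < \<epsilon>"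
  proof (intro exI[of _ \<epsilon>] conjI ballI impI \<epsilon>)
    fix y assume y: "y \<in> S" "d a y < \<epsilon>"
    thus "dist (d a x) (d y x) < \<epsilon>" using triangle[of a y x] triangle[of y a x] x by (simp add: dist_real_def commute abs_if)
  qed
qed

end

lemma (in prob_space) expectation_simple:
  fixes h :: "'b \<Rightarrow> real"
  assumes T: "simple_function M T"
  shows "(\<integral>x. h (T x) \<partial>M) = (\<Sum>t\<in>T ` space M. pr T t * h t)"
proof -
  have fin: "finite (T ` space M)" using T by (rule simple_functionD)
  have "(\<integral>x. h (T x) \<partial>M) = (\<integral>x. (\<Sum>t\<in>T ` space M. h t * indicator (T -` {t} \<inter> space M) x) \<partial>M)"
  proof (rule Bochner_Integration.integral_cong[OF refl])
    fix x assume x: "x \<in> space M"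
    have "(\<Sum>t\<in>T ` space M. h t * indicator (T -` {t} \<inter> space M) x) = (\<Sum>t\<in>T ` space M. if t = T x then h t else 0)"
      using x by (intro sum.cong) (auto simp: indicator_def)
    thus "h (T x) = (\<Sum>t\<in>T ` space M. h t * indicator (T -` {t} \<inter> space M) x)" using fin x by simp
  qed
  also have "\<dots> = (\<Sum>t\<in>T ` space M. h t * pr T t)"
    using simple_sets[OF T] by (subst Bochner_Integration.integral_sum) (auto intro!: integrable_mult_right integrable_real_indicator simp: emeasure_eq_measure)
  finally show ?thesis by (simp add: mult.commute)
qed

locale invariant_system = expanding_system S d \<phi> e \<theta> + pmp_system M \<phi>
  for S :: "'a set" and d \<phi> e \<theta> and M :: "'a measure" +
  assumes M_borel: "sets M = sets (borel_of mtopology)"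
begin

lemma space_M: "space M = S"
  using sets_eq_imp_space_eq[OF M_borel] space_borel by simp

lemma continuous_measurable: "continuous_map mtopology euclidean f \<Longrightarrow> f \<in> borel_measurable M"
  for f :: "'a \<Rightarrow> 'b::topological_space"
  by (rule continuous_map_measurable[OF M_borel])

lemma continuous_integrable:
  fixes f :: "'a \<Rightarrow> real"
  assumes f: "continuous_map mtopology euclideanreal f" shows "integrable M f"
proof -
  obtain B where "B > 0" "\<And>x. x \<in> S \<Longrightarrow> norm (f x) \<le> B" using continuous_bounded[OF f] by metis
  thus ?thesis using continuous_measurable[OF f] by (intro integrable_const_bound[of _ B] AE_I2) (auto simp: space_M)
qed

lemma open_sets: "openin mtopology U \<Longrightarrow> U \<in> events"
  unfolding M_borel sets_borel by (rule sigma_sets.Basic) simp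

text \<open>For open \<open>U\<close>, the level sets of \<open>T n\<close> inside \<open>U\<close>
  fill it up as the diameters shrink, since each point of \<open>U\<close> has a ball in
  \<open>U\<close>; dominated convergence turns this into convergence of measures.
  \<open>approximable_sigma\<close> extends it to all Borel sets.\<close>

lemma approximable_small_diameter:
  fixes T :: "nat \<Rightarrow> 'a \<Rightarrow> 'b"
  assumes T: "\<And>n. simple_function M (T n)" and D: "D \<longlonglongrightarrow> 0"
    and diam: "\<And>n x y. x \<in> S \<Longrightarrow> y \<in> S \<Longrightarrow> T n x = T n y \<Longrightarrow> d x y \<le> D n" and A: "A \<in> events"
  shows "approximable T A"
proof (rule approximable_sigma[OF T _ _ A])
  show "events = sigma_sets (space M) {U. openin mtopology U}" unfolding M_borel space_M by (rule sets_borel)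
  fix U assume "U \<in> {U. openin mtopology U}"
  hence U: "openin mtopology U" by simp
  define V where "V n = {s. \<forall>x\<in>S. T n x = s \<longrightarrow> x \<in> U}" for n
  define W where "W n = T n -` V n \<inter> space M" for n
  have Wev: "W n \<in> events" for n unfolding W_def by (rule simple_sets[OF T])
  have Uev: "U \<in> events" by (rule open_sets[OF U])
  have WU: "W n \<subseteq> U" for n unfolding W_def V_def space_M by auto
  have "(\<lambda>n. \<integral>x. indicator (W n) x \<partial>M) \<longlonglongrightarrow> (\<integral>x. (indicator U x :: real) \<partial>M)"
  proof (rule integral_dominated_convergence[where w="\<lambda>_. 1"])
    show "AE x in M. (\<lambda>n. indicator (W n) x) \<longlonglongrightarrow> (indicator U x :: real)"
    proof (rule AE_I2)
      fix x assume x: "x \<in> space M"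
      show "(\<lambda>n. indicator (W n) x) \<longlonglongrightarrow> (indicator U x :: real)"
      proof (cases "x \<in> U")
        case True
        then obtain r where r: "r > 0" "mball x r \<subseteq> U" using U unfolding openin_mtopology by blast
        have "\<forall>\<^sub>F n in sequentially. D n < r" using D r by (intro order_tendstoD(2)) auto
        hence "\<forall>\<^sub>F n in sequentially. indicator (W n) x = (indicator U x :: real)"
        proof eventually_elim
          case (elim n)
          have "y \<in> U" if "y \<in> S" "T n y = T n x" for y
          proof -
            have "d x y \<le> D n" using diam[of x y n] that x space_M by auto
            hence "y \<in> mball x r" using elim that x space_M by (simp add: in_mball)
            thus ?thesis using r by blast
          qed
          hence "x \<in> W n" using x unfolding W_def V_def by auto
          thus ?case using True by simp
        qed
        thus ?thesis by (rule tendsto_eventually)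
      next
        case False
        hence "x \<notin> W n" for n using WU by blast
        thus ?thesis using False by simp
      qed
    qed
  qed (use Wev Uev in \<open>auto simp: indicator_def\<close>)
  hence "(\<lambda>n. prob (W n)) \<longlonglongrightarrow> prob U" using Wev Uev by simp
  hence "(\<lambda>n. prob U - prob (W n)) \<longlonglongrightarrow> prob U - prob U" by (intro tendsto_diff tendsto_const)
  moreover have "prob U - prob (W n) = prob (sym_diff U (T n -` V n \<inter> space M))" for n
  proof -
    have "sym_diff U (W n) = U - W n" using WU by blast
    thus ?thesis using finite_measure_Diff[OF Uev Wev WU] unfolding W_def[symmetric] by simp
  qed
  ultimately have lim0: "(\<lambda>n. prob (sym_diff U (T n -` V n \<inter> space M))) \<longlonglongrightarrow> 0" by simp
  thus "approximable T U" unfolding approximable_def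
  proof (intro allI impI)
    fix \<epsilon> :: real assume "\<epsilon> > 0"
    with lim0 have "\<forall>\<^sub>F n in sequentially. prob (sym_diff U (T n -` V n \<inter> space M)) < \<epsilon>" by (intro order_tendstoD(2)) auto
    thus "\<forall>\<^sub>F n in sequentially. \<exists>V. prob (sym_diff U (T n -` V \<inter> space M)) < \<epsilon>" by eventually_elim blast
  qed
qed

text \<open>Points with a common itinerary of length \<open>n\<close> stay within \<open>e\<close>
  for \<open>n\<close> steps, so expansion forces them within \<open>B * (1 / \<theta>) ^ n\<close>
  of each other. The cells shrink uniformly and the itineraries approximate every event.\<close>

lemma erate_generator:
  assumes \<kappa>: "simple_function M \<kappa>" and diam: "\<And>x y. x \<in> S \<Longrightarrow> y \<in> S \<Longrightarrow> \<kappa> x = \<kappa> y \<Longrightarrow> d x y < e"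
    and R: "simple_function M R"
  shows "erate R \<le> erate \<kappa>"
proof (rule field_le_epsilon)
  fix \<epsilon> :: real assume \<epsilon>: "\<epsilon> > 0"
  obtain B where B: "\<And>x y. x \<in> S \<Longrightarrow> y \<in> S \<Longrightarrow> d x y \<le> B"
  proof -
    obtain x0 where x0: "x0 \<in> S" using nonempty by blast
    obtain B where "B > 0" "\<And>x. x \<in> S \<Longrightarrow> norm (d x x0) \<le> B" using continuous_bounded[OF continuous_map_d[OF x0]] by metis
    hence B: "d x x0 \<le> B" if "x \<in> S" for x using that by auto
    have "d x y \<le> B + B" if "x \<in> S" "y \<in> S" for x y
      using triangle[of x x0 y] that x0 commute[of x0 y] B[of x] B[of y] by auto
    thus ?thesis using that by blast
  qed
  have "\<forall>\<^sub>F n in sequentially. ent M (itin \<phi> \<kappa> n) / real n < erate \<kappa> + \<epsilon>"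
    using erate_lim[OF \<kappa>] \<epsilon> by (intro order_tendstoD(2)) auto
  then obtain N where N: "\<And>n. n \<ge> N \<Longrightarrow> ent M (itin \<phi> \<kappa> n) / real n < erate \<kappa> + \<epsilon>" unfolding eventually_sequentially by blast
  show "erate R \<le> erate \<kappa> + \<epsilon>"
  proof (rule erate_le_of_refining[OF R, where S="itin \<phi> \<kappa>" and a=0 and ?N0.0="max 1 N"])
    show "simple_function M (itin \<phi> \<kappa> n)" for n by (rule simple_itin[OF \<kappa>])
    show "itin \<phi> \<kappa> (n - i) ((\<phi> ^^ i) x) = itin \<phi> \<kappa> (n - i) ((\<phi> ^^ i) y)"
      if h: "i \<le> n" "itin \<phi> \<kappa> n x = itin \<phi> \<kappa> n y" for n i x y
      unfolding itin_eq_iff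
    proof (intro allI impI)
      fix j assume "j < n - i"
      hence "j + i < n" by simp
      hence "\<kappa> ((\<phi> ^^ (j + i)) x) = \<kappa> ((\<phi> ^^ (j + i)) y)" using h(2) unfolding itin_eq_iff by blast
      thus "\<kappa> ((\<phi> ^^ j) ((\<phi> ^^ i) x)) = \<kappa> ((\<phi> ^^ j) ((\<phi> ^^ i) y))" by (simp add: funpow_add)
    qed
    show "approximable (itin \<phi> \<kappa>) A" if "A \<in> events" for A
    proof (rule approximable_small_diameter[OF simple_itin[OF \<kappa>] _ _ that])
      have "(\<lambda>n. B * (1 / \<theta>) ^ n) \<longlonglongrightarrow> B * 0" using \<theta>_gt1 by (intro tendsto_intros LIMSEQ_power_zero) auto
      thus "(\<lambda>n. B * (1 / \<theta>) ^ n) \<longlonglongrightarrow> 0" by simp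
      fix n x y assume xy: "x \<in> S" "y \<in> S" "itin \<phi> \<kappa> n x = itin \<phi> \<kappa> n y"
      have "\<theta> ^ n * d x y \<le> d ((\<phi> ^^ n) x) ((\<phi> ^^ n) y)"
        using xy diam iter_S unfolding itin_eq_iff by (intro separation) auto
      also have "\<dots> \<le> B" using B xy iter_S by blast
      finally show "d x y \<le> B * (1 / \<theta>) ^ n" using \<theta>_gt1 by (simp add: field_simps power_divide)
    qed
    show "ent M (itin \<phi> \<kappa> n) \<le> 0 + real n * (erate \<kappa> + \<epsilon>)" if "max 1 N \<le> n" for n
      using N[of n] that by (simp add: field_simps)
  qed
qed

text \<open>The partition by pulled-back net points: z n x is the point shadowing the orbit of x for n steps
  whose n-th image is the net point chosen for the n-th image of x.\<close>
lemma erate_le_growth: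
  assumes c: "continuous_map mtopology euclideanreal c" "\<And>x. x \<in> S \<Longrightarrow> c x > 0"
    and \<rho>: "\<rho> > 0" "growth c \<rho>" and R: "simple_function M R"
  shows "erate R \<le> ln \<rho> - (\<integral>x. ln (c x) \<partial>M)"
proof (rule field_le_epsilon)
  fix \<eta> :: real assume \<eta>: "\<eta> > 0"
  have lnc: "continuous_map mtopology euclideanreal (\<lambda>x. ln (c x))"
  proof -
    have "continuous_map mtopology (top_of_set {0<..}) c" using c by (auto simp: continuous_map_in_subtopology)
    moreover have "continuous_map (top_of_set {0<..}) euclideanreal (ln :: real \<Rightarrow> real)" by (auto intro!: continuous_intros)
    ultimately show ?thesis using continuous_map_compose[of _ _ c _ ln] by (simp add: o_def)
  qed
  from uniformly_continuous[OF lnc \<eta>] obtain \<delta>1 where \<delta>1: "\<delta>1 > 0"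
    "\<And>x y. x \<in> S \<Longrightarrow> y \<in> S \<Longrightarrow> d x y < \<delta>1 \<Longrightarrow> dist (ln (c x)) (ln (c y)) < \<eta>" by metis
  \<comment> \<open>Three demands: a net point within \<delta> can be lifted, a shadowing point is
    unique since \<open>2 * \<delta> < e\<close>, and \<open>ln c\<close> varies by less than \<eta>
    at distance \<delta>.\<close>
  define \<delta> where "\<delta> = min (lift_radius / 2) (\<delta>1 / 2)"
  have \<delta>: "\<delta> > 0" "\<delta> < \<delta>1" "\<delta> < lift_radius" "2 * \<delta> < e" using lift_radius e_pos \<delta>1 unfolding \<delta>_def by auto
  obtain N where N: "finite N" "N \<subseteq> S" "\<And>x. x \<in> S \<Longrightarrow> \<exists>k\<in>N. d k x < \<delta>" using finite_net[OF \<delta>(1)] by metis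
  have "\<exists>\<kappa>. (\<forall>x\<in>space M. (\<exists>k\<in>N. x \<in> mball k \<delta>) \<longrightarrow> \<kappa> x \<in> N \<and> x \<in> mball (\<kappa> x) \<delta>) \<and> finite (\<kappa> ` space M) \<and> (\<forall>v. \<kappa> -` {v} \<inter> space M \<in> events)"
    by (rule sets.ex_selector) (use N open_sets in auto)
  then obtain \<kappa> where \<kappa>0: "\<forall>x\<in>S. (\<exists>k\<in>N. x \<in> mball k \<delta>) \<longrightarrow> \<kappa> x \<in> N \<and> x \<in> mball (\<kappa> x) \<delta>"
    "finite (\<kappa> ` space M)" "\<forall>v. \<kappa> -` {v} \<inter> space M \<in> events" unfolding space_M by blast
  have \<kappa>s: "simple_function M \<kappa>" using \<kappa>0 by (auto simp: simple_function_def)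
  have \<kappa>: "\<kappa> x \<in> N" "\<kappa> x \<in> S" "d x (\<kappa> x) < \<delta>" if "x \<in> S" for x
  proof -
    have "\<exists>k\<in>N. x \<in> mball k \<delta>" using N that by (fastforce simp: in_mball)
    hence "\<kappa> x \<in> N \<and> x \<in> mball (\<kappa> x) \<delta>" using \<kappa>0(1) that by blast
    thus "\<kappa> x \<in> N" "\<kappa> x \<in> S" "d x (\<kappa> x) < \<delta>" by (auto simp: in_mball commute)
  qed
  define zp where "zp n x z \<longleftrightarrow> z \<in> S \<and> (\<phi> ^^ n) z = \<kappa> ((\<phi> ^^ n) x) \<and> (\<forall>i\<le>n. d ((\<phi> ^^ i) x) ((\<phi> ^^ i) z) \<le> \<delta> / \<theta> ^ (n - i))" for n x z
  have zp_ex: "\<exists>z. zp n x z" if x: "x \<in> S" for n x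
  proof -
    let ?y = "\<kappa> ((\<phi> ^^ n) x)"
    have y: "?y \<in> S" "d ((\<phi> ^^ n) x) ?y < \<delta>" using \<kappa> iter_S[OF x] by auto
    hence "d ((\<phi> ^^ n) x) ?y < lift_radius" using \<delta> by simp
    from lift_iter[OF x y(1) this] obtain z where z: "z \<in> S" "(\<phi> ^^ n) z = ?y"
      "\<forall>i\<le>n. d ((\<phi> ^^ i) x) ((\<phi> ^^ i) z) \<le> d ((\<phi> ^^ n) x) ?y / \<theta> ^ (n - i)" by blast
    have "d ((\<phi> ^^ n) x) ?y / \<theta> ^ (n - i) \<le> \<delta> / \<theta> ^ (n - i)" for i
      using y \<theta>_gt1 by (intro divide_right_mono) auto
    hence "zp n x z" unfolding zp_def using z order_trans by blast
    thus ?thesis by blast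
  qed
  have div_le: "\<delta> / \<theta> ^ k \<le> \<delta>" for k using \<delta> \<theta>_gt1 by (simp add: divide_le_eq mult_le_cancel_left1)
  have zp_close: "d ((\<phi> ^^ i) x) ((\<phi> ^^ i) z) \<le> \<delta>" if "zp n x z" "i \<le> n" for n x z i
    using that div_le unfolding zp_def by (meson order_trans)
  have zp_unique: "z = z'" if x: "x \<in> S" and z: "zp n x z" "zp n x z'" for n x z z'
  proof (rule separation_eq)
    show S: "z \<in> S" "z' \<in> S" "(\<phi> ^^ n) z = (\<phi> ^^ n) z'" using z unfolding zp_def by auto
    fix i assume i: "i < n"
    have "d ((\<phi> ^^ i) z) ((\<phi> ^^ i) z') \<le> d ((\<phi> ^^ i) z) ((\<phi> ^^ i) x) + d ((\<phi> ^^ i) x) ((\<phi> ^^ i) z')"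
      using S x iter_S by (intro triangle) auto
    also have "\<dots> \<le> \<delta> + \<delta>" using zp_close[OF z(1), of i] zp_close[OF z(2), of i] i by (intro add_mono) (auto simp: commute)
    finally show "d ((\<phi> ^^ i) z) ((\<phi> ^^ i) z') < e" using \<delta> by simp
  qed
  define z where "z n x = (SOME z. zp n x z)" for n x
  have z: "zp n x (z n x)" if "x \<in> S" for n x unfolding z_def by (rule someI_ex[OF zp_ex[OF that]])
  have z_eq: "z n x = v \<longleftrightarrow> zp n x v" if "x \<in> S" for n x v using z[OF that] zp_unique[OF that] by blast
  have z_range: "z n ` S \<subseteq> (\<Union>y\<in>N. fib n y)" for n
  proof (rule image_subsetI)
    fix x assume x: "x \<in> S"
    show "z n x \<in> (\<Union>y\<in>N. fib n y)" using z[OF x, of n] \<kappa>(1)[OF iter_S[OF x, of n]] unfolding zp_def fib_def by blast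
  qed
  have zs: "simple_function M (z n)" for n
    unfolding simple_function_def space_M
  proof (intro conjI ballI)
    show "finite (z n ` S)" using z_range finite_fib N(1) by (meson finite_UN_I finite_subset)
    fix v assume "v \<in> z n ` S"
    hence v: "v \<in> S" using z unfolding zp_def by blast
    \<comment> \<open>Measurability cannot be read off from the choice operator. Uniqueness of the
      shadowing point replaces the equation by finitely many explicit conditions on
      \<open>x\<close>.\<close>
    have "z n -` {v} \<inter> S = {x \<in> space M. zp n x v}" using z_eq space_M by auto
    also have "\<dots> = {x \<in> space M. (\<phi> ^^ n) v = \<kappa> ((\<phi> ^^ n) x)} \<inter> (\<Inter>i\<in>{..n}. {x \<in> space M. d ((\<phi> ^^ i) x) ((\<phi> ^^ i) v) \<le> \<delta> / \<theta> ^ (n - i)})"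
      unfolding zp_def using v by auto
    also have "\<dots> \<in> events"
    proof (intro sets.Int sets.finite_INT)
      have "{x \<in> space M. (\<phi> ^^ n) v = \<kappa> ((\<phi> ^^ n) x)} = (\<lambda>x. \<kappa> ((\<phi> ^^ n) x)) -` {(\<phi> ^^ n) v} \<inter> space M" by auto
      thus "{x \<in> space M. (\<phi> ^^ n) v = \<kappa> ((\<phi> ^^ n) x)} \<in> events" using simple_sets[OF simple_iter[OF \<kappa>s]] by simp
      fix i
      have "continuous_map mtopology euclideanreal ((\<lambda>y. d y ((\<phi> ^^ i) v)) \<circ> (\<phi> ^^ i))"
        by (rule continuous_map_compose[OF cont_iter continuous_map_d[OF iter_S[OF v]]])
      hence "(\<lambda>x. d ((\<phi> ^^ i) x) ((\<phi> ^^ i) v)) \<in> borel_measurable M" using continuous_measurable by (simp add: o_def)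
      thus "{x \<in> space M. d ((\<phi> ^^ i) x) ((\<phi> ^^ i) v) \<le> \<delta> / \<theta> ^ (n - i)} \<in> events" by measurable
    qed auto
    finally show "z n -` {v} \<inter> S \<in> events" .
  qed
  let ?I = "\<integral>x. ln (c x) \<partial>M"
  obtain C where C: "\<And>n y. y \<in> S \<Longrightarrow> (Lop c ^^ n) (\<lambda>_. 1) y \<le> C * \<rho> ^ n" using \<rho>(2) unfolding growth_def by blast
  have C1: "C \<ge> 1"
  proof -
    obtain y where "y \<in> S" using nonempty by blast
    from C[OF this, of 0] show ?thesis by simp
  qed
  have Nne: "card N > 0" using N nonempty by (auto simp: card_gt_0_iff)
  have orbit_prod_pos: "orbit_prod c n v > 0" if "v \<in> S" for n v unfolding orbit_prod_def using c(2) iter_S[OF that] by (intro prod_pos) auto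
  \<comment> \<open>The points \<open>z n x\<close> lie in the fibres over the net, so their total
    weight is at most \<open>card N * C * \<rho> ^ n\<close>; this is the \<open>W\<close> of the
    Gibbs inequality. Along the orbit, the weights at \<open>z n x\<close> and at \<open>x\<close>
    differ by at most \<eta> per step in the logarithm.\<close>
  have bound: "ent M (z n) \<le> ln (real (card N) * C) + real n * (ln \<rho> - ?I + \<eta>)" for n
  proof -
    let ?W = "real (card N) * C * \<rho> ^ n"
    have "ent M (z n) \<le> ln ?W - (\<Sum>v\<in>z n ` space M. pr (z n) v * ln (orbit_prod c n v))"
      unfolding ent_def
    proof (rule gibbs_ineq)
      show "sum (pr (z n)) (z n ` space M) = 1" by (rule pr_sum_1[OF zs])
      have zS: "v \<in> S" if "v \<in> z n ` space M" for v using that z space_M unfolding zp_def by blast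
      show "orbit_prod c n v \<ge> 0" "orbit_prod c n v > 0" if "v \<in> z n ` space M" for v using orbit_prod_pos[OF zS[OF that]] by (auto intro: less_imp_le)
      have "sum (orbit_prod c n) (z n ` space M) \<le> sum (orbit_prod c n) (\<Union>y\<in>N. fib n y)"
      proof (rule sum_mono2)
        show "orbit_prod c n b \<ge> 0" if "b \<in> (\<Union>y\<in>N. fib n y) - z n ` space M" for b
          using that orbit_prod_pos[of b n] fib_subset by (auto intro: less_imp_le)
      qed (use z_range N(1) finite_fib space_M in auto)
      also have "\<dots> = (\<Sum>y\<in>N. sum (orbit_prod c n) (fib n y))"
        using N(1) finite_fib by (intro sum.UNION_disjoint) (auto simp: fib_def)
      also have "\<dots> \<le> (\<Sum>y\<in>N. C * \<rho> ^ n)"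
      proof (rule sum_mono)
        fix y assume "y \<in> N"
        hence "y \<in> S" using N by auto
        from C[OF this, of n] show "sum (orbit_prod c n) (fib n y) \<le> C * \<rho> ^ n" using Lop_iter_eq[OF \<open>y \<in> S\<close>, of n c "\<lambda>_. 1"] by simp
      qed
      finally show "sum (orbit_prod c n) (z n ` space M) \<le> ?W" by simp
    qed (use simple_functionD[OF zs] in auto)
    also have "(\<Sum>v\<in>z n ` space M. pr (z n) v * ln (orbit_prod c n v)) = (\<integral>x. ln (orbit_prod c n (z n x)) \<partial>M)"
      by (rule expectation_simple[OF zs, symmetric])
    also have "ln ?W - \<dots> \<le> ln ?W - real n * (?I - \<eta>)"
    proof -
      have int_i: "integrable M (\<lambda>x. ln (c ((\<phi> ^^ i) x)))" for i
        using continuous_integrable[OF continuous_map_compose[OF cont_iter lnc], of i] by (simp add: o_def)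
      have "real n * (?I - \<eta>) = (\<Sum>i<n. (\<integral>x. ln (c ((\<phi> ^^ i) x)) \<partial>M) - \<eta>)"
        using integral_iter[OF continuous_measurable[OF lnc]] by simp
      also have "\<dots> = (\<integral>x. (\<Sum>i<n. ln (c ((\<phi> ^^ i) x)) - \<eta>) \<partial>M)"
        using int_i by (subst Bochner_Integration.integral_sum) (auto simp: prob_space)
      also have "\<dots> \<le> (\<integral>x. ln (orbit_prod c n (z n x)) \<partial>M)"
      proof (rule integral_mono)
        show "integrable M (\<lambda>x. \<Sum>i<n. ln (c ((\<phi> ^^ i) x)) - \<eta>)" using int_i by auto
        show "integrable M (\<lambda>x. ln (orbit_prod c n (z n x)))"
        proof -
          have s: "simple_function M (\<lambda>x. ln (orbit_prod c n (z n x)))" using simple_function_compose[OF zs, of "\<lambda>v. ln (orbit_prod c n v)"] by (simp add: o_def)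
          have fin: "finite ((\<lambda>x. ln (orbit_prod c n (z n x))) ` space M)" by (rule simple_functionD(1)[OF s])
          obtain b where "\<forall>v\<in>(\<lambda>x. ln (orbit_prod c n (z n x))) ` space M. norm v \<le> b"
            using finite_imp_bounded[OF fin] unfolding bounded_iff by blast
          thus ?thesis using borel_measurable_simple_function[OF s] by (intro integrable_const_bound[of _ b] AE_I2) auto
        qed
        fix x assume "x \<in> space M"
        hence x: "x \<in> S" by (simp add: space_M)
        have zS: "z n x \<in> S" using z[OF x] unfolding zp_def by blast
        have "ln (c ((\<phi> ^^ i) x)) - \<eta> \<le> ln (c ((\<phi> ^^ i) (z n x)))" if "i < n" for i
        proof -
          have "d ((\<phi> ^^ i) x) ((\<phi> ^^ i) (z n x)) < \<delta>1" using zp_close[OF z[OF x], of i n] that \<delta> by simp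
          from \<delta>1(2)[OF iter_S[OF x] iter_S[OF zS] this] show ?thesis by (simp add: dist_real_def abs_less_iff)
        qed
        hence "(\<Sum>i<n. ln (c ((\<phi> ^^ i) x)) - \<eta>) \<le> (\<Sum>i<n. ln (c ((\<phi> ^^ i) (z n x))))" by (intro sum_mono) auto
        also have "\<dots> = ln (orbit_prod c n (z n x))"
          unfolding orbit_prod_def by (subst ln_prod) (use c(2)[OF iter_S[OF zS]] in \<open>auto simp: less_le\<close>)
        finally show "(\<Sum>i<n. ln (c ((\<phi> ^^ i) x)) - \<eta>) \<le> ln (orbit_prod c n (z n x))" .
      qed
      finally show ?thesis by simp
    qed
    also have "ln ?W = ln (real (card N) * C) + real n * ln \<rho>"
      using Nne C1 \<rho> by (simp add: ln_mult ln_realpow)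
    finally show ?thesis by (simp add: algebra_simps)
  qed
  show "erate R \<le> ln \<rho> - ?I + \<eta>"
  proof (rule erate_le_of_refining[OF R, where S=z and ?N0.0=0])
    show "simple_function M (z n)" for n by (rule zs)
    show "ent M (z n) \<le> ln (real (card N) * C) + real n * (ln \<rho> - ?I + \<eta>)" for n by (rule bound)
    \<comment> \<open>The \<open>i\<close>-th image of the shadowing point shadows the rest of the
      orbit, hence by uniqueness is the point chosen for the remaining \<open>n - i\<close>
      steps.\<close>
    show "z (n - i) ((\<phi> ^^ i) x) = z (n - i) ((\<phi> ^^ i) y)"
      if h: "i \<le> n" "x \<in> space M" "y \<in> space M" "z n x = z n y" for n i x y
    proof -
      have "z (n - i) ((\<phi> ^^ i) w) = (\<phi> ^^ i) (z n w)" if w: "w \<in> S" for w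
        unfolding z_eq[OF iter_S[OF w]]
      proof -
        have zw: "zp n w (z n w)" by (rule z[OF w])
        have comp: "(\<phi> ^^ j) ((\<phi> ^^ i) v) = (\<phi> ^^ (j + i)) v" for j v by (simp add: funpow_add)
        show "zp (n - i) ((\<phi> ^^ i) w) ((\<phi> ^^ i) (z n w))"
          unfolding zp_def comp
        proof (intro conjI allI impI)
          show "(\<phi> ^^ i) (z n w) \<in> S" "(\<phi> ^^ (n - i + i)) (z n w) = \<kappa> ((\<phi> ^^ (n - i + i)) w)"
            using zw h(1) iter_S unfolding zp_def by auto
          fix j assume "j \<le> n - i"
          hence "j + i \<le> n" "n - (j + i) = n - i - j" using h(1) by auto
          thus "d ((\<phi> ^^ (j + i)) w) ((\<phi> ^^ (j + i)) (z n w)) \<le> \<delta> / \<theta> ^ (n - i - j)" using zw unfolding zp_def by metis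
        qed
      qed
      thus ?thesis using h space_M by simp
    qed
    show "approximable z A" if "A \<in> events" for A
    proof (rule approximable_small_diameter[OF zs _ _ that])
      have "(\<lambda>n. 2 * \<delta> * (1 / \<theta>) ^ n) \<longlonglongrightarrow> 2 * \<delta> * 0" using \<theta>_gt1 by (intro tendsto_intros LIMSEQ_power_zero) auto
      thus "(\<lambda>n. 2 * \<delta> * (1 / \<theta>) ^ n) \<longlonglongrightarrow> 0" by simp
      fix n x y assume xy: "x \<in> S" "y \<in> S" "z n x = z n y"
      have 1: "d x (z n x) \<le> \<delta> / \<theta> ^ n" if "x \<in> S" for x
      proof -
        have "d ((\<phi> ^^ 0) x) ((\<phi> ^^ 0) (z n x)) \<le> \<delta> / \<theta> ^ (n - 0)" using z[OF that, of n] unfolding zp_def by blast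
        thus ?thesis by simp
      qed
      have zS: "z n x \<in> S" using z[OF xy(1)] unfolding zp_def by blast
      have "d x y \<le> d x (z n x) + d (z n x) y" using xy zS by (intro triangle) auto
      also have "\<dots> \<le> \<delta> / \<theta> ^ n + \<delta> / \<theta> ^ n" using 1[OF xy(1)] 1[OF xy(2)] xy(3) by (intro add_mono) (auto simp: commute)
      finally show "d x y \<le> 2 * \<delta> * (1 / \<theta>) ^ n" by (simp add: power_divide)
    qed
  qed
qed

end

context compact_metric begin

definition net :: "nat \<Rightarrow> 'a set" where
  "net m = (SOME K. finite K \<and> K \<subseteq> S \<and> (\<forall>x\<in>S. \<exists>k\<in>K. d k x < 1 / (real m + 1)))"

lemma net: "finite (net m)" "net m \<subseteq> S" "\<And>x. x \<in> S \<Longrightarrow> \<exists>k\<in>net m. d k x < 1 / (real m + 1)"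
proof -
  obtain K where K: "finite K" "K \<subseteq> S" "\<And>x. x \<in> S \<Longrightarrow> \<exists>k\<in>K. d k x < 1 / (real m + 1)"
    using finite_net[of "1 / (real m + 1)"] by (metis add.commute of_nat_0_less_iff of_nat_Suc zero_less_Suc zero_less_divide_1_iff)
  have "finite (net m) \<and> net m \<subseteq> S \<and> (\<forall>x\<in>S. \<exists>k\<in>net m. d k x < 1 / (real m + 1))"
    unfolding net_def by (rule someI[of _ K]) (use K in auto)
  thus "finite (net m)" "net m \<subseteq> S" "\<And>x. x \<in> S \<Longrightarrow> \<exists>k\<in>net m. d k x < 1 / (real m + 1)" by blast+
qed

lemma continuous_map_comp_real:
  fixes f :: "'a \<Rightarrow> real" and g :: "real \<Rightarrow> real"
  assumes f: "continuous_map mtopology euclideanreal f" and g: "continuous_on UNIV g"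
  shows "continuous_map mtopology euclideanreal (\<lambda>x. g (f x))"
proof -
  have "continuous_map euclideanreal euclideanreal g" using g by simp
  from continuous_map_compose[OF f this] show ?thesis by (simp add: o_def)
qed

subsection \<open>A countable family of continuous functions determining a measure\<close>

text \<open>A continuous approximate indicator: 1 within \<open>1 / (m + 1)\<close> of a point of
  \<open>T\<close>, and 0 where all points of \<open>T\<close> are at distance at least
  \<open>2 / (m + 1)\<close>. Letting \<open>T\<close> range over subsets of finite nets keeps the
  family countable.\<close>

definition bump :: "nat \<Rightarrow> 'a set \<Rightarrow> 'a \<Rightarrow> real" where
  "bump m T x = min 1 (\<Sum>t\<in>T. max 0 (min 1 (2 - (real m + 1) * d x t)))"

lemma bump_bounds: "0 \<le> bump m T x" "bump m T x \<le> 1"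
  unfolding bump_def by (auto intro!: sum_nonneg)

lemma bump_continuous: assumes "finite T" "T \<subseteq> S" shows "continuous_map mtopology euclideanreal (bump m T)"
proof -
  have "continuous_map mtopology euclideanreal (\<lambda>x. \<Sum>t\<in>T. max 0 (min 1 (2 - (real m + 1) * d x t)))"
    using assms
  proof (induction T)
    case (insert t T)
    have "continuous_map mtopology euclideanreal (\<lambda>x. max 0 (min 1 (2 - (real m + 1) * d x t)))"
      using insert by (intro continuous_map_comp_real[OF continuous_map_d, where g="\<lambda>u. max 0 (min 1 (2 - (real m + 1) * u))"] continuous_intros) auto
    with insert show ?case by (auto intro!: continuous_intros)
  qed simp
  thus ?thesis unfolding bump_def[abs_def]
    by (rule continuous_map_comp_real[where g="\<lambda>u. min 1 u"]) (intro continuous_intros)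
qed

lemma bump_eq_1:
  assumes "finite T" "t \<in> T" "(real m + 1) * d x t \<le> 1" shows "bump m T x = 1"
proof -
  have "max 0 (min 1 (2 - (real m + 1) * d x t)) \<le> (\<Sum>t\<in>T. max 0 (min 1 (2 - (real m + 1) * d x t)))"
    using assms by (intro member_le_sum) auto
  thus ?thesis using assms unfolding bump_def by simp
qed

lemma bump_eq_0:
  assumes "\<And>t. t \<in> T \<Longrightarrow> (real m + 1) * d x t \<ge> 2" shows "bump m T x = 0"
proof -
  have "(\<Sum>t\<in>T. max 0 (min 1 (2 - (real m + 1) * d x t))) = 0"
  proof (intro sum.neutral ballI)
    fix t assume "t \<in> T"
    hence "2 - (real m + 1) * d x t \<le> 0" using assms[of t] by linarith
    thus "max 0 (min 1 (2 - (real m + 1) * d x t)) = 0" by (simp add: max_def min_def)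
  qed
  thus ?thesis unfolding bump_def by simp
qed

text \<open>For closed \<open>F\<close>, let \<open>T\<close> be the net points within
  \<open>1 / (m + 1)\<close> of \<open>F\<close>. The bump is 1 on \<open>F\<close> and vanishes at
  distance \<open>3 / (m + 1)\<close>: two units from the bump, one from \<open>T\<close>. Dominated
  convergence gives the measure of \<open>F\<close>, and open sets form a generating system stable
  under intersection.\<close>

lemma measure_eq_of_bumps:
  assumes M: "prob_space M" "sets M = sets (borel_of mtopology)" and N: "prob_space N" "sets N = sets (borel_of mtopology)"
    and eq: "\<And>m T. T \<subseteq> net m \<Longrightarrow> (\<integral>x. bump m T x \<partial>M) = (\<integral>x. bump m T x \<partial>N)"
  shows "M = N"
proof -
  define T where "T F m = {t \<in> net m. \<exists>y\<in>F. d y t < 1 / (real m + 1)}" for F m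
  have Tnet: "T F m \<subseteq> net m" for F m unfolding T_def by auto
  have cont: "continuous_map mtopology euclideanreal (bump m (T F m))" for F m
    using Tnet net(1,2) by (intro bump_continuous) (meson finite_subset, blast)
  have lim: "(\<lambda>m. \<integral>x. bump m (T (S - U) m) x \<partial>P) \<longlonglongrightarrow> measure P (S - U)"
    if P: "prob_space P" "sets P = sets (borel_of mtopology)" and U: "openin mtopology U" for P U
  proof -
    interpret P: prob_space P by fact
    have spP: "space P = S" using sets_eq_imp_space_eq[OF P(2)] space_borel by simp
    let ?F = "S - U"
    have "U \<in> sets P" unfolding P(2) sets_borel using U by (intro sigma_sets.Basic) simp
    hence F: "?F \<in> sets P" using spP sets.compl_sets[of U P] by simp
    have "(\<lambda>m. \<integral>x. bump m (T ?F m) x \<partial>P) \<longlonglongrightarrow> (\<integral>x. indicator ?F x \<partial>P)"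
    proof (rule integral_dominated_convergence[where w="\<lambda>_. 1"])
      show "(\<lambda>x. bump m (T ?F m) x) \<in> borel_measurable P" for m by (rule continuous_map_measurable[OF P(2) cont])
      show "AE x in P. (\<lambda>m. bump m (T ?F m) x) \<longlonglongrightarrow> indicator ?F x"
      proof (rule AE_I2)
        fix x assume "x \<in> space P"
        hence x: "x \<in> S" using spP by simp
        show "(\<lambda>m. bump m (T ?F m) x) \<longlonglongrightarrow> indicator ?F x"
        proof (cases "x \<in> U")
          case False
          have "bump m (T ?F m) x = 1" for m
          proof -
            obtain t where t: "t \<in> net m" "d t x < 1 / (real m + 1)" using net(3)[OF x] by blast
            hence "t \<in> T ?F m" unfolding T_def using x False by (auto simp: commute)
            moreover have "(real m + 1) * d x t \<le> 1" using t(2) by (simp add: commute field_simps)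
            ultimately show ?thesis using Tnet net(1) by (intro bump_eq_1[of _ t]) (meson finite_subset, auto)
          qed
          thus ?thesis using False x by simp
        next
          case True
          then obtain r where r: "r > 0" "mball x r \<subseteq> U" using U unfolding openin_mtopology by blast
          have "\<forall>\<^sub>F m in sequentially. 3 / (real m + 1) < r" using r(1) by real_asymp
          hence "\<forall>\<^sub>F m in sequentially. bump m (T ?F m) x = 0"
          proof eventually_elim
            case (elim m)
            show ?case
            proof (rule bump_eq_0)
              fix t assume "t \<in> T ?F m"
              then obtain y where y: "y \<in> S" "y \<notin> U" "d y t < 1 / (real m + 1)" and t: "t \<in> S" unfolding T_def using net(2) by blast
              have "y \<notin> mball x r" using r(2) y by blast
              hence "r \<le> d x y" using x y by (simp add: in_mball)
              also have "\<dots> \<le> d x t + d y t" using triangle[of x t y] x y t by (simp add: commute)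
              finally have "3 / (real m + 1) < d x t + 1 / (real m + 1)" using elim y(3) by linarith
              moreover have "3 / (real m + 1) = 2 / (real m + 1) + 1 / (real m + 1)" by (simp add: add_divide_distrib[symmetric])
              ultimately have "2 / (real m + 1) < d x t" by linarith
              thus "2 \<le> (real m + 1) * d x t" by (simp add: field_simps)
            qed
          qed
          thus ?thesis using True by (simp add: tendsto_eventually)
        qed
      qed
      show "AE x in P. norm (bump m (T ?F m) x) \<le> 1" for m using bump_bounds by auto
    qed (use F in auto)
    thus ?thesis using F by simp
  qed
  interpret M: prob_space M by fact
  interpret N: prob_space N by fact
  have spM: "space M = S" "space N = S" using sets_eq_imp_space_eq[OF M(2)] sets_eq_imp_space_eq[OF N(2)] space_borel by auto
  show "M = N"
  proof (rule measure_eqI_generator_eq[where E="{U. openin mtopology U}" and \<Omega>=S and A="\<lambda>_. S"])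
    show "Int_stable {U. openin mtopology U}" unfolding Int_stable_def by auto
    show "{U. openin mtopology U} \<subseteq> Pow S" using openin_subset by fastforce
    show "sets M = sigma_sets S {U. openin mtopology U}" "sets N = sigma_sets S {U. openin mtopology U}" using M N sets_borel by auto
    show "range (\<lambda>_. S) \<subseteq> {U. openin mtopology U}" using openin_topspace[of mtopology] by auto
    fix U assume "U \<in> {U. openin mtopology U}"
    hence U: "openin mtopology U" by simp
    have "measure M (S - U) = measure N (S - U)"
      using lim[OF M U] lim[OF N U] eq[OF Tnet] by (intro LIMSEQ_unique[OF lim[OF M U]]) simp
    moreover have Us: "U \<in> sets M" "U \<in> sets N" unfolding M(2) N(2) sets_borel using U by (auto intro: sigma_sets.Basic)
    ultimately have "measure M U = measure N U"
      using M.prob_compl[OF Us(1)] N.prob_compl[OF Us(2)] unfolding spM by simp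
    thus "emeasure M U = emeasure N U" by (simp add: M.emeasure_eq_measure N.emeasure_eq_measure)
  qed (use M.emeasure_finite in auto)
qed

text \<open>Enumerates the bumps over all subsets of all nets. Countability and the bounds 0 and 1
  allow a convergent weighted sum over the family later on.\<close>

lemma determining_family:
  obtains G :: "nat \<Rightarrow> 'a \<Rightarrow> real" where "\<And>k. continuous_map mtopology euclideanreal (G k)" "\<And>k x. 0 \<le> G k x" "\<And>k x. G k x \<le> 1"
    "\<forall>M N. prob_space M \<and> sets M = sets (borel_of mtopology) \<and> prob_space N \<and> sets N = sets (borel_of mtopology) \<and>
      (\<forall>k. (\<integral>x. G k x \<partial>M) = (\<integral>x. G k x \<partial>N)) \<longrightarrow> M = N"
proof -
  define I where "I = (SIGMA m:UNIV. Pow (net m))"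
  have I1: "countable I" unfolding I_def by (rule countable_SIGMA[OF countableI_type countable_finite]) (simp add: net(1))
  have I2: "I \<noteq> {}" unfolding I_def by auto
  note I = I1 I2
  define G where "G k = (case from_nat_into I k of (m, T) \<Rightarrow> bump m T)" for k
  have GI: "\<exists>m T. T \<subseteq> net m \<and> G k = bump m T" for k
  proof -
    obtain m T where mT: "from_nat_into I k = (m, T)" by (cases "from_nat_into I k")
    hence "(m, T) \<in> I" using from_nat_into[OF I(2), of k] by simp
    thus ?thesis using mT unfolding G_def I_def by (intro exI[of _ m] exI[of _ T]) simp
  qed
  have IG: "\<exists>k. G k = bump m T" if "T \<subseteq> net m" for m T
  proof -
    have "(m, T) \<in> I" using that unfolding I_def by auto
    then obtain k where "from_nat_into I k = (m, T)" using from_nat_into_surj[OF I(1)] by blast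
    thus ?thesis unfolding G_def by (intro exI[of _ k]) simp
  qed
  show ?thesis
  proof (rule that[of G])
    fix k x
    obtain m T where mT: "T \<subseteq> net m" "G k = bump m T" using GI by blast
    show "continuous_map mtopology euclideanreal (G k)" unfolding mT(2)
      using mT(1) net(1,2) by (intro bump_continuous) (meson finite_subset, blast)
    show "0 \<le> G k x" "G k x \<le> 1" unfolding mT(2) by (rule bump_bounds)+
  next
    show "\<forall>M N. prob_space M \<and> sets M = sets (borel_of mtopology) \<and> prob_space N \<and> sets N = sets (borel_of mtopology) \<and>
      (\<forall>k. (\<integral>x. G k x \<partial>M) = (\<integral>x. G k x \<partial>N)) \<longrightarrow> M = N"
    proof (intro allI impI, elim conjE)
      fix M N assume MN: "prob_space M" "sets M = sets (borel_of mtopology)" "prob_space N" "sets N = sets (borel_of mtopology)"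
        and eq: "\<forall>k. (\<integral>x. G k x \<partial>M) = (\<integral>x. G k x \<partial>N)"
      show "M = N" by (rule measure_eq_of_bumps[OF MN]) (metis IG eq)
    qed
  qed
qed

subsection \<open>Sequential compactness of the space of probability measures\<close>

text \<open>The ternary code of x records which balls of the nets contain x. Nearby codes come from nearby points,
  so the code has a continuous left inverse on the closure of its range, and Helly's theorem on the
  line can be transported.\<close>
lemma ternary_code:
  obtains s :: "'a \<Rightarrow> real" where "s \<in> borel_measurable (borel_of mtopology)" "\<And>x. 0 \<le> s x" "\<And>x. s x \<le> 3 / 2"
    "\<And>\<epsilon>. \<epsilon> > 0 \<Longrightarrow> \<exists>\<delta>>0. \<forall>x\<in>S. \<forall>y\<in>S. \<bar>s x - s y\<bar> < \<delta> \<longrightarrow> d x y < \<epsilon>"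
proof -
  define I where "I = (SIGMA m:UNIV. net m)"
  have I1: "countable I" unfolding I_def by (rule countable_SIGMA[OF countableI_type countable_finite]) (simp add: net(1))
  have I2: "I \<noteq> {}"
  proof -
    obtain x where "x \<in> S" using nonempty by blast
    from net(3)[OF this, of 0] show ?thesis unfolding I_def by blast
  qed
  note I = I1 I2
  define U where "U k = (case from_nat_into I k of (m, t) \<Rightarrow> mball t (1 / (real m + 1)))" for k
  have Uopen: "openin mtopology (U k)" for k unfolding U_def by (auto split: prod.splits)
  define b where "b k x = (indicator (U k) x :: real)" for k x
  have b01: "0 \<le> b k x" "b k x \<le> 1" for k x unfolding b_def by (auto simp: indicator_def)
  define s where "s x = (\<Sum>k. b k x * (1 / 3) ^ k)" for x
  have geo: "summable (\<lambda>k. (1 / 3 :: real) ^ k)" by (rule summable_geometric) auto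
  have sm: "summable (\<lambda>k. b k x * (1 / 3) ^ k)" for x
    using b01 by (intro summable_comparison_test'[OF geo, of 0]) (auto simp: mult_le_one abs_mult intro!: mult_left_le_one_le)
  \<comment> \<open>Digits 0 and 1 in base 3 leave gaps: the first differing digit contributes
    \<open>(1 / 3) ^ K\<close> and the whole tail at most half of that. In base 2 the tail could
    cancel the difference.\<close>
  have gap: "\<bar>s x - s y\<bar> \<ge> (1 / 3) ^ K / 2" if "b K x \<noteq> b K y" "\<And>k. k < K \<Longrightarrow> b k x = b k y" for x y K
  proof -
    define a where "a k = (b k x - b k y) * (1 / 3) ^ k" for k
    have sa: "summable a" unfolding a_def using summable_diff[OF sm[of x] sm[of y]] by (simp add: algebra_simps)
    have sxy: "s x - s y = suminf a" unfolding s_def a_def using suminf_diff[OF sm[of x] sm[of y]] by (simp add: algebra_simps)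
    have "suminf a = (\<Sum>n. a (n + Suc K)) + (\<Sum>i<Suc K. a i)" by (rule suminf_split_initial_segment[OF sa])
    also have "(\<Sum>i<Suc K. a i) = a K" using that(2) by (simp add: a_def)
    finally have 1: "s x - s y = (\<Sum>n. a (n + Suc K)) + a K" using sxy by simp
    have aK: "\<bar>a K\<bar> = (1 / 3) ^ K"
    proof -
      have "\<bar>b K x - b K y\<bar> = 1" using that(1) unfolding b_def by (auto simp: indicator_def split: if_splits)
      thus ?thesis unfolding a_def by (simp add: abs_mult)
    qed
    have "norm (\<Sum>n. a (n + Suc K)) \<le> (\<Sum>n. (1 / 3) ^ Suc K * (1 / 3) ^ n)"
    proof (rule norm_suminf_le)
      show "summable (\<lambda>n. (1 / 3 :: real) ^ Suc K * (1 / 3) ^ n)" using geo by (rule summable_mult)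
      show "norm (a (n + Suc K)) \<le> (1 / 3) ^ Suc K * (1 / 3) ^ n" for n
      proof -
        have "\<bar>b (n + Suc K) x - b (n + Suc K) y\<bar> \<le> 1" using b01[of "n + Suc K" x] b01[of "n + Suc K" y] by linarith
        hence "\<bar>b (n + Suc K) x - b (n + Suc K) y\<bar> * (1 / 3) ^ (n + Suc K) \<le> 1 * (1 / 3) ^ (n + Suc K)" by (intro mult_right_mono) auto
        thus ?thesis unfolding a_def by (simp add: abs_mult power_add mult_ac)
      qed
    qed
    also have "\<dots> = (1 / 3) ^ Suc K * (3 / 2)" by (simp only: suminf_mult[OF geo]) (simp add: suminf_geometric)
    also have "\<dots> = (1 / 3) ^ K / 2" by simp
    finally have "\<bar>\<Sum>n. a (n + Suc K)\<bar> \<le> (1 / 3) ^ K / 2" by simp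
    thus ?thesis using 1 aK by linarith
  qed
  have agree: "b k x = b k y" if "\<bar>s x - s y\<bar> < (1 / 3) ^ K / 2" "k \<le> K" for x y k K
  proof (rule ccontr)
    assume "b k x \<noteq> b k y"
    define k0 where "k0 = (LEAST k. b k x \<noteq> b k y)"
    have k0: "b k0 x \<noteq> b k0 y" unfolding k0_def by (rule LeastI[of _ k]) fact
    have "k0 \<le> k" unfolding k0_def by (rule Least_le) fact
    hence "(1 / 3 :: real) ^ K \<le> (1 / 3) ^ k0" using that(2) by (intro power_decreasing) auto
    moreover have "(1 / 3) ^ k0 / 2 \<le> \<bar>s x - s y\<bar>"
    proof (rule gap[OF k0])
      show "b j x = b j y" if "j < k0" for j using not_less_Least[of j "\<lambda>k. b k x \<noteq> b k y"] that unfolding k0_def by blast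
    qed
    ultimately show False using that(1) by linarith
  qed
  show ?thesis
  proof (rule that[of s])
    have "U k \<in> sets (borel_of mtopology)" for k unfolding sets_borel using Uopen by (intro sigma_sets.Basic) simp
    thus "s \<in> borel_measurable (borel_of mtopology)" unfolding s_def[abs_def] b_def by measurable
    show "0 \<le> s x" for x unfolding s_def using b01 by (intro suminf_nonneg sm) auto
    show "s x \<le> 3 / 2" for x
    proof -
      have "s x \<le> (\<Sum>k. (1 / 3) ^ k)" unfolding s_def
        using b01 by (intro suminf_le sm geo) (auto intro!: mult_left_le_one_le)
      thus ?thesis by (simp add: suminf_geometric)
    qed
    fix \<epsilon> :: real assume \<epsilon>: "\<epsilon> > 0"
    have "\<forall>\<^sub>F m in sequentially. 2 / (real m + 1) < \<epsilon>" using \<epsilon> by real_asymp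
    then obtain m where m: "2 / (real m + 1) < \<epsilon>" unfolding eventually_sequentially by blast
    have "\<exists>k. from_nat_into I k = (m, t)" if "t \<in> net m" for t
      using that from_nat_into_surj[OF I(1), of "(m,t)"] unfolding I_def by auto
    then obtain code where code: "\<And>t. t \<in> net m \<Longrightarrow> from_nat_into I (code t) = (m, t)" by metis
    \<comment> \<open>A common bound for the codes of the finitely many balls of mesh
      \<open>m\<close>; the sum is a convenient one.\<close>
    define K where "K = (\<Sum>t\<in>net m. code t)"
    have codeK: "code t \<le> K" if "t \<in> net m" for t unfolding K_def using net(1) that by (intro member_le_sum) auto
    show "\<exists>\<delta>>0. \<forall>x\<in>S. \<forall>y\<in>S. \<bar>s x - s y\<bar> < \<delta> \<longrightarrow> d x y < \<epsilon>"
    proof (intro exI[of _ "(1 / 3) ^ K / 2"] conjI ballI impI)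
      fix x y assume xy: "x \<in> S" "y \<in> S" "\<bar>s x - s y\<bar> < (1 / 3) ^ K / 2"
      obtain t where t: "t \<in> net m" "d t x < 1 / (real m + 1)" using net(3)[OF xy(1)] by blast
      have tS: "t \<in> S" using t net(2) by blast
      have Ut: "U (code t) = mball t (1 / (real m + 1))" unfolding U_def code[OF t(1)] by simp
      have "b (code t) x = 1" unfolding b_def Ut using t tS xy by (simp add: in_mball)
      hence "b (code t) y = 1" using agree[OF xy(3) codeK[OF t(1)]] by simp
      hence "y \<in> mball t (1 / (real m + 1))" unfolding b_def Ut by (simp add: indicator_def split: if_splits)
      hence "d t y < 1 / (real m + 1)" by (simp add: in_mball)
      hence "d x y < 1 / (real m + 1) + 1 / (real m + 1)" using triangle[of x t y] t xy tS by (simp add: commute)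
      thus "d x y < \<epsilon>" using m by simp
    qed simp
  qed
qed

text \<open>The images under \<open>s\<close> live in (-1, 2], hence are tight and have a weak limit
  \<open>P\<close> on the line. \<open>P\<close> is carried by the closure \<open>C\<close> of the
  codes, because the capped distance to \<open>C\<close> integrates to 0. The map \<pi> extends the
  inverse of \<open>s\<close> to \<open>C\<close> and carries \<open>P\<close> back to the space;
  continuous functions are tested through a Tietze extension of their composition with
  \<pi>.\<close>

theorem prob_measures_seq_compact:
  fixes \<mu> :: "nat \<Rightarrow> 'a measure"
  assumes \<mu>: "\<And>n. prob_space (\<mu> n)" "\<And>n. sets (\<mu> n) = sets (borel_of mtopology)"
  obtains r M where "strict_mono (r :: nat \<Rightarrow> nat)" "prob_space M" "sets M = sets (borel_of mtopology)"
    "\<And>f. continuous_map mtopology euclideanreal f \<Longrightarrow> (\<lambda>n. \<integral>x. f x \<partial>\<mu> (r n)) \<longlonglongrightarrow> (\<integral>x. f x \<partial>M)"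
proof -
  obtain s :: "'a \<Rightarrow> real" where s: "s \<in> borel_measurable (borel_of mtopology)" "\<And>x. 0 \<le> s x" "\<And>x. s x \<le> 3 / 2"
    "\<And>\<epsilon>. \<epsilon> > 0 \<Longrightarrow> \<exists>\<delta>>0. \<forall>x\<in>S. \<forall>y\<in>S. \<bar>s x - s y\<bar> < \<delta> \<longrightarrow> d x y < \<epsilon>" using ternary_code by blast
  have sp: "space (\<mu> n) = S" for n using sets_eq_imp_space_eq[OF \<mu>(2)] space_borel by simp
  have sm: "s \<in> borel_measurable (\<mu> n)" for n using s(1) measurable_cong_sets[OF \<mu>(2) refl] by blast
  define \<nu> where "\<nu> n = distr (\<mu> n) borel s" for n
  have \<nu>: "real_distribution (\<nu> n)" for n unfolding \<nu>_def real_distribution_def real_distribution_axioms_def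
    using prob_space.prob_space_distr[OF \<mu>(1) sm] by simp
  have "tight \<nu>" unfolding tight_def
  proof (intro conjI allI impI)
    fix \<epsilon> :: real assume \<epsilon>: "\<epsilon> > 0"
    have "measure (\<nu> n) {-1<..2} > 1 - \<epsilon>" for n
    proof -
      have "s x \<in> {-1<..2}" for x using s(2,3)[of x] by auto
      hence "s -` {-1<..2} \<inter> space (\<mu> n) = space (\<mu> n)" by auto
      hence "measure (\<nu> n) {-1<..2} = 1" unfolding \<nu>_def using sm prob_space.prob_space[OF \<mu>(1)] by (subst measure_distr) auto
      thus ?thesis using \<epsilon> by simp
    qed
    thus "\<exists>a b. a < b \<and> (\<forall>n. 1 - \<epsilon> < measure (\<nu> n) {a<..b})" by (intro exI[of _ "-1"] exI[of _ 2]) auto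
  qed (use \<nu> in auto)
  from tight_imp_convergent_subsubsequence[OF this strict_mono_id]
  obtain r P where r: "strict_mono r" and P: "real_distribution P" and conv: "weak_conv_m (\<lambda>n. \<nu> (r n)) P"
    by (auto simp: o_def)
  interpret P: real_distribution P by fact
  have conv_int: "(\<lambda>n. \<integral>t. F t \<partial>\<nu> (r n)) \<longlonglongrightarrow> (\<integral>t. F t \<partial>P)"
    if "\<And>t. isCont F t" "\<And>t. norm (F t) \<le> B" for F :: "real \<Rightarrow> real" and B
    using weak_conv_imp_integral_bdd_continuous_conv[OF _ P conv that] \<nu> by blast
  have int_\<nu>: "(\<integral>t. F t \<partial>\<nu> n) = (\<integral>x. F (s x) \<partial>\<mu> n)" if "F \<in> borel_measurable borel" for F :: "real \<Rightarrow> real" and n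
    unfolding \<nu>_def by (rule integral_distr[OF sm that])
  define C where "C = closure (s ` S)"
  have sC: "s x \<in> C" if "x \<in> S" for x
    unfolding C_def by (rule subsetD[OF closure_subset]) (use that in blast)
  have Cne: "C \<noteq> {}" unfolding C_def using nonempty by auto
  have AEC: "AE t in P. t \<in> C"
  proof -
    define h where "h t = min 1 (infdist t C)" for t :: real
    have hc: "continuous_on UNIV h" unfolding h_def by (intro continuous_intros)
    have hm: "h \<in> borel_measurable borel" using hc by (rule borel_measurable_continuous_onI)
    have hb: "norm (h t) \<le> 1" "h t \<ge> 0" for t unfolding h_def using infdist_nonneg[of t C] by auto
    have "(\<integral>t. h t \<partial>\<nu> (r n)) = 0" for n
    proof -
      have "(\<integral>x. h (s x) \<partial>\<mu> (r n)) = (\<integral>x. 0 \<partial>\<mu> (r n))"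
      proof (rule Bochner_Integration.integral_cong[OF refl])
        fix x assume "x \<in> space (\<mu> (r n))"
        hence "s x \<in> C" unfolding sp by (rule sC)
        thus "h (s x) = 0" unfolding h_def by simp
      qed
      thus ?thesis by (simp add: int_\<nu>[OF hm])
    qed
    moreover have "(\<lambda>n. \<integral>t. h t \<partial>\<nu> (r n)) \<longlonglongrightarrow> (\<integral>t. h t \<partial>P)"
      using hc hb by (intro conv_int[of _ 1]) (auto simp: continuous_on_eq_continuous_at)
    ultimately have "(\<integral>t. h t \<partial>P) = 0" by (simp add: LIMSEQ_const_iff)
    moreover have "integrable P h" using hb hm by (intro P.integrable_const_bound[of _ 1]) auto
    ultimately have "AE t in P. h t = 0" using integral_nonneg_eq_0_iff_AE[of P h] hb by auto
    thus ?thesis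
    proof eventually_elim
      case (elim t)
      hence "infdist t C = 0" unfolding h_def by (simp add: min_def split: if_splits)
      thus "t \<in> C" using Cne in_closed_iff_infdist_zero[of C t] unfolding C_def by auto
    qed
  qed
  \<comment> \<open>\<open>p\<close> is the point approached whenever codes approach
    \<open>t\<close>. Compactness provides it, and the uniform continuity of the inverse of
    \<open>s\<close> makes it independent of the approximating sequence.\<close>
  define Q where "Q t p \<longleftrightarrow> p \<in> S \<and> (\<forall>\<epsilon>>0. \<exists>\<delta>>0. \<forall>x\<in>S. \<bar>s x - t\<bar> < \<delta> \<longrightarrow> d x p < \<epsilon>)" for t p
  have Q_ex: "\<exists>p. Q t p" if t: "t \<in> C" for t
  proof -
    obtain y where y: "\<And>n. y n \<in> s ` S" "y \<longlonglongrightarrow> t" using t unfolding C_def closure_sequential by blast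
    have "\<forall>n. \<exists>x. x \<in> S \<and> y n = s x" using y(1) by auto
    from choice[OF this] obtain x where x0: "\<forall>n. x n \<in> S \<and> y n = s (x n)" by (elim exE) (rule that)
    hence x: "x n \<in> S" "y n = s (x n)" for n by auto
    have xS: "range x \<subseteq> S" using x(1) by auto
    from compact[unfolded compact_space_sequentially, rule_format, OF xS]
    obtain p q where p: "p \<in> S" "strict_mono q" "limitin mtopology (x \<circ> q) p sequentially"
      by (elim exE conjE) (rule that)
    have sq: "(\<lambda>n. s (x (q n))) \<longlonglongrightarrow> t" using LIMSEQ_subseq_LIMSEQ[OF y(2) p(2)] x(2) by (simp add: o_def)
    have "Q t p" unfolding Q_def
    proof (intro conjI allI impI)
      fix \<epsilon> :: real assume \<epsilon>: "\<epsilon> > 0"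
      obtain \<delta> where \<delta>: "\<delta> > 0" "\<forall>x\<in>S. \<forall>y\<in>S. \<bar>s x - s y\<bar> < \<delta> \<longrightarrow> d x y < \<epsilon> / 2" using s(4)[of "\<epsilon> / 2"] \<epsilon> by auto
      have "\<forall>\<^sub>F n in sequentially. dist (s (x (q n))) t < \<delta> / 2" using sq \<delta> by (intro tendstoD) auto
      moreover have "\<forall>\<^sub>F n in sequentially. d (x (q n)) p < \<epsilon> / 2"
        using p(3) \<epsilon> unfolding limitin_metric by (auto elim!: allE[of _ "\<epsilon> / 2"] eventually_mono)
      ultimately have "\<forall>\<^sub>F n in sequentially. dist (s (x (q n))) t < \<delta> / 2 \<and> d (x (q n)) p < \<epsilon> / 2" by (rule eventually_conj)
      then obtain n where n: "\<bar>s (x (q n)) - t\<bar> < \<delta> / 2" "d (x (q n)) p < \<epsilon> / 2"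
        unfolding eventually_sequentially dist_real_def by blast
      show "\<exists>\<delta>>0. \<forall>x\<in>S. \<bar>s x - t\<bar> < \<delta> \<longrightarrow> d x p < \<epsilon>"
      proof (intro exI[of _ "\<delta> / 2"] conjI ballI impI)
        fix z assume z: "z \<in> S" "\<bar>s z - t\<bar> < \<delta> / 2"
        hence "\<bar>s z - s (x (q n))\<bar> < \<delta>" using n(1) by linarith
        hence "d z (x (q n)) < \<epsilon> / 2" using \<delta>(2) z x(1) by blast
        thus "d z p < \<epsilon>" using n(2) triangle[of z "x (q n)" p] z x(1) p(1) by fastforce
      qed (use \<delta> in simp)
    qed (use p in simp)
    thus ?thesis by blast
  qed
  obtain p0 where p0: "p0 \<in> S" using nonempty by blast
  \<comment> \<open>Constant off the closed set \<open>C\<close>, which keeps \<pi> Borel on the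
    whole line; \<open>P\<close> gives no mass to the complement of \<open>C\<close>.\<close>
  define \<pi> where "\<pi> t = (if t \<in> C then SOME p. Q t p else p0)" for t
  have Q\<pi>: "Q t (\<pi> t)" if "t \<in> C" for t unfolding \<pi>_def using someI_ex[OF Q_ex[OF that]] that by simp
  have \<pi>S: "\<pi> t \<in> S" for t using Q\<pi>[of t] p0 unfolding Q_def \<pi>_def by (cases "t \<in> C") auto
  have \<pi>s: "\<pi> (s x) = x" if x: "x \<in> S" for x
  proof -
    have "s x \<in> C" by (rule sC[OF x])
    hence Qx: "Q (s x) (\<pi> (s x))" by (rule Q\<pi>)
    have "d x (\<pi> (s x)) < \<epsilon>" if "\<epsilon> > 0" for \<epsilon>
    proof -
      obtain \<delta> where "\<delta> > 0" "\<forall>z\<in>S. \<bar>s z - s x\<bar> < \<delta> \<longrightarrow> d z (\<pi> (s x)) < \<epsilon>" using Qx \<open>\<epsilon> > 0\<close> unfolding Q_def by blast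
      thus ?thesis using x by simp
    qed
    hence "\<not> 0 < d x (\<pi> (s x))" using less_irrefl by blast
    thus ?thesis using x \<pi>S by simp
  qed
  have \<pi>_cont: "\<exists>\<delta>>0. \<forall>t'\<in>C. dist t' t < \<delta> \<longrightarrow> d (\<pi> t) (\<pi> t') < \<epsilon>" if t: "t \<in> C" and \<epsilon>: "\<epsilon> > 0" for t \<epsilon>
  proof -
    obtain \<delta> where \<delta>: "\<delta> > 0" "\<forall>x\<in>S. \<bar>s x - t\<bar> < \<delta> \<longrightarrow> d x (\<pi> t) < \<epsilon> / 2" using Q\<pi>[OF t] \<epsilon> unfolding Q_def by (meson half_gt_zero)
    show ?thesis
    proof (intro exI[of _ "\<delta> / 2"] conjI ballI impI)
      fix t' assume t': "t' \<in> C" "dist t' t < \<delta> / 2"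
      obtain \<delta>' where \<delta>': "\<delta>' > 0" "\<forall>x\<in>S. \<bar>s x - t'\<bar> < \<delta>' \<longrightarrow> d x (\<pi> t') < \<epsilon> / 2" using Q\<pi>[OF t'(1)] \<epsilon> unfolding Q_def by (meson half_gt_zero)
      have "min \<delta>' (\<delta> / 2) > 0" using \<delta> \<delta>' by simp
      then obtain u where u: "u \<in> s ` S" "dist u t' < min \<delta>' (\<delta> / 2)" using t'(1) unfolding C_def closure_approachable by blast
      then obtain x where x: "x \<in> S" "u = s x" by blast
      have "\<bar>s x - t'\<bar> < \<delta>'" "\<bar>s x - t'\<bar> < \<delta> / 2" using u(2) x(2) unfolding dist_real_def by auto
      moreover have "\<bar>t' - t\<bar> < \<delta> / 2" using t'(2) unfolding dist_real_def .
      ultimately have "\<bar>s x - t\<bar> < \<delta>" "\<bar>s x - t'\<bar> < \<delta>'" by linarith+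
      hence "d x (\<pi> t) < \<epsilon> / 2" "d x (\<pi> t') < \<epsilon> / 2" using \<delta> \<delta>' x by auto
      thus "d (\<pi> t) (\<pi> t') < \<epsilon>" using triangle[of "\<pi> t" x "\<pi> t'"] \<pi>S x by (simp add: commute)
    qed (use \<delta> in simp)
  qed
  have \<pi>_meas: "\<pi> \<in> measurable borel (borel_of mtopology)"
    unfolding borel_of_def
  proof (rule measurable_measure_of)
    show "{U. openin mtopology U} \<subseteq> Pow (topspace mtopology)" using openin_subset by fastforce
    show "\<pi> \<in> space borel \<rightarrow> topspace mtopology" using \<pi>S by auto
    fix U assume "U \<in> {U. openin mtopology U}"
    hence U: "openin mtopology U" by simp
    have "openin (top_of_set C) {t \<in> C. \<pi> t \<in> U}"
      unfolding openin_euclidean_subtopology_iff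
    proof (intro conjI ballI)
      fix t assume t: "t \<in> {t \<in> C. \<pi> t \<in> U}"
      then obtain \<epsilon> where \<epsilon>: "\<epsilon> > 0" "mball (\<pi> t) \<epsilon> \<subseteq> U" using U unfolding openin_mtopology by blast
      obtain \<delta> where \<delta>: "\<delta> > 0" "\<forall>t'\<in>C. dist t' t < \<delta> \<longrightarrow> d (\<pi> t) (\<pi> t') < \<epsilon>" using \<pi>_cont[of t \<epsilon>] t \<epsilon> by blast
      hence "\<forall>t'\<in>C. dist t' t < \<delta> \<longrightarrow> t' \<in> {t \<in> C. \<pi> t \<in> U}" using \<epsilon>(2) \<pi>S by (auto simp: in_mball subset_iff)
      thus "\<exists>e>0. \<forall>x'\<in>C. dist x' t < e \<longrightarrow> x' \<in> {t \<in> C. \<pi> t \<in> U}" using \<delta> by blast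
    qed auto
    then obtain W where W: "open W" "{t \<in> C. \<pi> t \<in> U} = C \<inter> W" unfolding openin_open by blast
    have "\<pi> -` U \<inter> space borel = C \<inter> W \<union> (if p0 \<in> U then - C else {})"
      unfolding W(2)[symmetric] by (auto simp: \<pi>_def split: if_splits)
    moreover have "closed C" unfolding C_def by simp
    ultimately show "\<pi> -` U \<inter> space borel \<in> sets borel" using W(1) by auto
  qed
  have \<pi>_measP: "\<pi> \<in> measurable P (borel_of mtopology)" using \<pi>_meas measurable_cong_sets[OF P.events_eq_borel refl] by blast
  define M where "M = distr P (borel_of mtopology) \<pi>"
  show ?thesis
  proof (rule that[of r M])
    show "prob_space M" unfolding M_def by (rule P.prob_space_distr[OF \<pi>_measP])
    show "sets M = sets (borel_of mtopology)" unfolding M_def by simp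
    fix f assume f: "continuous_map mtopology euclideanreal f"
    obtain B where B: "B > 0" "\<And>x. x \<in> S \<Longrightarrow> norm (f x) \<le> B" using continuous_bounded[OF f] by metis
    have "continuous_on C (\<lambda>t. f (\<pi> t))"
      unfolding continuous_on_iff
    proof (intro ballI allI impI)
      fix t \<epsilon> assume t: "t \<in> C" and \<epsilon>: "(\<epsilon>::real) > 0"
      obtain \<eta> where \<eta>: "\<eta> > 0" "\<forall>y\<in>S. d (\<pi> t) y < \<eta> \<longrightarrow> dist (f (\<pi> t)) (f y) < \<epsilon>" using f \<epsilon> \<pi>S unfolding continuous_map_metric_iff by blast
      obtain \<delta> where \<delta>: "\<delta> > 0" "\<forall>t'\<in>C. dist t' t < \<delta> \<longrightarrow> d (\<pi> t) (\<pi> t') < \<eta>" using \<pi>_cont[OF t \<eta>(1)] by blast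
      show "\<exists>\<delta>>0. \<forall>t'\<in>C. dist t' t < \<delta> \<longrightarrow> dist (f (\<pi> t')) (f (\<pi> t)) < \<epsilon>"
        using \<delta> \<eta>(2) \<pi>S by (intro exI[of _ \<delta>]) (auto simp: dist_commute)
    qed
    moreover have "closedin (top_of_set UNIV) C" unfolding C_def by simp
    ultimately obtain F where F: "continuous_on UNIV F" "\<And>t. t \<in> C \<Longrightarrow> F t = f (\<pi> t)" "\<And>t. norm (F t) \<le> B"
      using Tietze[of C "\<lambda>t. f (\<pi> t)" UNIV B] B \<pi>S by (metis UNIV_I less_imp_le)
    have Fm: "F \<in> borel_measurable borel" using F(1) by (rule borel_measurable_continuous_onI)
    have fm: "f \<in> borel_measurable (borel_of mtopology)" by (rule continuous_map_measurable[OF refl f])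
    have 1: "(\<integral>t. F t \<partial>\<nu> (r n)) = (\<integral>x. f x \<partial>\<mu> (r n))" for n
      unfolding int_\<nu>[OF Fm]
    proof (rule Bochner_Integration.integral_cong[OF refl])
      fix x assume "x \<in> space (\<mu> (r n))"
      hence x: "x \<in> S" using sp by simp
      hence "s x \<in> C" by (rule sC)
      thus "F (s x) = f x" using F(2) \<pi>s[OF x] by simp
    qed
    have 2: "(\<integral>t. F t \<partial>P) = (\<integral>x. f x \<partial>M)"
    proof -
      have "(\<integral>x. f x \<partial>M) = (\<integral>t. f (\<pi> t) \<partial>P)" unfolding M_def by (rule integral_distr[OF \<pi>_measP fm])
      also have "\<dots> = (\<integral>t. F t \<partial>P)"
      proof (rule integral_cong_AE)
        show "(\<lambda>t. f (\<pi> t)) \<in> borel_measurable P" using measurable_compose[OF \<pi>_measP fm] .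
        show "F \<in> borel_measurable P" using Fm by simp
        show "AE t in P. f (\<pi> t) = F t" using AEC by eventually_elim (simp add: F(2))
      qed
      finally show ?thesis by simp
    qed
    have "(\<lambda>n. \<integral>t. F t \<partial>\<nu> (r n)) \<longlonglongrightarrow> (\<integral>t. F t \<partial>P)"
      using F by (intro conv_int[of _ B]) (auto simp: continuous_on_eq_continuous_at)
    thus "(\<lambda>n. \<integral>x. f x \<partial>\<mu> (r n)) \<longlonglongrightarrow> (\<integral>x. f x \<partial>M)" by (simp add: 1 2)
  qed (rule r)
qed

end

context compact_metric begin

lemma continuous_map_max:
  fixes f g :: "'a \<Rightarrow> real"
  assumes "continuous_map mtopology euclideanreal f" "continuous_map mtopology euclideanreal g"
  shows "continuous_map mtopology euclideanreal (\<lambda>x. max (f x) (g x))"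
proof -
  have "(\<lambda>x. max (f x) (g x)) = (\<lambda>x. (f x + g x + \<bar>f x - g x\<bar>) / 2)" by (auto simp: max_def)
  thus ?thesis using assms by (auto intro!: continuous_intros)
qed

lemma prob_integrable:
  assumes M: "prob_space M" "sets M = sets (borel_of mtopology)" and f: "continuous_map mtopology euclideanreal f"
  shows "integrable M f"
proof -
  interpret prob_space M by fact
  obtain B where "B > 0" "\<And>x. x \<in> S \<Longrightarrow> norm (f x) \<le> B" using continuous_bounded[OF f] by metis
  thus ?thesis using continuous_map_measurable[OF M(2) f] sets_eq_imp_space_eq[OF M(2)] space_borel
    by (intro integrable_const_bound[of _ B] AE_I2) auto
qed

end

section \<open>Invariance of Borel measures tested on continuous functions\<close>

context expanding_system begin

lemma \<phi>_borel:
  assumes "sets M = sets (borel_of mtopology)" shows "\<phi> \<in> measurable M (borel_of mtopology)"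
proof -
  have sp: "space M = S" using sets_eq_imp_space_eq[OF assms] space_borel by simp
  show ?thesis
    unfolding borel_of_def
  proof (rule measurable_measure_of)
    show "{U. openin mtopology U} \<subseteq> Pow (topspace mtopology)" using openin_subset by fastforce
    show "\<phi> \<in> space M \<rightarrow> topspace mtopology" using \<phi>_S sp by auto
    fix U assume "U \<in> {U. openin mtopology U}"
    hence "openin mtopology {x \<in> topspace mtopology. \<phi> x \<in> U}" using cont by (intro openin_continuous_map_preimage[of _ mtopology]) auto
    moreover have "{x \<in> topspace mtopology. \<phi> x \<in> U} = \<phi> -` U \<inter> space M" using sp by auto
    ultimately show "\<phi> -` U \<inter> space M \<in> sets M" unfolding assms sets_borel by auto
  qed
qed

lemma measurable_system_borel:
  assumes "prob_space M" "sets M = sets (borel_of mtopology)" shows "measurable_system M \<phi>"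
proof -
  have "\<phi> \<in> measurable M M" using \<phi>_borel[OF assms(2)] measurable_cong_sets[OF refl assms(2)] by blast
  thus ?thesis using assms by (intro measurable_system.intro measurable_system_axioms.intro)
qed

lemma invariant_system_iff: "M \<in> invariant_measures mtopology \<phi> \<longleftrightarrow> invariant_system S d \<phi> e \<theta> M"
proof
  assume M: "M \<in> invariant_measures mtopology \<phi>"
  have "measurable_system M \<phi>" using M unfolding invariant_measures_def by (intro measurable_system_borel) auto
  thus "invariant_system S d \<phi> e \<theta> M" using M expanding_system_axioms unfolding invariant_measures_def
    by (intro invariant_system.intro pmp_system.intro pmp_system_axioms.intro invariant_system_axioms.intro) auto
next
  assume "invariant_system S d \<phi> e \<theta> M"
  then interpret invariant_system S d \<phi> e \<theta> M .
  show "M \<in> invariant_measures mtopology \<phi>"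
    unfolding invariant_measures_def using prob_space_axioms M_borel meas inv by auto
qed

text \<open>Integrals of continuous functions are what a weak limit preserves. They determine a
  Borel measure through the bumps, so \<open>M\<close> coincides with its image under the
  map.\<close>

lemma invariant_of_integrals:
  assumes M: "prob_space M" "sets M = sets (borel_of mtopology)"
    and eq: "\<And>f. continuous_map mtopology euclideanreal f \<Longrightarrow> (\<integral>x. f (\<phi> x) \<partial>M) = (\<integral>x. f x \<partial>M)"
  shows "invariant_system S d \<phi> e \<theta> M"
proof -
  interpret measurable_system M \<phi> by (rule measurable_system_borel[OF M])
  define N where "N = distr M (borel_of mtopology) \<phi>"
  note \<phi>m = \<phi>_borel[OF M(2)]
  have "M = N"
  proof (rule measure_eq_of_bumps[OF M])
    show "prob_space N" unfolding N_def by (rule prob_space_distr[OF \<phi>m])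
    show "sets N = sets (borel_of mtopology)" unfolding N_def by simp
    fix m T assume T: "T \<subseteq> net m"
    have "finite T" "T \<subseteq> S" using T net(1)[of m] net(2)[of m] finite_subset by auto
    hence b: "continuous_map mtopology euclideanreal (bump m T)" by (rule bump_continuous)
    have "(\<integral>x. bump m T x \<partial>N) = (\<integral>x. bump m T (\<phi> x) \<partial>M)"
      unfolding N_def by (rule integral_distr[OF \<phi>m continuous_map_measurable[OF refl b]])
    thus "(\<integral>x. bump m T x \<partial>M) = (\<integral>x. bump m T x \<partial>N)" using eq[OF b] by simp
  qed
  hence "emeasure M (\<phi> -` A \<inter> space M) = emeasure M A" if "A \<in> sets M" for A
    using emeasure_distr[OF \<phi>m, of A] that M(2) unfolding N_def by simp
  thus ?thesis using M expanding_system_axioms measurable_system_axioms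
    by (intro invariant_system.intro pmp_system.intro pmp_system_axioms.intro invariant_system_axioms.intro) auto
qed

end

subsection \<open>Partitions with null boundaries\<close>

definition (in compact_metric) weakly_converges :: "(nat \<Rightarrow> 'a measure) \<Rightarrow> 'a measure \<Rightarrow> bool" where
  "weakly_converges \<mu> M \<longleftrightarrow> (\<forall>f. continuous_map mtopology euclideanreal f \<longrightarrow> (\<lambda>n. \<integral>x. f x \<partial>\<mu> n) \<longlonglongrightarrow> (\<integral>x. f x \<partial>M))"

context invariant_system begin

text \<open>Sets whose indicator is squeezed between continuous functions with close integrals, i.e. sets
  with null boundary. They form an algebra stable under preimages by the map.\<close>
definition jordan :: "'a set \<Rightarrow> bool" where
  "jordan A \<longleftrightarrow> A \<in> events \<and> (\<forall>\<epsilon>>0. \<exists>f g. continuous_map mtopology euclideanreal f \<and> continuous_map mtopology euclideanreal g \<and>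
     (\<forall>x\<in>S. f x \<le> indicator A x \<and> indicator A x \<le> g x) \<and> (\<integral>x. g x \<partial>M) - (\<integral>x. f x \<partial>M) < \<epsilon>)"

lemma jordan_events: "jordan A \<Longrightarrow> A \<in> events"
  unfolding jordan_def by (rule conjunct1)

lemma jordan_approx:
  assumes "jordan A" "\<epsilon> > 0"
  obtains f g where "continuous_map mtopology euclideanreal f" "continuous_map mtopology euclideanreal g"
     "\<forall>x\<in>S. f x \<le> indicator A x \<and> indicator A x \<le> g x" "(\<integral>x. g x \<partial>M) - (\<integral>x. f x \<partial>M) < \<epsilon>"
  using assms unfolding jordan_def by meson

lemma events_subset: "A \<in> events \<Longrightarrow> A \<subseteq> S"
  using sets.sets_into_space space_M by metis

lemma jordan_compl: assumes "jordan A" shows "jordan (S - A)"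
  unfolding jordan_def
proof (intro conjI allI impI)
  show "S - A \<in> events" using jordan_events[OF assms] sets.compl_sets[of A M] by (simp add: space_M)
  fix \<epsilon> :: real assume \<epsilon>: "\<epsilon> > 0"
  obtain f g where fg: "continuous_map mtopology euclideanreal f" "continuous_map mtopology euclideanreal g"
     "\<forall>x\<in>S. f x \<le> indicator A x \<and> indicator A x \<le> g x" "(\<integral>x. g x \<partial>M) - (\<integral>x. f x \<partial>M) < \<epsilon>"
    by (rule jordan_approx[OF assms \<epsilon>])
  have "(\<integral>x. 1 - f x \<partial>M) - (\<integral>x. 1 - g x \<partial>M) < \<epsilon>"
    using fg continuous_integrable by (simp add: prob_space)
  moreover have "\<forall>x\<in>S. 1 - g x \<le> indicator (S - A) x \<and> indicator (S - A) x \<le> 1 - f x"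
    using fg(3) by (auto simp: indicator_def split: if_splits)
  moreover have "continuous_map mtopology euclideanreal (\<lambda>x. 1 - g x)" "continuous_map mtopology euclideanreal (\<lambda>x. 1 - f x)"
    using fg by (auto intro!: continuous_intros)
  ultimately show "\<exists>f g. continuous_map mtopology euclideanreal f \<and> continuous_map mtopology euclideanreal g \<and>
     (\<forall>x\<in>S. f x \<le> indicator (S - A) x \<and> indicator (S - A) x \<le> g x) \<and> (\<integral>x. g x \<partial>M) - (\<integral>x. f x \<partial>M) < \<epsilon>" by blast
qed

lemma jordan_Un: assumes A: "jordan A" and B: "jordan B" shows "jordan (A \<union> B)"
  unfolding jordan_def
proof (intro conjI allI impI)
  show "A \<union> B \<in> events" using assms unfolding jordan_def by auto
  fix \<epsilon> :: real assume "\<epsilon> > 0"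
  hence \<epsilon>2: "\<epsilon> / 2 > 0" by simp
  obtain f g where fg: "continuous_map mtopology euclideanreal f" "continuous_map mtopology euclideanreal g"
     "\<forall>x\<in>S. f x \<le> indicator A x \<and> indicator A x \<le> g x" "(\<integral>x. g x \<partial>M) - (\<integral>x. f x \<partial>M) < \<epsilon> / 2" by (rule jordan_approx[OF A \<epsilon>2])
  obtain f' g' where fg': "continuous_map mtopology euclideanreal f'" "continuous_map mtopology euclideanreal g'"
     "\<forall>x\<in>S. f' x \<le> indicator B x \<and> indicator B x \<le> g' x" "(\<integral>x. g' x \<partial>M) - (\<integral>x. f' x \<partial>M) < \<epsilon> / 2" by (rule jordan_approx[OF B \<epsilon>2])
  let ?F = "\<lambda>x. max (f x) (f' x)" and ?G = "\<lambda>x. max (g x) (g' x)"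
  have c: "continuous_map mtopology euclideanreal ?F" "continuous_map mtopology euclideanreal ?G"
    using fg fg' by (auto intro!: continuous_map_max)
  have s: "\<forall>x\<in>S. ?F x \<le> indicator (A \<union> B) x \<and> indicator (A \<union> B) x \<le> ?G x"
  proof
    fix x assume "x \<in> S"
    hence "f x \<le> indicator A x" "indicator A x \<le> g x" "f' x \<le> indicator B x" "indicator B x \<le> g' x" using fg(3) fg'(3) by auto
    moreover have "indicator (A \<union> B) x = max (indicator A x) (indicator B x :: real)" by (auto simp: indicator_def)
    ultimately show "?F x \<le> indicator (A \<union> B) x \<and> indicator (A \<union> B) x \<le> ?G x" by linarith
  qed
  note i = continuous_integrable
  have "(\<integral>x. ?G x \<partial>M) - (\<integral>x. ?F x \<partial>M) = (\<integral>x. ?G x - ?F x \<partial>M)" using i[OF c(1)] i[OF c(2)] by simp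
  also have "\<dots> \<le> (\<integral>x. (g x - f x) + (g' x - f' x) \<partial>M)"
  proof (rule integral_mono)
    show "integrable M (\<lambda>x. ?G x - ?F x)" using i[OF c(1)] i[OF c(2)] by simp
    show "integrable M (\<lambda>x. (g x - f x) + (g' x - f' x))" using fg fg' i by simp
    fix x assume "x \<in> space M"
    hence "f x \<le> g x" "f' x \<le> g' x" using fg(3) fg'(3) unfolding space_M by force+
    thus "?G x - ?F x \<le> (g x - f x) + (g' x - f' x)" by linarith
  qed
  also have "\<dots> = ((\<integral>x. g x \<partial>M) - (\<integral>x. f x \<partial>M)) + ((\<integral>x. g' x \<partial>M) - (\<integral>x. f' x \<partial>M))"
    using fg fg' i by simp
  also have "\<dots> < \<epsilon>" using fg(4) fg'(4) by linarith
  finally show "\<exists>f g. continuous_map mtopology euclideanreal f \<and> continuous_map mtopology euclideanreal g \<and>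
     (\<forall>x\<in>S. f x \<le> indicator (A \<union> B) x \<and> indicator (A \<union> B) x \<le> g x) \<and> (\<integral>x. g x \<partial>M) - (\<integral>x. f x \<partial>M) < \<epsilon>" using c s by blast
qed

lemma jordan_algebra: "algebra S {A. jordan A}"
  unfolding algebra_iff_Un
proof (intro conjI ballI)
  show "{A. jordan A} \<subseteq> Pow S" using jordan_events events_subset by blast
  have "jordan {}" unfolding jordan_def
  proof (intro conjI allI impI)
    fix \<epsilon> :: real assume "\<epsilon> > 0"
    thus "\<exists>f g. continuous_map mtopology euclideanreal f \<and> continuous_map mtopology euclideanreal g \<and>
     (\<forall>x\<in>S. f x \<le> indicator {} x \<and> indicator {} x \<le> g x) \<and> (\<integral>x. g x \<partial>M) - (\<integral>x. f x \<partial>M) < \<epsilon>"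
      by (intro exI[of _ "\<lambda>_. 0"]) simp
  qed simp
  thus "{} \<in> {A. jordan A}" by simp
qed (auto simp: jordan_compl jordan_Un)

text \<open>Composition with an iterate keeps the squeezing functions continuous, and invariance of
  \<open>M\<close> keeps the gap between their integrals.\<close>

lemma jordan_vimage: assumes A: "jordan A" shows "jordan ((\<phi> ^^ i) -` A \<inter> S)"
  unfolding jordan_def
proof (intro conjI allI impI)
  show "(\<phi> ^^ i) -` A \<inter> S \<in> events" using measurable_sets[OF iter_meas jordan_events[OF A], of i] unfolding space_M .
  fix \<epsilon> :: real assume \<epsilon>: "\<epsilon> > 0"
  obtain f g where fg: "continuous_map mtopology euclideanreal f" "continuous_map mtopology euclideanreal g"
     "\<forall>x\<in>S. f x \<le> indicator A x \<and> indicator A x \<le> g x" "(\<integral>x. g x \<partial>M) - (\<integral>x. f x \<partial>M) < \<epsilon>"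
    by (rule jordan_approx[OF A \<epsilon>])
  have "continuous_map mtopology euclideanreal (\<lambda>x. f ((\<phi> ^^ i) x))" "continuous_map mtopology euclideanreal (\<lambda>x. g ((\<phi> ^^ i) x))"
    using continuous_map_compose[OF cont_iter fg(1)] continuous_map_compose[OF cont_iter fg(2)] by (auto simp: o_def)
  moreover have "\<forall>x\<in>S. f ((\<phi> ^^ i) x) \<le> indicator ((\<phi> ^^ i) -` A \<inter> S) x \<and> indicator ((\<phi> ^^ i) -` A \<inter> S) x \<le> g ((\<phi> ^^ i) x)"
  proof
    fix x assume x: "x \<in> S"
    have "indicator ((\<phi> ^^ i) -` A \<inter> S) x = (indicator A ((\<phi> ^^ i) x) :: real)" using x by (auto simp: indicator_def)
    thus "f ((\<phi> ^^ i) x) \<le> indicator ((\<phi> ^^ i) -` A \<inter> S) x \<and> indicator ((\<phi> ^^ i) -` A \<inter> S) x \<le> g ((\<phi> ^^ i) x)"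
      using fg(3) iter_S[OF x, of i] by simp
  qed
  moreover have "(\<integral>x. g ((\<phi> ^^ i) x) \<partial>M) - (\<integral>x. f ((\<phi> ^^ i) x) \<partial>M) < \<epsilon>"
    using fg(4) integral_iter[OF continuous_measurable[OF fg(1)]] integral_iter[OF continuous_measurable[OF fg(2)]] by simp
  ultimately show "\<exists>f g. continuous_map mtopology euclideanreal f \<and> continuous_map mtopology euclideanreal g \<and>
     (\<forall>x\<in>S. f x \<le> indicator ((\<phi> ^^ i) -` A \<inter> S) x \<and> indicator ((\<phi> ^^ i) -` A \<inter> S) x \<le> g x) \<and> (\<integral>x. g x \<partial>M) - (\<integral>x. f x \<partial>M) < \<epsilon>"
    by (intro exI[of _ "\<lambda>x. f ((\<phi> ^^ i) x)"] exI[of _ "\<lambda>x. g ((\<phi> ^^ i) x)"]) blast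
qed

text \<open>Spheres about \<open>p\<close> are disjoint, so only countably many have positive
  measure and some radius in the interval avoids them. The ramps \<open>?f n\<close> and
  \<open>?g n\<close> of slope \<open>n\<close> squeeze the ball, and their difference tends to the
  indicator of the null sphere.\<close>

lemma ex_jordan_ball:
  assumes p: "p \<in> S" and ab: "a < b"
  obtains t where "a < t" "t < b" "jordan (mball p t)"
proof -
  have dc: "continuous_map mtopology euclideanreal (\<lambda>x. d x p)" by (rule continuous_map_d[OF p])
  have dm[measurable]: "(\<lambda>x. d x p) \<in> borel_measurable M" by (rule continuous_measurable[OF dc])
  let ?D = "distr M borel (\<lambda>x. d x p)"
  interpret D: prob_space ?D by (rule prob_space_distr[OF dm])
  have "countable {t. measure ?D {t} \<noteq> 0}" by (rule D.countable_support)
  moreover have "uncountable {a<..<b}" using ab by (simp add: uncountable_open_interval)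
  ultimately have "\<not> {a<..<b} \<subseteq> {t. measure ?D {t} \<noteq> 0}" using countable_subset by blast
  then obtain t where t: "a < t" "t < b" "measure ?D {t} = 0" by auto
  have sphere: "measure M {x \<in> space M. d x p = t} = 0"
  proof -
    have "(\<lambda>x. d x p) -` {t} \<inter> space M = {x \<in> space M. d x p = t}" by auto
    thus ?thesis using t(3) measure_distr[OF dm, of "{t}"] by simp
  qed
  let ?f = "\<lambda>n x. max 0 (min 1 (real n * (t - d x p)))" and ?g = "\<lambda>n x. max 0 (min 1 (1 - real n * (d x p - t)))"
  have cf: "continuous_map mtopology euclideanreal (?f n)" "continuous_map mtopology euclideanreal (?g n)" for n
    by (rule continuous_map_comp_real[OF dc, where g="\<lambda>u. max 0 (min 1 (real n * (t - u)))"], intro continuous_intros)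
       (rule continuous_map_comp_real[OF dc, where g="\<lambda>u. max 0 (min 1 (1 - real n * (u - t)))"], intro continuous_intros)
  have "(\<lambda>n. \<integral>x. ?g n x - ?f n x \<partial>M) \<longlonglongrightarrow> (\<integral>x. indicator {x \<in> space M. d x p = t} x \<partial>M)"
  proof (rule integral_dominated_convergence[where w="\<lambda>_. 2"])
    show "(\<lambda>x. ?g n x - ?f n x) \<in> borel_measurable M" for n by measurable
    show "indicat_real {x \<in> space M. d x p = t} \<in> borel_measurable M" by measurable
    show "AE x in M. norm (?g n x - ?f n x) \<le> 2" for n by (intro AE_I2) (auto simp: max_def min_def)
    show "AE x in M. (\<lambda>n. ?g n x - ?f n x) \<longlonglongrightarrow> indicator {x \<in> space M. d x p = t} x"
    proof (rule AE_I2)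
      fix x assume x: "x \<in> space M"
      show "(\<lambda>n. ?g n x - ?f n x) \<longlonglongrightarrow> indicator {x \<in> space M. d x p = t} x"
      proof (cases "d x p = t")
        case True thus ?thesis using x by simp
      next
        case False
        have "\<forall>\<^sub>F n in sequentially. ?g n x - ?f n x = 0"
        proof (cases "d x p < t")
          case True
          have "\<forall>\<^sub>F n in sequentially. real n * (t - d x p) > 1" using True by real_asymp
          thus ?thesis
          proof eventually_elim
            case (elim n)
            have "real n * (d x p - t) \<le> 0" using True by (simp add: mult_nonneg_nonpos)
            thus ?case using elim by simp
          qed
        next
          case F2: False
          hence gt: "d x p - t > 0" using False by simp
          have "\<forall>\<^sub>F n in sequentially. real n * (d x p - t) > 1" using gt by real_asymp
          thus ?thesis
          proof eventually_elim
            case (elim n)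
            have "real n * (t - d x p) \<le> 0" using gt by (simp add: mult_nonneg_nonpos)
            thus ?case using elim by simp
          qed
        qed
        thus ?thesis using False by (simp add: tendsto_eventually)
      qed
    qed
  qed auto
  hence lim: "(\<lambda>n. (\<integral>x. ?g n x \<partial>M) - (\<integral>x. ?f n x \<partial>M)) \<longlonglongrightarrow> 0"
    using sphere continuous_integrable[OF cf(1)] continuous_integrable[OF cf(2)] by simp
  have "jordan (mball p t)" unfolding jordan_def
  proof (intro conjI allI impI)
    show "mball p t \<in> events" by (intro open_sets) simp
    fix \<epsilon> :: real assume "\<epsilon> > 0"
    hence "\<forall>\<^sub>F n in sequentially. (\<integral>x. ?g n x \<partial>M) - (\<integral>x. ?f n x \<partial>M) < \<epsilon>" using lim by (intro order_tendstoD(2)) auto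
    then obtain n where n: "(\<integral>x. ?g n x \<partial>M) - (\<integral>x. ?f n x \<partial>M) < \<epsilon>" unfolding eventually_sequentially by blast
    have "\<forall>x\<in>S. ?f n x \<le> indicator (mball p t) x \<and> indicator (mball p t) x \<le> ?g n x"
    proof
      fix x assume x: "x \<in> S"
      have iff: "x \<in> mball p t \<longleftrightarrow> d x p < t" using x p by (simp add: in_mball commute)
      show "?f n x \<le> indicator (mball p t) x \<and> indicator (mball p t) x \<le> ?g n x"
      proof (cases "d x p < t")
        case True
        hence "real n * (d x p - t) \<le> 0" by (simp add: mult_nonneg_nonpos)
        thus ?thesis using True iff by simp
      next
        case False
        hence "real n * (t - d x p) \<le> 0" by (simp add: mult_nonneg_nonpos)
        thus ?thesis using False iff by simp
      qed
    qed
    with cf n show "\<exists>f g. continuous_map mtopology euclideanreal f \<and> continuous_map mtopology euclideanreal g \<and>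
     (\<forall>x\<in>S. f x \<le> indicator (mball p t) x \<and> indicator (mball p t) x \<le> g x) \<and> (\<integral>x. g x \<partial>M) - (\<integral>x. f x \<partial>M) < \<epsilon>"
      by (intro exI[of _ "?f n"] exI[of _ "?g n"]) blast
  qed
  with t that show ?thesis by blast
qed

text \<open>The portmanteau argument: the same two continuous functions squeeze the indicator for
  every measure, and their integrals against the limit are close.\<close>

lemma jordan_measure_tendsto:
  assumes \<mu>: "\<And>n. prob_space (\<mu> n)" "\<And>n. sets (\<mu> n) = sets (borel_of mtopology)"
    and conv: "weakly_converges \<mu> M" and A: "jordan A"
  shows "(\<lambda>n. measure (\<mu> n) A) \<longlonglongrightarrow> prob A"
proof (rule tendstoI)
  fix \<epsilon> :: real assume \<epsilon>: "\<epsilon> > 0"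
  hence \<epsilon>2: "\<epsilon> / 2 > 0" by simp
  obtain f g where fg: "continuous_map mtopology euclideanreal f" "continuous_map mtopology euclideanreal g"
     "\<forall>x\<in>S. f x \<le> indicator A x \<and> indicator A x \<le> g x" "(\<integral>x. g x \<partial>M) - (\<integral>x. f x \<partial>M) < \<epsilon> / 2" by (rule jordan_approx[OF A \<epsilon>2])
  have sandwich: "(\<integral>x. f x \<partial>N) \<le> measure N A \<and> measure N A \<le> (\<integral>x. g x \<partial>N)"
    if N: "prob_space N" "sets N = sets (borel_of mtopology)" for N
  proof -
    interpret N: prob_space N by fact
    have sp: "space N = S" using sets_eq_imp_space_eq[OF N(2)] space_borel by simp
    have AN: "A \<in> sets N" using A N(2) M_borel unfolding jordan_def by simp
    have iA: "integrable N (indicator A :: 'a \<Rightarrow> real)" using AN by (simp add: N.emeasure_eq_measure)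
    have "(\<integral>x. f x \<partial>N) \<le> (\<integral>x. indicator A x \<partial>N)"
      by (rule integral_mono[OF prob_integrable[OF N fg(1)] iA]) (use fg(3) sp in auto)
    moreover have "(\<integral>x. indicator A x \<partial>N) \<le> (\<integral>x. g x \<partial>N)"
      by (rule integral_mono[OF iA prob_integrable[OF N fg(2)]]) (use fg(3) sp in auto)
    moreover have "(\<integral>x. indicator A x \<partial>N) = measure N A" using AN by simp
    ultimately show ?thesis by simp
  qed
  have "(\<lambda>n. \<integral>x. f x \<partial>\<mu> n) \<longlonglongrightarrow> (\<integral>x. f x \<partial>M)" "(\<lambda>n. \<integral>x. g x \<partial>\<mu> n) \<longlonglongrightarrow> (\<integral>x. g x \<partial>M)"
    using conv fg unfolding weakly_converges_def by auto
  hence "\<forall>\<^sub>F n in sequentially. (\<integral>x. f x \<partial>\<mu> n) > (\<integral>x. f x \<partial>M) - \<epsilon> / 2" "\<forall>\<^sub>F n in sequentially. (\<integral>x. g x \<partial>\<mu> n) < (\<integral>x. g x \<partial>M) + \<epsilon> / 2"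
    using \<epsilon>2 by (auto intro!: order_tendstoD)
  thus "\<forall>\<^sub>F n in sequentially. dist (measure (\<mu> n) A) (prob A) < \<epsilon>"
  proof eventually_elim
    case (elim n)
    have "(\<integral>x. f x \<partial>\<mu> n) \<le> measure (\<mu> n) A \<and> measure (\<mu> n) A \<le> (\<integral>x. g x \<partial>\<mu> n)" by (rule sandwich[OF \<mu>])
    moreover have "(\<integral>x. f x \<partial>M) \<le> prob A \<and> prob A \<le> (\<integral>x. g x \<partial>M)" by (rule sandwich[OF prob_space_axioms M_borel])
    ultimately show ?case using elim fg(4) unfolding dist_real_def abs_less_iff by linarith
  qed
qed

definition jordan_fun :: "('a \<Rightarrow> 'b) \<Rightarrow> bool" where
  "jordan_fun T \<longleftrightarrow> finite (T ` S) \<and> (\<forall>v. jordan (T -` {v} \<inter> S))"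

lemma jordan_fun_simple: "jordan_fun T \<Longrightarrow> simple_function M T"
  unfolding jordan_fun_def simple_function_def space_M jordan_def by blast

lemma ent_tendsto:
  assumes \<mu>: "\<And>n. prob_space (\<mu> n)" "\<And>n. sets (\<mu> n) = sets (borel_of mtopology)"
    and conv: "weakly_converges \<mu> M" and T: "jordan_fun T"
  shows "(\<lambda>n. ent (\<mu> n) T) \<longlonglongrightarrow> ent M T"
proof -
  have sp: "space (\<mu> n) = S" for n using sets_eq_imp_space_eq[OF \<mu>(2)] space_borel by simp
  show ?thesis unfolding ent_def sp space_M
    using T unfolding jordan_fun_def
    by (intro tendsto_sum tendsto_eta jordan_measure_tendsto[OF \<mu> conv]) auto
qed

lemma jordan_fun_itin: assumes \<kappa>: "jordan_fun \<kappa>" shows "jordan_fun (itin \<phi> \<kappa> n)"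
proof -
  interpret J: algebra S "{A. jordan A}" by (rule jordan_algebra)
  have "jordan (itin \<phi> \<kappa> n -` {v} \<inter> S)" for v
  proof (induction n arbitrary: v)
    case 0
    have "itin \<phi> \<kappa> 0 -` {v} \<inter> S = (if v = [] then S else {})" by (auto simp: itin_def)
    thus ?case using J.top J.empty_sets by auto
  next
    case (Suc n)
    let ?B = "(\<phi> ^^ n) -` (\<kappa> -` {last v} \<inter> S) \<inter> S"
    have "itin \<phi> \<kappa> (Suc n) -` {v} \<inter> S = (if v = [] then {} else (itin \<phi> \<kappa> n -` {butlast v} \<inter> S) \<inter> ?B)"
    proof -
      have "itin \<phi> \<kappa> (Suc n) x = v \<longleftrightarrow> v \<noteq> [] \<and> itin \<phi> \<kappa> n x = butlast v \<and> \<kappa> ((\<phi> ^^ n) x) = last v" for x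
      proof -
        have "itin \<phi> \<kappa> (Suc n) x = itin \<phi> \<kappa> n x @ [\<kappa> ((\<phi> ^^ n) x)]" by (simp add: itin_def)
        thus ?thesis by (metis append_butlast_last_id butlast_snoc last_snoc snoc_eq_iff_butlast)
      qed
      thus ?thesis using iter_S by auto
    qed
    moreover have "jordan ?B" using \<kappa> by (intro jordan_vimage) (simp add: jordan_fun_def)
    ultimately show ?case using J.empty_sets J.Int[of "itin \<phi> \<kappa> n -` {butlast v} \<inter> S" ?B] Suc by auto
  qed
  moreover have "finite (itin \<phi> \<kappa> n ` S)"
    using simple_functionD(1)[OF simple_itin[OF jordan_fun_simple[OF \<kappa>]]] unfolding space_M .
  ultimately show ?thesis unfolding jordan_fun_def by blast
qed

text \<open>Radii above \<open>e / 4\<close> let the balls about an \<open>e / 4\<close>-net cover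
  the space; radii below \<open>e / 2\<close> keep points with the same label less than
  \<open>e\<close> apart; within this range the spheres can be made null.\<close>

lemma ex_jordan_generator:
  obtains \<kappa> :: "'a \<Rightarrow> 'a" where "jordan_fun \<kappa>" "\<And>x y. x \<in> S \<Longrightarrow> y \<in> S \<Longrightarrow> \<kappa> x = \<kappa> y \<Longrightarrow> d x y < e"
proof -
  have e4: "e / 4 > 0" "e / 4 < e / 2" using e_pos by auto
  obtain N where N: "finite N" "N \<subseteq> S" "\<And>x. x \<in> S \<Longrightarrow> \<exists>k\<in>N. d k x < e / 4" using finite_net[OF e4(1)] by metis
  have "\<exists>t. e / 4 < t \<and> t < e / 2 \<and> jordan (mball k t)" if "k \<in> S" for k using ex_jordan_ball[OF that e4(2)] by metis
  then obtain t where t: "\<And>k. k \<in> S \<Longrightarrow> e / 4 < t k \<and> t k < e / 2 \<and> jordan (mball k (t k))" by metis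
  interpret J: algebra S "{A. jordan A}" by (rule jordan_algebra)
  have "\<exists>\<kappa>. (\<forall>x\<in>S. (\<exists>k\<in>N. x \<in> mball k (t k)) \<longrightarrow> \<kappa> x \<in> N \<and> x \<in> mball (\<kappa> x) (t (\<kappa> x))) \<and> finite (\<kappa> ` S) \<and> (\<forall>v. \<kappa> -` {v} \<inter> S \<in> {A. jordan A})"
    by (rule J.ex_selector) (use N t in auto)
  then obtain \<kappa> where \<kappa>: "\<forall>x\<in>S. (\<exists>k\<in>N. x \<in> mball k (t k)) \<longrightarrow> \<kappa> x \<in> N \<and> x \<in> mball (\<kappa> x) (t (\<kappa> x))"
    "finite (\<kappa> ` S)" "\<forall>v. \<kappa> -` {v} \<inter> S \<in> {A. jordan A}" by (elim exE conjE) (rule that)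
  have cl: "\<kappa> x \<in> S \<and> d (\<kappa> x) x < e / 2" if x: "x \<in> S" for x
  proof -
    obtain k where k: "k \<in> N" "d k x < e / 4" using N(3)[OF x] by blast
    hence "x \<in> mball k (t k)" using t[of k] N(2) x by (auto simp: in_mball)
    hence *: "\<kappa> x \<in> N \<and> x \<in> mball (\<kappa> x) (t (\<kappa> x))" using \<kappa>(1) x k by blast
    thus ?thesis using t[of "\<kappa> x"] N(2) by (auto simp: in_mball)
  qed
  show ?thesis
  proof (rule that[of \<kappa>])
    show "jordan_fun \<kappa>" unfolding jordan_fun_def using \<kappa> by auto
    fix x y assume xy: "x \<in> S" "y \<in> S" "\<kappa> x = \<kappa> y"
    have "d x y \<le> d (\<kappa> x) x + d (\<kappa> x) y" using triangle[of x "\<kappa> x" y] cl[OF xy(1)] xy by (simp add: commute)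
    thus "d x y < e" using cl[OF xy(1)] cl[OF xy(2)] xy(3) by simp
  qed
qed

text \<open>Null boundaries are left out on purpose: they depend on the measure, whereas one
  labelling is used as a generator for several measures at once, for instance along a weakly
  convergent sequence.\<close>

definition generator :: "('a \<Rightarrow> 'a) \<Rightarrow> bool" where
  "generator \<kappa> \<longleftrightarrow> simple_function M \<kappa> \<and> (\<forall>x\<in>S. \<forall>y\<in>S. \<kappa> x = \<kappa> y \<longrightarrow> d x y < e)"

lemma ks_entropy_generator: assumes "generator \<kappa>" shows "ks_entropy M \<phi> = ereal (erate \<kappa>)"
proof (rule antisym)
  show "ks_entropy M \<phi> \<le> ereal (erate \<kappa>)"
    unfolding ks_le_iff
  proof
    fix P assume "P \<in> finite_meas_partitions M"
    hence "erate (cell P) \<le> erate \<kappa>"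
      by (intro erate_generator simple_cell) (use assms in \<open>auto simp: generator_def\<close>)
    thus "ereal (erate (cell P)) \<le> ereal (erate \<kappa>)" by simp
  qed
  show "ereal (erate \<kappa>) \<le> ks_entropy M \<phi>" using assms erate_le_ks unfolding generator_def by blast
qed

lemma ex_generator: "\<exists>\<kappa>. generator \<kappa> \<and> jordan_fun \<kappa>"
  using ex_jordan_generator jordan_fun_simple unfolding generator_def by metis

lemma erate_eq_ks: "generator \<kappa> \<Longrightarrow> erate \<kappa> = real_of_ereal (ks_entropy M \<phi>)"
  by (simp add: ks_entropy_generator)

lemma ks_finite: "ks_entropy M \<phi> = ereal (real_of_ereal (ks_entropy M \<phi>))"
  using ex_generator ks_entropy_generator erate_eq_ks by metis

end

subsection \<open>Existence of equilibrium measures\<close>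

context compact_metric begin

text \<open>The sum of point masses \<open>w i\<close> at \<open>p i\<close>. Indexing by
  \<open>I\<close> instead of by points allows coincidences, which occur when pieces of different
  orbits meet.\<close>

definition weighted_measure :: "'i set \<Rightarrow> ('i \<Rightarrow> real) \<Rightarrow> ('i \<Rightarrow> 'a) \<Rightarrow> 'a measure" where
  "weighted_measure I w p = distr (point_measure I (\<lambda>i. ennreal (w i))) (borel_of mtopology) p"

context
  fixes I :: "'i set" and w :: "'i \<Rightarrow> real" and p :: "'i \<Rightarrow> 'a"
  assumes I: "finite I" and w: "\<And>i. i \<in> I \<Longrightarrow> w i \<ge> 0" and w1: "sum w I = 1" and p: "\<And>i. i \<in> I \<Longrightarrow> p i \<in> S"
begin

lemma weighted_measurable: "p \<in> measurable (point_measure I (\<lambda>i. ennreal (w i))) (borel_of mtopology)"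
  using p space_borel by simp

lemma sets_weighted: "sets (weighted_measure I w p) = sets (borel_of mtopology)"
  by (simp add: weighted_measure_def)

lemma prob_weighted: "prob_space (weighted_measure I w p)"
  unfolding weighted_measure_def
proof (rule prob_space.prob_space_distr[OF _ weighted_measurable], rule prob_spaceI)
  have "emeasure (point_measure I (\<lambda>i. ennreal (w i))) I = (\<Sum>i\<in>I. ennreal (w i))"
    by (rule emeasure_point_measure_finite[OF I]) simp
  also have "\<dots> = 1" using w w1 by (simp add: sum_ennreal)
  finally show "emeasure (point_measure I (\<lambda>i. ennreal (w i))) (space (point_measure I (\<lambda>i. ennreal (w i)))) = 1"
    by (simp add: space_point_measure)
qed

lemma integral_weighted:
  assumes f: "f \<in> borel_measurable (borel_of mtopology)"
  shows "(\<integral>x. f x \<partial>weighted_measure I w p) = (\<Sum>i\<in>I. w i * (f (p i) :: real))"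
  unfolding weighted_measure_def integral_distr[OF weighted_measurable f]
  using w by (subst lebesgue_integral_point_measure_finite[OF I]) auto

lemma measure_weighted:
  assumes A: "A \<in> sets (borel_of mtopology)"
  shows "measure (weighted_measure I w p) A = (\<Sum>i\<in>I. w i * indicator A (p i))"
proof -
  interpret P: prob_space "weighted_measure I w p" by (rule prob_weighted)
  have "measure (weighted_measure I w p) A = (\<integral>x. indicator A x \<partial>weighted_measure I w p)" using A by (simp add: sets_weighted)
  also have "\<dots> = (\<Sum>i\<in>I. w i * indicator A (p i))" using A by (intro integral_weighted) simp
  finally show ?thesis .
qed

end

end

context transfer_system begin

definition ln_cut :: "nat \<Rightarrow> 'a \<Rightarrow> real" where "ln_cut m x = ln (max (c x) (1 / (real m + 1)))"

lemma ln_cut_cont: "continuous_map mtopology euclideanreal (ln_cut m)"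
proof -
  have "continuous_map mtopology euclideanreal (\<lambda>x. ln (max (c x) (1 / (real m + 1))))"
  proof (rule continuous_map_comp_real[OF c_cont])
    have "0 < max t (1 / (real m + 1))" for t :: real by (simp add: less_max_iff_disj)
    hence "max t (1 / (real m + 1)) \<noteq> 0" for t :: real by (metis less_irrefl)
    thus "continuous_on UNIV (\<lambda>t. ln (max t (1 / (real m + 1))))" by (intro continuous_intros) auto
  qed
  thus ?thesis unfolding ln_cut_def[abs_def] .
qed

definition ks_real :: "'a measure \<Rightarrow> real" where "ks_real M = real_of_ereal (ks_entropy M \<phi>)"

text \<open>The generator is picked with boundaries null for the limit \<open>M\<close>, and
  \<open>bound\<close> must therefore hold for every fine labelling. The limit in \<open>n\<close>
  is taken at fixed \<open>q\<close>, where entropies converge, and only then does \<open>q\<close>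
  grow. The error term makes room for the boundary effects of the construction.\<close>

lemma entropy_limit:
  assumes M: "invariant_system S d \<phi> e \<theta> M"
    and \<mu>: "\<And>n. prob_space (\<mu> n)" "\<And>n. sets (\<mu> n) = sets (borel_of mtopology)" and conv: "weakly_converges \<mu> M"
    and bound: "\<And>(\<kappa> :: 'a \<Rightarrow> 'a) q. simple_function M \<kappa> \<Longrightarrow> (\<And>x y. x \<in> S \<Longrightarrow> y \<in> S \<Longrightarrow> \<kappa> x = \<kappa> y \<Longrightarrow> d x y < e) \<Longrightarrow> q > 0 \<Longrightarrow>
      \<exists>err. err \<longlonglongrightarrow> 0 \<and> (\<forall>\<^sub>F n in sequentially. K \<le> ent (\<mu> n) (itin \<phi> \<kappa> q) / real q + (\<integral>x. ln_cut m x \<partial>\<mu> n) + err n)"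
  shows "K \<le> ks_real M + (\<integral>x. ln_cut m x \<partial>M)"
proof -
  interpret invariant_system S d \<phi> e \<theta> M by (rule M)
  obtain \<kappa> where \<kappa>: "generator \<kappa>" "jordan_fun \<kappa>" using ex_generator by blast
  have le: "K \<le> ent M (itin \<phi> \<kappa> q) / real q + (\<integral>x. ln_cut m x \<partial>M)" if q: "q > 0" for q
  proof -
    obtain err where err: "err \<longlonglongrightarrow> 0" "\<forall>\<^sub>F n in sequentially. K \<le> ent (\<mu> n) (itin \<phi> \<kappa> q) / real q + (\<integral>x. ln_cut m x \<partial>\<mu> n) + err n"
      using bound[of \<kappa> q] \<kappa>(1) q unfolding generator_def by blast
    have "(\<lambda>n. ent (\<mu> n) (itin \<phi> \<kappa> q) / real q + (\<integral>x. ln_cut m x \<partial>\<mu> n) + err n) \<longlonglongrightarrow> ent M (itin \<phi> \<kappa> q) / real q + (\<integral>x. ln_cut m x \<partial>M) + 0"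
      using conv ln_cut_cont unfolding weakly_converges_def
      by (intro tendsto_intros ent_tendsto[OF \<mu> conv] jordan_fun_itin \<kappa>(2) err(1)) (use q in auto)
    from tendsto_lowerbound[OF this err(2)] show ?thesis by simp
  qed
  have "(\<lambda>q. ent M (itin \<phi> \<kappa> q) / real q + (\<integral>x. ln_cut m x \<partial>M)) \<longlonglongrightarrow> erate \<kappa> + (\<integral>x. ln_cut m x \<partial>M)"
    using \<kappa>(1) unfolding generator_def by (intro tendsto_intros erate_lim) auto
  moreover have "\<forall>\<^sub>F q in sequentially. K \<le> ent M (itin \<phi> \<kappa> q) / real q + (\<integral>x. ln_cut m x \<partial>M)"
    using eventually_gt_at_top[of 0] by eventually_elim (rule le)
  ultimately have "K \<le> erate \<kappa> + (\<integral>x. ln_cut m x \<partial>M)" by (rule tendsto_lowerbound) simp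
  thus ?thesis using erate_eq_ks[OF \<kappa>(1)] unfolding ks_real_def by simp
qed

context
  fixes n :: nat and y :: 'a
  assumes n: "n > 0" and y: "y \<in> S" and pos: "L1 n y > 0"
begin

definition wt :: "'a \<Rightarrow> real" where "wt x = orbit_prod c n x / L1 n y"

definition \<sigma>n :: "'a measure" where "\<sigma>n = weighted_measure (fib n y) wt (\<lambda>x. x)"

text \<open>The average of the images of \<open>\<sigma>n\<close> under the first \<open>n\<close>
  iterates, written as a single weighted measure on pairs so that integrals and masses become finite
  double sums.\<close>

definition \<mu>n :: "'a measure" where
  "\<mu>n = weighted_measure (fib n y \<times> {..<n}) (\<lambda>(x, i). wt x / real n) (\<lambda>(x, i). (\<phi> ^^ i) x)"

lemma wt_nonneg: "x \<in> fib n y \<Longrightarrow> wt x \<ge> 0"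
  unfolding wt_def orbit_prod_def using pos c_nonneg fib_subset iter_S by (intro divide_nonneg_pos prod_nonneg) (auto simp: subset_iff)

lemma wt_sum: "sum wt (fib n y) = 1"
  using Lop_iter_eq[OF y, of n c "\<lambda>_. 1"] pos unfolding wt_def by (simp add: sum_divide_distrib[symmetric])

lemma wt_sum2: "(\<Sum>z\<in>fib n y \<times> {..<n}. case z of (x, i) \<Rightarrow> wt x / real n) = 1"
proof -
  have "(\<Sum>z\<in>fib n y \<times> {..<n}. case z of (x, i) \<Rightarrow> wt x / real n) = (\<Sum>x\<in>fib n y. \<Sum>i<n. wt x / real n)"
    by (rule sum.cartesian_product[symmetric])
  also have "\<dots> = 1" using n wt_sum by simp
  finally show ?thesis .
qed

lemmas w\<sigma> = finite_fib wt_nonneg wt_sum subsetD[OF fib_subset]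

lemma w\<mu>: "finite (fib n y \<times> {..<n})" "\<And>z. z \<in> fib n y \<times> {..<n} \<Longrightarrow> (case z of (x, i) \<Rightarrow> wt x / real n) \<ge> 0"
  "\<And>z. z \<in> fib n y \<times> {..<n} \<Longrightarrow> (case z of (x, i) \<Rightarrow> (\<phi> ^^ i) x) \<in> S"
  using finite_fib wt_nonneg iter_S fib_subset by (auto simp: subset_iff)

lemma prob_\<sigma>n: "prob_space \<sigma>n" "sets \<sigma>n = sets (borel_of mtopology)"
  unfolding \<sigma>n_def by (rule prob_weighted[OF w\<sigma>], simp_all) (rule sets_weighted[OF w\<sigma>], simp_all)

lemma prob_\<mu>n: "prob_space \<mu>n" "sets \<mu>n = sets (borel_of mtopology)"
  unfolding \<mu>n_def by (rule prob_weighted[OF w\<mu>(1,2) wt_sum2 w\<mu>(3)], simp_all) (rule sets_weighted[OF w\<mu>(1,2) wt_sum2 w\<mu>(3)], simp_all)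

lemma integral_\<mu>n:
  assumes f: "continuous_map mtopology euclideanreal f"
  shows "(\<integral>x. f x \<partial>\<mu>n) = (\<Sum>x\<in>fib n y. wt x * (\<Sum>i<n. f ((\<phi> ^^ i) x))) / real n"
proof -
  have "(\<integral>x. f x \<partial>\<mu>n) = (\<Sum>z\<in>fib n y \<times> {..<n}. (case z of (x, i) \<Rightarrow> wt x / real n) * f (case z of (x, i) \<Rightarrow> (\<phi> ^^ i) x))"
    unfolding \<mu>n_def by (rule integral_weighted[OF w\<mu>(1,2) wt_sum2 w\<mu>(3) continuous_map_measurable[OF refl f]])
  also have "\<dots> = (\<Sum>x\<in>fib n y. \<Sum>i<n. wt x / real n * f ((\<phi> ^^ i) x))"
    by (subst sum.cartesian_product) (auto intro!: sum.cong)
  also have "\<dots> = (\<Sum>x\<in>fib n y. wt x * (\<Sum>i<n. f ((\<phi> ^^ i) x))) / real n"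
    by (simp add: sum_distrib_left sum_divide_distrib)
  finally show ?thesis .
qed

text \<open>The orbit sums telescope, leaving only the two endpoints of each orbit piece, divided by
  \<open>n\<close>.\<close>

lemma \<mu>n_almost_invariant:
  assumes f: "continuous_map mtopology euclideanreal f" and B: "\<And>x. x \<in> S \<Longrightarrow> \<bar>f x\<bar> \<le> B"
  shows "\<bar>(\<integral>x. f (\<phi> x) \<partial>\<mu>n) - (\<integral>x. f x \<partial>\<mu>n)\<bar> \<le> 2 * B / real n"
proof -
  have f\<phi>: "continuous_map mtopology euclideanreal (\<lambda>x. f (\<phi> x))" using continuous_map_compose[OF cont f] by (simp add: o_def)
  have "(\<integral>x. f (\<phi> x) \<partial>\<mu>n) - (\<integral>x. f x \<partial>\<mu>n) = (\<Sum>x\<in>fib n y. wt x * ((\<Sum>i<n. f (\<phi> ((\<phi> ^^ i) x))) - (\<Sum>i<n. f ((\<phi> ^^ i) x)))) / real n"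
    unfolding integral_\<mu>n[OF f] integral_\<mu>n[OF f\<phi>] by (simp add: diff_divide_distrib sum_subtractf right_diff_distrib)
  also have "\<dots> = (\<Sum>x\<in>fib n y. wt x * (f ((\<phi> ^^ n) x) - f x)) / real n"
  proof -
    have "(\<Sum>i<n. f (\<phi> ((\<phi> ^^ i) x))) - (\<Sum>i<n. f ((\<phi> ^^ i) x)) = f ((\<phi> ^^ n) x) - f x" for x
      using sum_lessThan_telescope[of "\<lambda>i. f ((\<phi> ^^ i) x)" n] by (simp add: sum_subtractf)
    thus ?thesis by simp
  qed
  finally have "\<bar>(\<integral>x. f (\<phi> x) \<partial>\<mu>n) - (\<integral>x. f x \<partial>\<mu>n)\<bar> = \<bar>\<Sum>x\<in>fib n y. wt x * (f ((\<phi> ^^ n) x) - f x)\<bar> / real n" by simp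
  also have "\<dots> \<le> (\<Sum>x\<in>fib n y. wt x * (2 * B)) / real n"
  proof (intro divide_right_mono order_trans[OF sum_abs] sum_mono)
    fix x assume x: "x \<in> fib n y"
    have "\<bar>f ((\<phi> ^^ n) x) - f x\<bar> \<le> 2 * B" using B[of x] B[of "(\<phi> ^^ n) x"] x fib_subset iter_S by fastforce
    thus "\<bar>wt x * (f ((\<phi> ^^ n) x) - f x)\<bar> \<le> wt x * (2 * B)"
      unfolding abs_mult using wt_nonneg[OF x] by (intro mult_mono) auto
  qed simp
  also have "\<dots> = 2 * B / real n" using wt_sum by (simp add: sum_distrib_right[symmetric])
  finally show ?thesis .
qed

text \<open>Distinct points of the \<open>n\<close>-th fibre have distinct itineraries, so the
  partition sees the full entropy of the weights \<open>wt\<close>. By the form of \<open>wt\<close>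
  this entropy is \<open>ln (L1 n y)\<close> minus the mean of \<open>ln (orbit_prod c n x)\<close>,
  and cutting off can only increase the latter.\<close>

lemma ent_\<sigma>n_lower:
  fixes \<kappa> :: "'a \<Rightarrow> 'b"
  assumes \<kappa>: "simple_function (borel_of mtopology) \<kappa>" and diam: "\<And>x y. x \<in> S \<Longrightarrow> y \<in> S \<Longrightarrow> \<kappa> x = \<kappa> y \<Longrightarrow> d x y < e"
  shows "ln (L1 n y) \<le> ent \<sigma>n (itin \<phi> \<kappa> n) + real n * (\<integral>x. ln_cut m x \<partial>\<mu>n)"
proof -
  interpret measurable_system \<sigma>n \<phi> by (rule measurable_system_borel[OF prob_\<sigma>n])
  have sp: "space \<sigma>n = S" using sets_eq_imp_space_eq[OF prob_\<sigma>n(2)] space_borel by simp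
  have ks: "simple_function \<sigma>n \<kappa>" using \<kappa> prob_\<sigma>n(2) sp space_borel by (simp add: simple_function_def)
  let ?T = "itin \<phi> \<kappa> n" and ?F = "fib n y"
  have Ts: "simple_function \<sigma>n ?T" by (rule simple_itin[OF ks])
  have inj: "inj_on ?T ?F"
  proof (rule inj_onI)
    fix a b assume ab: "a \<in> ?F" "b \<in> ?F" "?T a = ?T b"
    hence S: "a \<in> S" "b \<in> S" using fib_subset by auto
    show "a = b"
    proof (rule separation_eq[OF S])
      show "(\<phi> ^^ n) a = (\<phi> ^^ n) b" using ab by (simp add: fib_def)
      fix i assume "i < n"
      thus "d ((\<phi> ^^ i) a) ((\<phi> ^^ i) b) < e" using ab(3) S iter_S diam unfolding itin_eq_iff by blast
    qed
  qed
  have prT: "measure \<sigma>n (?T -` {?T x} \<inter> S) = wt x" if x: "x \<in> ?F" for x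
  proof -
    have ev: "?T -` {?T x} \<inter> S \<in> sets (borel_of mtopology)" using simple_sets[OF Ts, of "{?T x}"] prob_\<sigma>n(2) sp by simp
    have "measure \<sigma>n (?T -` {?T x} \<inter> S) = (\<Sum>z\<in>?F. wt z * indicator (?T -` {?T x} \<inter> S) z)"
      unfolding \<sigma>n_def by (rule measure_weighted[OF w\<sigma>]) (use ev in auto)
    also have "\<dots> = (\<Sum>z\<in>?F. if z = x then wt z else 0)"
      using inj x fib_subset by (intro sum.cong) (auto simp: indicator_def inj_on_def subset_iff)
    also have "\<dots> = wt x" using x finite_fib by simp
    finally show ?thesis .
  qed
  have fin: "finite (?T ` S)" using simple_functionD(1)[OF Ts] sp by simp
  have "(\<Sum>x\<in>?F. eta (wt x)) = (\<Sum>x\<in>?F. eta (measure \<sigma>n (?T -` {?T x} \<inter> S)))" using prT by simp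
  also have "\<dots> = (\<Sum>v\<in>?T ` ?F. eta (measure \<sigma>n (?T -` {v} \<inter> S)))" using inj by (simp add: sum.reindex)
  also have "\<dots> \<le> (\<Sum>v\<in>?T ` S. eta (measure \<sigma>n (?T -` {v} \<inter> S)))"
    using fin fib_subset by (intro sum_mono2 eta_nonneg) auto
  also have "\<dots> = ent \<sigma>n ?T" unfolding ent_def sp ..
  finally have 1: "(\<Sum>x\<in>?F. eta (wt x)) \<le> ent \<sigma>n ?T" .
  have "ln (L1 n y) = (\<Sum>x\<in>?F. wt x * ln (L1 n y))" using wt_sum by (simp add: sum_distrib_right[symmetric])
  also have "\<dots> \<le> (\<Sum>x\<in>?F. eta (wt x) + wt x * (\<Sum>i<n. ln_cut m ((\<phi> ^^ i) x)))"
  proof (rule sum_mono)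
    fix x assume x: "x \<in> ?F"
    hence xS: "x \<in> S" using fib_subset by blast
    show "wt x * ln (L1 n y) \<le> eta (wt x) + wt x * (\<Sum>i<n. ln_cut m ((\<phi> ^^ i) x))"
    proof (cases "wt x = 0")
      case False
      hence wp: "wt x > 0" using wt_nonneg[OF x] by simp
      hence cnp: "orbit_prod c n x > 0" using pos unfolding wt_def by (simp add: zero_less_divide_iff)
      have ci: "c ((\<phi> ^^ i) x) > 0" if "i < n" for i
      proof -
        have "c ((\<phi> ^^ i) x) \<noteq> 0" using cnp that unfolding orbit_prod_def by (metis finite_lessThan lessThan_iff less_irrefl prod_zero)
        thus ?thesis using c_nonneg[OF iter_S[OF xS, of i]] by simp
      qed
      have "ln (orbit_prod c n x) = (\<Sum>i<n. ln (c ((\<phi> ^^ i) x)))"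
        unfolding orbit_prod_def by (rule ln_prod) (use ci in \<open>auto simp: less_le\<close>)
      also have "\<dots> \<le> (\<Sum>i<n. ln_cut m ((\<phi> ^^ i) x))"
      proof (rule sum_mono)
        fix i assume "i \<in> {..<n}"
        hence "c ((\<phi> ^^ i) x) > 0" using ci by simp
        thus "ln (c ((\<phi> ^^ i) x)) \<le> ln_cut m ((\<phi> ^^ i) x)" unfolding ln_cut_def by (subst ln_le_cancel_iff) (auto simp: less_max_iff_disj)
      qed
      finally have "wt x * ln (orbit_prod c n x) \<le> wt x * (\<Sum>i<n. ln_cut m ((\<phi> ^^ i) x))" using wp by (intro mult_left_mono) auto
      moreover {
      have "ln (wt x) = ln (orbit_prod c n x) - ln (L1 n y)" unfolding wt_def using cnp pos by (simp add: ln_div)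
      hence "wt x * ln (orbit_prod c n x) = wt x * ln (wt x) + wt x * ln (L1 n y)" by (simp add: distrib_left[symmetric])
      }
      ultimately show ?thesis unfolding eta_def by linarith
    qed simp
  qed
  also have "\<dots> = (\<Sum>x\<in>?F. eta (wt x)) + real n * (\<integral>x. ln_cut m x \<partial>\<mu>n)"
    unfolding integral_\<mu>n[OF ln_cut_cont] using n by (simp add: sum.distrib)
  finally show ?thesis using 1 by linarith
qed

text \<open>The windows of length \<open>q\<close> pass from \<open>\<sigma>n\<close> to the average
  \<open>\<mu>n\<close> by concavity. Dividing by \<open>q * n\<close> turns the window error
  \<open>3 * q^2 * ?B\<close> into the last term, which vanishes as \<open>n\<close> grows with
  \<open>q\<close> fixed.\<close>

lemma misiurewicz_bound:
  fixes \<kappa> :: "'a \<Rightarrow> 'b"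
  assumes \<kappa>: "simple_function (borel_of mtopology) \<kappa>" and diam: "\<And>x y. x \<in> S \<Longrightarrow> y \<in> S \<Longrightarrow> \<kappa> x = \<kappa> y \<Longrightarrow> d x y < e"
    and q: "q > 0" "q \<le> n"
  shows "ln (L1 n y) / real n \<le> ent \<mu>n (itin \<phi> \<kappa> q) / real q + (\<integral>x. ln_cut m x \<partial>\<mu>n) + 3 * real q * ln (real (card (\<kappa> ` S))) / real n"
proof -
  interpret measurable_system \<sigma>n \<phi> by (rule measurable_system_borel[OF prob_\<sigma>n])
  have sp: "space \<sigma>n = S" using sets_eq_imp_space_eq[OF prob_\<sigma>n(2)] space_borel by simp
  have sp\<mu>: "space \<mu>n = S" using sets_eq_imp_space_eq[OF prob_\<mu>n(2)] space_borel by simp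
  have ks: "simple_function \<sigma>n \<kappa>" using \<kappa> prob_\<sigma>n(2) sp space_borel by (simp add: simple_function_def)
  let ?B = "ln (real (card (\<kappa> ` S)))" and ?X = "itin \<phi> \<kappa> q"
  have fin: "finite (\<kappa> ` S)" using simple_functionD(1)[OF ks] sp by simp
  have Xs: "simple_function \<sigma>n ?X" by (rule simple_itin[OF ks])
  have 1: "real q * ent \<sigma>n (itin \<phi> \<kappa> n) \<le> (\<Sum>i<n. ent \<sigma>n (\<lambda>x. ?X ((\<phi> ^^ i) x))) + 3 * (real q)\<^sup>2 * ?B"
  proof (rule ent_itin_windows[OF ks _ q])
    fix j show "ent \<sigma>n (\<lambda>x. \<kappa> ((\<phi> ^^ j) x)) \<le> ?B"
      by (rule ent_le_ln_card[OF simple_iter[OF ks] fin]) (use iter_S sp in auto)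
  qed
  have 2: "(\<Sum>i<n. ent \<sigma>n (\<lambda>x. ?X ((\<phi> ^^ i) x))) \<le> real n * ent \<mu>n ?X"
  proof (rule ent_average_ge[where f="\<lambda>i. \<phi> ^^ i"])
    show "space \<sigma>n = space \<mu>n" using sp sp\<mu> by simp
    show "finite (?X ` space \<mu>n)" using simple_functionD(1)[OF Xs] sp sp\<mu> by simp
    show "(\<phi> ^^ i) x \<in> space \<mu>n" if "x \<in> space \<mu>n" for i x using that iter_S sp\<mu> by simp
    fix v
    let ?A = "?X -` {v} \<inter> S"
    have A: "?A \<in> sets (borel_of mtopology)" using simple_sets[OF Xs, of "{v}"] prob_\<sigma>n(2) sp by simp
    have Ai: "(\<lambda>x. ?X ((\<phi> ^^ i) x)) -` {v} \<inter> S \<in> sets (borel_of mtopology)" for i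
      using simple_sets[OF simple_iter[OF Xs], of i "{v}"] prob_\<sigma>n(2) sp by simp
    have "real n * measure \<mu>n ?A = real n * (\<Sum>z\<in>fib n y \<times> {..<n}. (case z of (x, i) \<Rightarrow> wt x / real n) * indicator ?A (case z of (x, i) \<Rightarrow> (\<phi> ^^ i) x))"
      unfolding \<mu>n_def by (subst measure_weighted[OF w\<mu>(1,2) wt_sum2 w\<mu>(3)]) (use A in auto)
    also have "\<dots> = real n * (\<Sum>x\<in>fib n y. \<Sum>i<n. wt x / real n * indicator ?A ((\<phi> ^^ i) x))"
      by (subst sum.cartesian_product) (auto intro!: sum.cong arg_cong[where f="\<lambda>u. real n * u"])
    also have "\<dots> = (\<Sum>x\<in>fib n y. \<Sum>i<n. wt x * indicator ?A ((\<phi> ^^ i) x))"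
      using n by (simp add: sum_distrib_left)
    also have "\<dots> = (\<Sum>i<n. \<Sum>x\<in>fib n y. wt x * indicator ?A ((\<phi> ^^ i) x))" by (rule sum.swap)
    also have "\<dots> = (\<Sum>i<n. measure \<sigma>n ((\<lambda>x. ?X ((\<phi> ^^ i) x)) -` {v} \<inter> S))"
    proof (rule sum.cong[OF refl])
      fix i
      have "measure \<sigma>n ((\<lambda>x. ?X ((\<phi> ^^ i) x)) -` {v} \<inter> S) = (\<Sum>x\<in>fib n y. wt x * indicator ((\<lambda>x. ?X ((\<phi> ^^ i) x)) -` {v} \<inter> S) x)"
        unfolding \<sigma>n_def by (rule measure_weighted[OF w\<sigma>]) (use Ai in auto)
      also have "\<dots> = (\<Sum>x\<in>fib n y. wt x * indicator ?A ((\<phi> ^^ i) x))"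
        using fib_subset iter_S by (intro sum.cong) (auto simp: indicator_def subset_iff)
      finally show "(\<Sum>x\<in>fib n y. wt x * indicator ?A ((\<phi> ^^ i) x)) = measure \<sigma>n ((\<lambda>x. ?X ((\<phi> ^^ i) x)) -` {v} \<inter> S)" by simp
    qed
    finally show "real n * measure \<mu>n (?X -` {v} \<inter> space \<mu>n) = (\<Sum>i<n. measure \<sigma>n ((\<lambda>x. ?X ((\<phi> ^^ i) x)) -` {v} \<inter> space \<sigma>n))"
      unfolding sp sp\<mu> .
  qed
  let ?I = "\<integral>x. ln_cut m x \<partial>\<mu>n"
  have "real q * ln (L1 n y) \<le> real q * (ent \<sigma>n (itin \<phi> \<kappa> n) + real n * ?I)"
    by (intro mult_left_mono ent_\<sigma>n_lower[OF \<kappa>] diam) auto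
  also have "\<dots> \<le> real n * ent \<mu>n ?X + 3 * (real q)\<^sup>2 * ?B + real q * (real n * ?I)"
    using 1 2 by (simp add: algebra_simps)
  finally have "real q * ln (L1 n y) / (real q * real n) \<le> (real n * ent \<mu>n ?X + 3 * (real q)\<^sup>2 * ?B + real q * (real n * ?I)) / (real q * real n)"
    by (intro divide_right_mono) auto
  also have "\<dots> = ent \<mu>n ?X / real q + ?I + 3 * real q * ?B / real n"
    using q n by (simp add: add_divide_distrib power2_eq_square)
  finally show ?thesis using q by simp
qed

end

definition equilibrium :: "'a measure \<Rightarrow> bool" where
  "equilibrium M \<longleftrightarrow> invariant_system S d \<phi> e \<theta> M \<and> (\<forall>m. ln (rad c) \<le> ks_real M + (\<integral>x. ln_cut m x \<partial>M))"

theorem ex_equilibrium: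
  assumes r: "rad c > 0" shows "\<exists>M. equilibrium M"
proof -
  \<comment> \<open>Positive rates that increase to \<open>rad c\<close> but stay strictly below it,
    as \<open>L1_large\<close> requires. The loss \<open>ln ((real k + 1) / (real k + 2))\<close>
    goes into the error term.\<close>
  define s where "s k = rad c * ((real k + 1) / (real k + 2))" for k
  have s: "0 < s k" "s k < rad c" for k
  proof -
    have "(real k + 1) / (real k + 2) < 1" by simp
    hence "rad c * ((real k + 1) / (real k + 2)) < rad c * 1" using r by (intro mult_strict_left_mono) auto
    thus "s k < rad c" unfolding s_def by simp
    show "0 < s k" unfolding s_def using r by (intro mult_pos_pos divide_pos_pos) auto
  qed
  have "\<exists>y\<in>S. L1 (Suc k) y > s k ^ Suc k" for k using L1_large[OF s, of "Suc k" k] by simp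
  then obtain y where y: "\<And>k. y k \<in> S" "\<And>k. L1 (Suc k) (y k) > s k ^ Suc k" by metis
  have pos: "L1 (Suc k) (y k) > 0" for k using y(2)[of k] s(1)[of k] by (meson less_trans zero_less_power)
  have lnL: "ln (s k) \<le> ln (L1 (Suc k) (y k)) / real (Suc k)" for k
  proof -
    have "ln (s k ^ Suc k) \<le> ln (L1 (Suc k) (y k))" by (rule ln_le_cancel_iff[THEN iffD2, OF zero_less_power[OF s(1)] pos less_imp_le[OF y(2)]])
    hence "real (Suc k) * ln (s k) \<le> ln (L1 (Suc k) (y k))" using s(1)[of k] by (simp only: ln_realpow)
    thus ?thesis by (simp add: field_simps)
  qed
  define \<mu> where "\<mu> k = \<mu>n (Suc k) (y k)" for k
  note h = zero_less_Suc y(1) pos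
  have \<mu>: "prob_space (\<mu> k)" "sets (\<mu> k) = sets (borel_of mtopology)" for k
    unfolding \<mu>_def using prob_\<mu>n[OF h] by auto
  obtain r M where r: "strict_mono r" and M: "prob_space M" "sets M = sets (borel_of mtopology)"
    and conv: "\<And>f. continuous_map mtopology euclideanreal f \<Longrightarrow> (\<lambda>n. \<integral>x. f x \<partial>\<mu> (r n)) \<longlonglongrightarrow> (\<integral>x. f x \<partial>M)"
    by (rule prob_measures_seq_compact[OF \<mu>]) (rule that)
  have wc: "weakly_converges (\<lambda>n. \<mu> (r n)) M" unfolding weakly_converges_def using conv by blast
  have inv: "invariant_system S d \<phi> e \<theta> M"
  proof (rule invariant_of_integrals[OF M])
    fix f assume f: "continuous_map mtopology euclideanreal f"
    have f\<phi>: "continuous_map mtopology euclideanreal (\<lambda>x. f (\<phi> x))" using continuous_map_compose[OF cont f] by (simp add: o_def)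
    obtain B where B: "B > 0" "\<And>x. x \<in> S \<Longrightarrow> \<bar>f x\<bar> \<le> B" using continuous_bounded[OF f] by (metis real_norm_def)
    have "(\<lambda>k. 2 * B / real (Suc k)) \<longlonglongrightarrow> 0" by real_asymp
    hence lim: "(\<lambda>n. 2 * B / real (Suc (r n))) \<longlonglongrightarrow> 0" by (rule LIMSEQ_subseq_LIMSEQ[OF _ r, unfolded o_def])
    have bd: "norm ((\<integral>x. f (\<phi> x) \<partial>\<mu> (r n)) - (\<integral>x. f x \<partial>\<mu> (r n))) \<le> 2 * B / real (Suc (r n))" for n
      unfolding \<mu>_def using \<mu>n_almost_invariant[OF h f B(2)] by simp
    have "(\<lambda>n. (\<integral>x. f (\<phi> x) \<partial>\<mu> (r n)) - (\<integral>x. f x \<partial>\<mu> (r n))) \<longlonglongrightarrow> 0"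
      by (rule Lim_null_comparison[OF _ lim]) (simp only: bd eventually_True)
    moreover have "(\<lambda>n. (\<integral>x. f (\<phi> x) \<partial>\<mu> (r n)) - (\<integral>x. f x \<partial>\<mu> (r n))) \<longlonglongrightarrow> (\<integral>x. f (\<phi> x) \<partial>M) - (\<integral>x. f x \<partial>M)"
      by (intro tendsto_diff conv f f\<phi>)
    ultimately have "(\<integral>x. f (\<phi> x) \<partial>M) - (\<integral>x. f x \<partial>M) = 0" using LIMSEQ_unique by blast
    thus "(\<integral>x. f (\<phi> x) \<partial>M) = (\<integral>x. f x \<partial>M)" by simp
  qed
  have "ln (rad c) \<le> ks_real M + (\<integral>x. ln_cut m x \<partial>M)" for m
  proof (rule entropy_limit[OF inv \<mu> wc])
    fix \<kappa> :: "'a \<Rightarrow> 'a" and q :: nat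
    assume \<kappa>: "simple_function M \<kappa>" and diam: "\<And>x y. x \<in> S \<Longrightarrow> y \<in> S \<Longrightarrow> \<kappa> x = \<kappa> y \<Longrightarrow> d x y < e" and q: "q > 0"
    have \<kappa>b: "simple_function (borel_of mtopology) \<kappa>" using \<kappa> M(2) sets_eq_imp_space_eq[OF M(2)] by (simp add: simple_function_def)
    define C where "C = 3 * real q * ln (real (card (\<kappa> ` S)))"
    define err where "err k = C / real (Suc k) - ln ((real k + 1) / (real k + 2))" for k
    have err0: "err \<longlonglongrightarrow> 0" unfolding err_def by real_asymp
    have err: "(\<lambda>n. err (r n)) \<longlonglongrightarrow> 0" by (rule LIMSEQ_subseq_LIMSEQ[OF err0 r, unfolded o_def])
    have bound: "ln (rad c) \<le> ent (\<mu> k) (itin \<phi> \<kappa> q) / real q + (\<integral>x. ln_cut m x \<partial>\<mu> k) + err k" if "q \<le> Suc k" for k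
    proof -
      have "ln (s k) = ln (rad c) + ln ((real k + 1) / (real k + 2))" unfolding s_def using \<open>rad c > 0\<close> by (intro ln_mult_pos) auto
      moreover have "ln (s k) \<le> ent (\<mu> k) (itin \<phi> \<kappa> q) / real q + (\<integral>x. ln_cut m x \<partial>\<mu> k) + C / real (Suc k)"
        unfolding \<mu>_def C_def by (rule order_trans[OF lnL misiurewicz_bound[OF h \<kappa>b _ q that]]) (rule diam)
      ultimately show ?thesis unfolding err_def by linarith
    qed
    have "\<forall>\<^sub>F n in sequentially. q \<le> Suc (r n)"
      unfolding eventually_sequentially using seq_suble[OF r] by (intro exI[of _ q]) (meson le_SucI le_trans)
    hence "\<forall>\<^sub>F n in sequentially. ln (rad c) \<le> ent (\<mu> (r n)) (itin \<phi> \<kappa> q) / real q + (\<integral>x. ln_cut m x \<partial>\<mu> (r n)) + err (r n)"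
      by eventually_elim (rule bound)
    with err show "\<exists>err. err \<longlonglongrightarrow> 0 \<and> (\<forall>\<^sub>F n in sequentially. ln (rad c) \<le> ent (\<mu> (r n)) (itin \<phi> \<kappa> q) / real q + (\<integral>x. ln_cut m x \<partial>\<mu> (r n)) + err n)" by blast
  qed
  with inv show ?thesis unfolding equilibrium_def by blast
qed

end

subsection \<open>Ergodic equilibrium measures\<close>

context transfer_system begin

lemma ln_cut_mono: "m \<le> m' \<Longrightarrow> ln_cut m' x \<le> ln_cut m x"
proof -
  assume "m \<le> m'"
  hence "1 / (real m' + 1) \<le> 1 / (real m + 1)" by (intro divide_left_mono) auto
  hence "max (c x) (1 / (real m' + 1)) \<le> max (c x) (1 / (real m + 1))" by (rule max.mono[OF order_refl])
  moreover have "0 < max (c x) (1 / (real m' + 1))" by (simp add: less_max_iff_disj)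
  ultimately show ?thesis unfolding ln_cut_def by (subst ln_le_cancel_iff) auto
qed

lemma invariant_systemD:
  assumes "invariant_system S d \<phi> e \<theta> M"
  shows "prob_space M" "sets M = sets (borel_of mtopology)" "space M = S"
proof -
  interpret invariant_system S d \<phi> e \<theta> M by fact
  show "prob_space M" "sets M = sets (borel_of mtopology)" "space M = S" by (unfold_locales) (rule M_borel space_M)+
qed

lemma integral_ln_cut_mono:
  assumes M: "invariant_system S d \<phi> e \<theta> M" and m: "m \<le> m'"
  shows "(\<integral>x. ln_cut m' x \<partial>M) \<le> (\<integral>x. ln_cut m x \<partial>M)"
  by (rule integral_mono[OF prob_integrable[OF invariant_systemD(1,2)[OF M] ln_cut_cont] prob_integrable[OF invariant_systemD(1,2)[OF M] ln_cut_cont]])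
     (rule ln_cut_mono[OF m])

text \<open>The level \<open>m0\<close> is independent of \<open>M\<close>: as soon as
  \<open>1 / (m0 + 1) < \<delta>\<close>, the cut-off weight lies below \<open>c + \<delta>\<close>,
  for which \<rho> is still an admissible rate. So deep cut-offs overshoot the bound by arbitrarily
  little, uniformly over all invariant measures.\<close>

lemma ks_real_upper:
  assumes \<rho>: "\<rho> > rad c"
  shows "\<exists>m0. \<forall>M. invariant_system S d \<phi> e \<theta> M \<longrightarrow> ks_real M + (\<integral>x. ln_cut m0 x \<partial>M) \<le> ln \<rho>"
proof -
  obtain \<delta> where \<delta>: "\<delta> > 0" "growth (\<lambda>x. c x + \<delta>) \<rho>" using growth_perturbed[OF \<rho>] by blast
  have \<rho>0: "\<rho> > 0" using \<rho> rad_nonneg by linarith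
  have "\<forall>\<^sub>F m in sequentially. 1 / (real m + 1) < \<delta>" using \<delta>(1) by real_asymp
  then obtain m0 where m0: "1 / (real m0 + 1) < \<delta>" unfolding eventually_sequentially by blast
  have c': "continuous_map mtopology euclideanreal (\<lambda>x. c x + \<delta>)" using c_cont by (intro continuous_intros)
  have c'pos: "c x + \<delta> > 0" if "x \<in> S" for x using c_nonneg[OF that] \<delta> by simp
  have lnc: "continuous_map mtopology euclideanreal (\<lambda>x. ln (c x + \<delta>))"
  proof (rule continuous_map_eq)
    have "max t 0 + \<delta> \<noteq> 0" for t :: real using \<delta> by (smt (verit) max.cobounded2)
    hence "continuous_on UNIV (\<lambda>t::real. ln (max t 0 + \<delta>))" by (intro continuous_intros) auto
    thus "continuous_map mtopology euclideanreal (\<lambda>x. ln (max (c x) 0 + \<delta>))" by (rule continuous_map_comp_real[OF c_cont])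
    show "ln (max (c x) 0 + \<delta>) = ln (c x + \<delta>)" if "x \<in> topspace mtopology" for x using c_nonneg[of x] that by (simp add: max_absorb1)
  qed
  have "ks_real M + (\<integral>x. ln_cut m0 x \<partial>M) \<le> ln \<rho>" if M: "invariant_system S d \<phi> e \<theta> M" for M
  proof -
    interpret invariant_system S d \<phi> e \<theta> M by (rule M)
    obtain \<kappa> where \<kappa>: "generator \<kappa>" using ex_generator by blast
    have "ks_real M = erate \<kappa>" using erate_eq_ks[OF \<kappa>] unfolding ks_real_def by simp
    also have "\<dots> \<le> ln \<rho> - (\<integral>x. ln (c x + \<delta>) \<partial>M)"
      using \<kappa> unfolding generator_def by (intro erate_le_growth[OF c' _ \<rho>0 \<delta>(2)] c'pos) auto
    finally have 1: "ks_real M \<le> ln \<rho> - (\<integral>x. ln (c x + \<delta>) \<partial>M)" .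
    have "(\<integral>x. ln_cut m0 x \<partial>M) \<le> (\<integral>x. ln (c x + \<delta>) \<partial>M)"
    proof (rule integral_mono[OF continuous_integrable[OF ln_cut_cont] continuous_integrable[OF lnc]])
      fix x assume "x \<in> space M"
      hence "c x \<ge> 0" using c_nonneg space_M by simp
      hence "max (c x) (1 / (real m0 + 1)) \<le> c x + \<delta>" using m0 \<delta> by simp
      moreover have "0 < max (c x) (1 / (real m0 + 1))" by (simp add: less_max_iff_disj)
      ultimately show "ln_cut m0 x \<le> ln (c x + \<delta>)" unfolding ln_cut_def by (subst ln_le_cancel_iff) auto
    qed
    with 1 show ?thesis by linarith
  qed
  thus ?thesis by blast
qed

text \<open>For fixed \<open>q\<close> the entropy rate of \<open>\<mu> n\<close> is at most its
  entropy at stage \<open>q\<close>, and that quantity converges along a labelling adapted to the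
  limit.\<close>

lemma equilibrium_closed:
  assumes \<mu>: "\<And>n. equilibrium (\<mu> n)" and M: "prob_space M" "sets M = sets (borel_of mtopology)" and conv: "weakly_converges \<mu> M"
  shows "equilibrium M"
proof -
  have \<mu>inv: "invariant_system S d \<phi> e \<theta> (\<mu> n)" for n using \<mu> unfolding equilibrium_def by blast
  note \<mu>p = invariant_systemD[OF \<mu>inv]
  have invM: "invariant_system S d \<phi> e \<theta> M"
  proof (rule invariant_of_integrals[OF M])
    fix f assume f: "continuous_map mtopology euclideanreal f"
    have f\<phi>: "continuous_map mtopology euclideanreal (\<lambda>x. f (\<phi> x))" using continuous_map_compose[OF cont f] by (simp add: o_def)
    have eq: "(\<integral>x. f (\<phi> x) \<partial>\<mu> n) = (\<integral>x. f x \<partial>\<mu> n)" for n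
    proof -
      interpret invariant_system S d \<phi> e \<theta> "\<mu> n" by (rule \<mu>inv)
      show ?thesis using integral_iter[OF continuous_measurable[OF f], of 1] by simp
    qed
    have "(\<lambda>n. \<integral>x. f (\<phi> x) \<partial>\<mu> n) \<longlonglongrightarrow> (\<integral>x. f (\<phi> x) \<partial>M)" "(\<lambda>n. \<integral>x. f x \<partial>\<mu> n) \<longlonglongrightarrow> (\<integral>x. f x \<partial>M)"
      using conv f f\<phi> unfolding weakly_converges_def by blast+
    thus "(\<integral>x. f (\<phi> x) \<partial>M) = (\<integral>x. f x \<partial>M)" unfolding eq by (rule LIMSEQ_unique)
  qed
  have "ln (rad c) \<le> ks_real M + (\<integral>x. ln_cut m x \<partial>M)" for m
  proof (rule entropy_limit[OF invM \<mu>p(1,2) conv])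
    fix \<kappa> :: "'a \<Rightarrow> 'a" and q :: nat
    assume \<kappa>: "simple_function M \<kappa>" and diam: "\<And>x y. x \<in> S \<Longrightarrow> y \<in> S \<Longrightarrow> \<kappa> x = \<kappa> y \<Longrightarrow> d x y < e" and q: "q > 0"
    have "ln (rad c) \<le> ent (\<mu> n) (itin \<phi> \<kappa> q) / real q + (\<integral>x. ln_cut m x \<partial>\<mu> n) + 0" for n
    proof -
      interpret invariant_system S d \<phi> e \<theta> "\<mu> n" by (rule \<mu>inv)
      have ks: "simple_function (\<mu> n) \<kappa>" using \<kappa> M(2) M_borel space_M invariant_systemD(3)[OF invM] by (simp add: simple_function_def)
      hence g: "generator \<kappa>" unfolding generator_def using diam by blast
      have "ln (rad c) \<le> ks_real (\<mu> n) + (\<integral>x. ln_cut m x \<partial>\<mu> n)" using \<mu> unfolding equilibrium_def by blast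
      also have "ks_real (\<mu> n) = erate \<kappa>" using erate_eq_ks[OF g] unfolding ks_real_def by simp
      also have "erate \<kappa> \<le> ent (\<mu> n) (itin \<phi> \<kappa> q) / real q" by (rule erate_le[OF ks q])
      finally show ?thesis by simp
    qed
    thus "\<exists>err. err \<longlonglongrightarrow> 0 \<and> (\<forall>\<^sub>F n in sequentially. ln (rad c) \<le> ent (\<mu> n) (itin \<phi> \<kappa> q) / real q + (\<integral>x. ln_cut m x \<partial>\<mu> n) + err n)"
      by (intro exI[of _ "\<lambda>_. 0"]) (auto intro!: always_eventually)
  qed
  with invM show ?thesis unfolding equilibrium_def by blast
qed

section \<open>Conditioning on an invariant set\<close>

lemma integral_uniform_measure:
  fixes f :: "'a \<Rightarrow> real"
  assumes M: "prob_space M" and f: "f \<in> borel_measurable M" and A: "A \<in> sets M" "measure M A > 0"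
  shows "(\<integral>x. f x \<partial>uniform_measure M A) = (\<integral>x. indicator A x * f x \<partial>M) / measure M A"
proof -
  interpret prob_space M by fact
  have "indicator A x / emeasure M A = ennreal (indicator A x / measure M A)" for x
    using A(2) divide_ennreal[of "indicator A x" "measure M A"] by (simp add: emeasure_eq_measure ennreal_indicator)
  hence "uniform_measure M A = density M (\<lambda>x. ennreal (indicator A x / measure M A))"
    unfolding uniform_measure_def by simp
  hence "(\<integral>x. f x \<partial>uniform_measure M A) = (\<integral>x. (indicator A x / measure M A) *\<^sub>R f x \<partial>M)"
    using f A by (simp add: integral_density)
  also have "\<dots> = (\<integral>x. (indicator A x * f x) / measure M A \<partial>M)" by (intro Bochner_Integration.integral_cong) auto
  finally show ?thesis by simp
qed

context
  fixes M A
  assumes M: "invariant_system S d \<phi> e \<theta> M" and A: "A \<in> sets M" "\<phi> -` A \<inter> space M = A" "0 < measure M A" "measure M A < 1"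
begin

interpretation invariant_system S d \<phi> e \<theta> M by (rule M)

lemma compl_invariant: "S - A \<in> sets M" "\<phi> -` (S - A) \<inter> space M = S - A" "measure M (S - A) = 1 - measure M A"
proof -
  show "S - A \<in> sets M" using A(1) sets.compl_sets[of A M] space_M by simp
  show "\<phi> -` (S - A) \<inter> space M = S - A" using A(2) \<phi>_S space_M by auto
  show "measure M (S - A) = 1 - measure M A" using prob_compl[OF A(1)] space_M by simp
qed

lemma uniform_invariant: "invariant_system S d \<phi> e \<theta> (uniform_measure M A)"
proof -
  let ?U = "uniform_measure M A"
  have eA: "emeasure M A \<noteq> 0" "emeasure M A \<noteq> \<infinity>" using A(3) by (auto simp: emeasure_eq_measure)
  have U: "prob_space ?U" "sets ?U = sets (borel_of mtopology)" using prob_space_uniform_measure[OF eA] M_borel by auto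
  interpret U: measurable_system ?U \<phi> by (rule measurable_system_borel[OF U])
  have "emeasure ?U (\<phi> -` B \<inter> space ?U) = emeasure ?U B" if B: "B \<in> sets ?U" for B
  proof -
    have B': "B \<in> sets M" using B by simp
    have pB: "\<phi> -` B \<inter> space M \<in> sets M" using measurable_sets[OF meas B'] .
    have "A \<inter> (\<phi> -` B \<inter> space M) = \<phi> -` (A \<inter> B) \<inter> space M" using A(2) by blast
    hence "emeasure M (A \<inter> (\<phi> -` B \<inter> space M)) = emeasure M (A \<inter> B)" using inv[of "A \<inter> B"] A(1) B' by simp
    thus ?thesis using A(1) B' pB by simp
  qed
  thus ?thesis using U expanding_system_axioms U.measurable_system_axioms
    by (intro invariant_system.intro pmp_system.intro pmp_system_axioms.intro invariant_system_axioms.intro) auto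
qed

end

context
  fixes M A t M1 M2
  assumes M: "invariant_system S d \<phi> e \<theta> M" and A: "A \<in> sets M" "\<phi> -` A \<inter> space M = A" and t: "t = measure M A" "0 < t" "t < 1"
    and M1: "M1 = uniform_measure M A" and M2: "M2 = uniform_measure M (S - A)"
begin

interpretation invariant_system S d \<phi> e \<theta> M by (rule M)

lemma compl_meas: "measure M (S - A) = 1 - t" "S - A \<in> sets M" using compl_invariant[OF M A] t by auto

lemma M12_invariant: "invariant_system S d \<phi> e \<theta> M1" "invariant_system S d \<phi> e \<theta> M2"
  unfolding M1 M2 using uniform_invariant[OF M A] uniform_invariant[OF M compl_invariant(1,2)[OF M A]] compl_meas t by auto

lemma M12_measure: assumes B: "B \<in> sets M" shows "measure M B = t * measure M1 B + (1 - t) * measure M2 B"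
proof -
  have "measure M1 B = measure M (A \<inter> B) / t" unfolding M1 using A B t by (subst measure_uniform_measure) (auto simp: emeasure_eq_measure)
  moreover have "measure M2 B = measure M ((S - A) \<inter> B) / (1 - t)" unfolding M2
    using compl_meas B t by (subst measure_uniform_measure) (auto simp: emeasure_eq_measure)
  moreover have "measure M B = measure M (A \<inter> B) + measure M ((S - A) \<inter> B)"
  proof -
    have "B = (A \<inter> B) \<union> ((S - A) \<inter> B)" using events_subset[OF B] by blast
    moreover have "measure M ((A \<inter> B) \<union> ((S - A) \<inter> B)) = measure M (A \<inter> B) + measure M ((S - A) \<inter> B)"
      using A B compl_meas by (intro finite_measure_Union) auto
    ultimately show ?thesis by simp
  qed
  ultimately show ?thesis using t by simp
qed

lemma M12_integral:
  assumes f: "continuous_map mtopology euclideanreal f"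
  shows "(\<integral>x. f x \<partial>M) = t * (\<integral>x. f x \<partial>M1) + (1 - t) * (\<integral>x. f x \<partial>M2)"
proof -
  have fm: "f \<in> borel_measurable M" by (rule continuous_measurable[OF f])
  have i: "integrable M (\<lambda>x. indicator B x * f x)" if "B \<in> sets M" for B
    using integrable_mult_indicator[OF that continuous_integrable[OF f]] by simp
  have "(\<integral>x. f x \<partial>M) = (\<integral>x. indicator A x * f x + indicator (S - A) x * f x \<partial>M)"
    by (intro Bochner_Integration.integral_cong) (auto simp: indicator_def space_M)
  also have "\<dots> = (\<integral>x. indicator A x * f x \<partial>M) + (\<integral>x. indicator (S - A) x * f x \<partial>M)"
    using i A(1) compl_meas(2) by simp
  finally show ?thesis
    using integral_uniform_measure[OF prob_space_axioms fm A(1)] integral_uniform_measure[OF prob_space_axioms fm compl_meas(2)] t compl_meas(1)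
    unfolding M1 M2 by simp
qed

text \<open>One generator serves all three measures, so the three entropies are rates of the same
  itineraries; the defect of the mixture is bounded and vanishes after division by
  \<open>n\<close>.\<close>

lemma ks_real_mixture: "ks_real M \<le> t * ks_real M1 + (1 - t) * ks_real M2"
proof -
  interpret M1: invariant_system S d \<phi> e \<theta> M1 by (rule M12_invariant)
  interpret M2: invariant_system S d \<phi> e \<theta> M2 by (rule M12_invariant)
  obtain \<kappa> where g: "generator \<kappa>" using ex_generator by blast
  hence ks: "simple_function M \<kappa>" and diam: "\<forall>x\<in>S. \<forall>y\<in>S. \<kappa> x = \<kappa> y \<longrightarrow> d x y < e" unfolding generator_def by auto
  have s: "sets M1 = sets M" "sets M2 = sets M" "space M1 = space M" "space M2 = space M" unfolding M1 M2 by auto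
  have ks12: "simple_function M1 \<kappa>" "simple_function M2 \<kappa>" using ks s by (auto simp: simple_function_def)
  hence g12: "M1.generator \<kappa>" "M2.generator \<kappa>" unfolding M1.generator_def M2.generator_def using diam by auto
  have e: "ks_real M = erate \<kappa>" "ks_real M1 = M1.erate \<kappa>" "ks_real M2 = M2.erate \<kappa>"
    using erate_eq_ks[OF g] M1.erate_eq_ks[OF g12(1)] M2.erate_eq_ks[OF g12(2)]
    unfolding ks_real_def by auto
  let ?C = "eta t + eta (1 - t)"
  have le: "ent M (itin \<phi> \<kappa> n) / real n \<le> t * (ent M1 (itin \<phi> \<kappa> n) / real n) + (1 - t) * (ent M2 (itin \<phi> \<kappa> n) / real n) + ?C / real n" for n
  proof -
    have "ent M (itin \<phi> \<kappa> n) \<le> t * ent M1 (itin \<phi> \<kappa> n) + (1 - t) * ent M2 (itin \<phi> \<kappa> n) + ?C"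
      by (rule ent_mixture_le[OF prob_space_axioms M1.prob_space_axioms M2.prob_space_axioms s(1,2) _ _ M12_measure simple_itin[OF ks]])
         (use t in auto)
    hence "ent M (itin \<phi> \<kappa> n) / real n \<le> (t * ent M1 (itin \<phi> \<kappa> n) + (1 - t) * ent M2 (itin \<phi> \<kappa> n) + ?C) / real n"
      by (intro divide_right_mono) auto
    thus ?thesis by (simp add: add_divide_distrib)
  qed
  have "(\<lambda>n. t * (ent M1 (itin \<phi> \<kappa> n) / real n) + (1 - t) * (ent M2 (itin \<phi> \<kappa> n) / real n) + ?C / real n)
      \<longlonglongrightarrow> t * M1.erate \<kappa> + (1 - t) * M2.erate \<kappa> + 0"
    by (intro tendsto_intros M1.erate_lim M2.erate_lim ks12 lim_const_over_n)
  from LIMSEQ_le[OF erate_lim[OF ks] this] show ?thesis unfolding e using le by auto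
qed

text \<open>\<open>M\<close> is a mixture of \<open>M1\<close> and \<open>M2\<close>, and after a
  deep cut-off \<open>M2\<close> exceeds \<open>ln (rad c)\<close> by no more than \<eta>, so
  \<open>M1\<close> cannot fall noticeably short of it. Cut-off integrals decrease with the level,
  hence \<open>k = max m m0\<close> serves both measures.\<close>

lemma equilibrium_conditional:
  assumes eq: "equilibrium M" and r: "rad c > 0" shows "equilibrium M1"
proof -
  have "ln (rad c) \<le> ks_real M1 + (\<integral>x. ln_cut m x \<partial>M1)" for m
  proof (rule field_le_epsilon)
    fix \<epsilon> :: real assume \<epsilon>: "\<epsilon> > 0"
    \<comment> \<open>Chosen so that \<open>(1 - t) * \<eta> = t * \<epsilon>\<close>: the possible
      excess of \<open>M2\<close> then costs \<open>M1\<close> exactly \<epsilon>.\<close>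
    define \<eta> where "\<eta> = \<epsilon> * t / (1 - t)"
    have \<eta>: "\<eta> > 0" using \<epsilon> t unfolding \<eta>_def by simp
    have "rad c * exp \<eta> > rad c" using r \<eta> by simp
    from ks_real_upper[OF this] M12_invariant(2) obtain m0 where "ks_real M2 + (\<integral>x. ln_cut m0 x \<partial>M2) \<le> ln (rad c * exp \<eta>)" by blast
    hence m0: "ks_real M2 + (\<integral>x. ln_cut m0 x \<partial>M2) \<le> ln (rad c) + \<eta>" using r by (simp add: ln_mult)
    define k where "k = max m m0"
    have "ln (rad c) \<le> ks_real M + (\<integral>x. ln_cut k x \<partial>M)" using eq unfolding equilibrium_def by blast
    also have "\<dots> \<le> t * (ks_real M1 + (\<integral>x. ln_cut k x \<partial>M1)) + (1 - t) * (ks_real M2 + (\<integral>x. ln_cut k x \<partial>M2))"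
      using ks_real_mixture unfolding M12_integral[OF ln_cut_cont] by (simp add: algebra_simps)
    also have "\<dots> \<le> t * (ks_real M1 + (\<integral>x. ln_cut m x \<partial>M1)) + (1 - t) * (ln (rad c) + \<eta>)"
    proof (rule add_mono)
      have "(\<integral>x. ln_cut k x \<partial>M1) \<le> (\<integral>x. ln_cut m x \<partial>M1)" by (rule integral_ln_cut_mono[OF M12_invariant(1)]) (simp add: k_def)
      thus "t * (ks_real M1 + (\<integral>x. ln_cut k x \<partial>M1)) \<le> t * (ks_real M1 + (\<integral>x. ln_cut m x \<partial>M1))" using t by simp
      have "(\<integral>x. ln_cut k x \<partial>M2) \<le> (\<integral>x. ln_cut m0 x \<partial>M2)" by (rule integral_ln_cut_mono[OF M12_invariant(2)]) (simp add: k_def)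
      thus "(1 - t) * (ks_real M2 + (\<integral>x. ln_cut k x \<partial>M2)) \<le> (1 - t) * (ln (rad c) + \<eta>)" using m0 t by simp
    qed
    finally have "t * ln (rad c) \<le> t * (ks_real M1 + (\<integral>x. ln_cut m x \<partial>M1)) + (1 - t) * \<eta>" by (simp add: algebra_simps)
    also have "(1 - t) * \<eta> = t * \<epsilon>" using t unfolding \<eta>_def by simp
    finally have "t * ln (rad c) \<le> t * (ks_real M1 + (\<integral>x. ln_cut m x \<partial>M1) + \<epsilon>)" by (simp add: algebra_simps)
    thus "ln (rad c) \<le> ks_real M1 + (\<integral>x. ln_cut m x \<partial>M1) + \<epsilon>" using t by simp
  qed
  thus ?thesis unfolding equilibrium_def using M12_invariant by blast
qed

end

text \<open>Among the equilibrium measures, one that maximises a strictly convex continuous functional is an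
  extreme point, hence ergodic.\<close>
theorem ex_ergodic_equilibrium:
  assumes r: "rad c > 0" shows "\<exists>M. equilibrium M \<and> M \<in> ergodic_measures mtopology \<phi>"
proof -
  obtain G :: "nat \<Rightarrow> 'a \<Rightarrow> real" where G: "\<And>k. continuous_map mtopology euclideanreal (G k)" "\<And>k x. 0 \<le> G k x" "\<And>k x. G k x \<le> 1"
    and Gdet: "\<forall>M N. prob_space M \<and> sets M = sets (borel_of mtopology) \<and> prob_space N \<and> sets N = sets (borel_of mtopology) \<and>
      (\<forall>k. (\<integral>x. G k x \<partial>M) = (\<integral>x. G k x \<partial>N)) \<longrightarrow> M = N"
    by (rule determining_family) (rule that)
  define g where "g k M = (\<integral>x. G k x \<partial>M)" for k M
  have g01: "0 \<le> g k M" "g k M \<le> 1" if "prob_space M" "sets M = sets (borel_of mtopology)" for k M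
  proof -
    interpret prob_space M by fact
    show "0 \<le> g k M" unfolding g_def using G(2) by (intro integral_nonneg_AE) auto
    have "g k M \<le> (\<integral>x. 1 \<partial>M)" unfolding g_def using G(3) by (intro integral_mono prob_integrable[OF that G(1)]) auto
    thus "g k M \<le> 1" by (simp add: prob_space)
  qed
  have g2: "(g k M)\<^sup>2 \<le> 1" if "prob_space M" "sets M = sets (borel_of mtopology)" for k M
    using g01[OF that, of k] by (simp add: power_le_one)
  \<comment> \<open>Squares give strict convexity. The geometric weights make the series converge
    uniformly in \<open>M\<close>, so weak continuity of each term passes to the sum.\<close>
  define \<Psi> where "\<Psi> M = (\<Sum>k. (1 / 2) ^ k * (g k M)\<^sup>2)" for M
  have geo: "summable (\<lambda>k. (1 / 2 :: real) ^ k)" by (rule summable_geometric) auto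
  have bd: "norm ((1 / 2) ^ k * (g k M)\<^sup>2) \<le> (1 / 2) ^ k" if "prob_space M" "sets M = sets (borel_of mtopology)" for k M
    using g2[OF that, of k] by (simp add: mult_left_le)
  have sm: "summable (\<lambda>k. (1 / 2) ^ k * (g k M)\<^sup>2)" if "prob_space M" "sets M = sets (borel_of mtopology)" for M
    by (rule summable_comparison_test'[OF geo, of 0]) (rule bd[OF that])
  have \<Psi>2: "\<Psi> M \<le> 2" if "prob_space M" "sets M = sets (borel_of mtopology)" for M
  proof -
    have "\<Psi> M \<le> (\<Sum>k. (1 / 2) ^ k)" unfolding \<Psi>_def using bd[OF that] by (intro suminf_le sm[OF that] geo) auto
    thus ?thesis by (simp add: suminf_geometric)
  qed
  define E where "E = {M. equilibrium M}"
  have EP: "prob_space M" "sets M = sets (borel_of mtopology)" if "M \<in> E" for M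
    using that invariant_systemD unfolding E_def equilibrium_def by blast+
  have Ene: "E \<noteq> {}" unfolding E_def using ex_equilibrium[OF r] by blast
  have bdd: "bdd_above (\<Psi> ` E)" using \<Psi>2 EP by (intro bdd_aboveI[of _ 2]) auto
  have "\<exists>M\<in>E. \<Psi> M > Sup (\<Psi> ` E) - 1 / (real n + 1)" for n
  proof -
    have "Sup (\<Psi> ` E) - 1 / (real n + 1) < Sup (\<Psi> ` E)" by simp
    from less_cSupD[OF _ this] Ene show ?thesis by auto
  qed
  then obtain \<mu> where \<mu>: "\<And>n. \<mu> n \<in> E" "\<And>n. \<Psi> (\<mu> n) > Sup (\<Psi> ` E) - 1 / (real n + 1)" by metis
  obtain q M where q: "strict_mono q" and M: "prob_space M" "sets M = sets (borel_of mtopology)"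
    and conv: "\<And>f. continuous_map mtopology euclideanreal f \<Longrightarrow> (\<lambda>n. \<integral>x. f x \<partial>\<mu> (q n)) \<longlonglongrightarrow> (\<integral>x. f x \<partial>M)"
    by (rule prob_measures_seq_compact[OF EP[OF \<mu>(1)]]) (rule that)
  have wc: "weakly_converges (\<lambda>n. \<mu> (q n)) M" unfolding weakly_converges_def using conv by blast
  have eqM: "equilibrium M" by (rule equilibrium_closed[OF _ M wc]) (use \<mu>(1) E_def in auto)
  have "(\<lambda>n. \<Psi> (\<mu> (q n))) \<longlonglongrightarrow> \<Psi> M"
  proof -
    have "((\<lambda>n. suminf (\<lambda>k. (1 / 2) ^ k * (g k (\<mu> (q n)))\<^sup>2)) \<longlongrightarrow> suminf (\<lambda>k. (1 / 2) ^ k * (g k M)\<^sup>2)) sequentially"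
    proof (rule tannerys_theorem[where M="\<lambda>k. (1 / 2) ^ k", THEN conjunct2, THEN conjunct2])
      show "(\<lambda>n. (1 / 2) ^ k * (g k (\<mu> (q n)))\<^sup>2) \<longlonglongrightarrow> (1 / 2) ^ k * (g k M)\<^sup>2" for k
        unfolding g_def by (intro tendsto_intros conv G(1))
      show "\<forall>\<^sub>F (k, n) in sequentially \<times>\<^sub>F sequentially. norm ((1 / 2) ^ k * (g k (\<mu> (q n)))\<^sup>2) \<le> (1 / 2) ^ k"
        using bd[OF EP[OF \<mu>(1)]] by (intro always_eventually) auto
    qed (use geo in auto)
    thus ?thesis unfolding \<Psi>_def .
  qed
  moreover have "(\<lambda>n. Sup (\<Psi> ` E) - 1 / (real (q n) + 1)) \<longlonglongrightarrow> Sup (\<Psi> ` E)"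
  proof -
    have "(\<lambda>n. 1 / (real n + 1)) \<longlonglongrightarrow> 0" by real_asymp
    from tendsto_diff[OF tendsto_const[of "Sup (\<Psi> ` E)"] this]
    have "(\<lambda>n. Sup (\<Psi> ` E) - 1 / (real n + 1)) \<longlonglongrightarrow> Sup (\<Psi> ` E)" by simp
    from LIMSEQ_subseq_LIMSEQ[OF this q] show ?thesis by (simp add: o_def)
  qed
  ultimately have "Sup (\<Psi> ` E) \<le> \<Psi> M" using \<mu>(2) by (intro LIMSEQ_le) (auto intro: less_imp_le)
  hence max: "\<Psi> N \<le> \<Psi> M" if "N \<in> E" for N using cSUP_upper[OF that bdd] by linarith
  have invM: "invariant_system S d \<phi> e \<theta> M" using eqM unfolding equilibrium_def by blast
  interpret invariant_system S d \<phi> e \<theta> M by (rule invM)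
  have "measure M A = 0 \<or> measure M A = 1" if A: "A \<in> sets M" "\<phi> -` A \<inter> space M = A" for A
  proof (rule ccontr)
    assume "\<not> ?thesis"
    moreover define t where "t = measure M A"
    ultimately have t: "0 < t" "t < 1" using measure_nonneg[of M A] prob_le_1[of A] by linarith+
    define M1 M2 where "M1 = uniform_measure M A" and "M2 = uniform_measure M (S - A)"
    note ctx = invM A t_def t M1_def M2_def
    have t': "1 - t = measure M (S - A)" "0 < 1 - t" "1 - t < 1" using compl_meas(1)[OF ctx] t by auto
    have "S - (S - A) = A" using events_subset[OF A(1)] by blast
    hence M1': "M1 = uniform_measure M (S - (S - A))" unfolding M1_def by simp
    have E1: "M1 \<in> E" unfolding E_def using equilibrium_conditional[OF ctx eqM r] by simp
    \<comment> \<open>The argument for \<open>M1\<close>, with the complement of \<open>A\<close> in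
      the role of \<open>A\<close> and \<open>M1\<close> as the measure conditioned on the other
      part.\<close>
    have E2: "M2 \<in> E" unfolding E_def
      using equilibrium_conditional[OF invM compl_invariant(1,2)[OF invM A t(1)[unfolded t_def] t(2)[unfolded t_def]] t' M2_def M1' eqM r] by simp
    have disj: "(S - A) \<inter> A = {}" by blast
    have "measure M1 A = 1" "measure M2 A = 0"
      unfolding M1_def M2_def using A t t' t_def compl_meas[OF ctx]
      by (subst measure_uniform_measure, auto simp: emeasure_eq_measure disj)+
    hence "M1 \<noteq> M2" by auto
    then obtain k where k: "g k M1 \<noteq> g k M2" using Gdet EP[OF E1] EP[OF E2] unfolding g_def by blast
    let ?a = "\<lambda>k. (1 / 2) ^ k * (g k M1)\<^sup>2" and ?b = "\<lambda>k. (1 / 2) ^ k * (g k M2)\<^sup>2" and ?m = "\<lambda>k. (1 / 2) ^ k * (g k M)\<^sup>2"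
    \<comment> \<open>The convexity gap of each term; it equals
      \<open>t * (1 - t) * (g k M1 - g k M2)\<^sup>2\<close> up to the weight and is positive for
      the \<open>k\<close> that tells \<open>M1\<close> from \<open>M2\<close>.\<close>
    let ?D = "\<lambda>k. t * ?a k + (1 - t) * ?b k - ?m k"
    have sD: "summable ?D" using sm[OF EP[OF E1]] sm[OF EP[OF E2]] sm[OF M] by (intro summable_add summable_diff summable_mult)
    have Deq: "?D k = (1 / 2) ^ k * (t * (1 - t) * (g k M1 - g k M2)\<^sup>2)" for k
      unfolding g_def M12_integral[OF ctx G(1)] by (simp add: power2_eq_square algebra_simps)
    have "0 < suminf ?D"
    proof (rule suminf_pos2[OF sD, of k])
      show "0 \<le> ?D n" for n unfolding Deq using t by simp
      show "0 < ?D k" unfolding Deq using t k by simp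
    qed
    also have "suminf ?D = t * \<Psi> M1 + (1 - t) * \<Psi> M2 - \<Psi> M"
      unfolding \<Psi>_def using sm[OF EP[OF E1]] sm[OF EP[OF E2]] sm[OF M]
      by (simp add: suminf_diff[symmetric] suminf_add[symmetric] suminf_mult[symmetric] summable_add summable_mult)
    also have "\<dots> \<le> t * \<Psi> M + (1 - t) * \<Psi> M - \<Psi> M"
      using max[OF E1] max[OF E2] t by (intro diff_right_mono add_mono mult_left_mono) auto
    finally show False by (simp add: algebra_simps)
  qed
  hence "M \<in> ergodic_measures mtopology \<phi>"
    unfolding ergodic_measures_def using invM invariant_system_iff by blast
  with eqM show ?thesis by blast
qed

end

subsection \<open>The variational principle\<close>

context transfer_system begin

text \<open>The cut-off levels are at most 1, so the positive part of \<open>ln_cut m\<close> is the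
  same for all \<open>m\<close>. Only the negative part moves; it increases, and monotone
  convergence applies. The positive part has a finite integral, which rules out a difference of
  infinities.\<close>

lemma integral_ln_cut_tendsto:
  assumes M: "invariant_system S d \<phi> e \<theta> M"
  shows "(\<lambda>m. ereal (\<integral>x. ln_cut m x \<partial>M)) \<longlonglongrightarrow> integral_ln M c" and "integral_ln M c \<noteq> \<infinity>"
proof -
  interpret invariant_system S d \<phi> e \<theta> M by (rule M)
  have cm[measurable]: "c \<in> borel_measurable M" by (rule continuous_measurable[OF c_cont])
  have lm[measurable]: "ln_cut m \<in> borel_measurable M" for m by (rule continuous_measurable[OF ln_cut_cont])
  define P where "P = (\<integral>\<^sup>+x. ennreal (max 0 (ln (c x))) \<partial>M)"
  define N where "N m = (\<integral>\<^sup>+x. ennreal (- ln_cut m x) \<partial>M)" for m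
  define Ninf where "Ninf = (\<integral>\<^sup>+x. (if c x = 0 then \<infinity> else ennreal (max 0 (- ln (c x)))) \<partial>M)"
  have int: "integrable M (ln_cut m)" for m by (rule continuous_integrable[OF ln_cut_cont])
  have Pm: "(\<integral>\<^sup>+x. ennreal (ln_cut m x) \<partial>M) = P" for m
    unfolding P_def
  proof (rule nn_integral_cong)
    fix x assume "x \<in> space M"
    hence c0: "c x \<ge> 0" using c_nonneg space_M by simp
    show "ennreal (ln_cut m x) = ennreal (max 0 (ln (c x)))"
    proof (cases "c x \<ge> 1 / (real m + 1)")
      case True
      hence "ln_cut m x = ln (c x)" unfolding ln_cut_def by (simp add: max_absorb1)
      thus ?thesis by (simp add: max_def ennreal_neg)
    next
      case False
      have a1: "1 / (real m + 1) \<le> 1" by simp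
      have "ln_cut m x = ln (1 / (real m + 1))" unfolding ln_cut_def using False by (simp add: max_absorb2)
      also have "\<dots> \<le> 0" by (simp add: ln_div)
      finally have 1: "ln_cut m x \<le> 0" .
      have "ln (c x) \<le> 0"
      proof (cases "c x = 0")
        case False thus ?thesis using c0 a1 \<open>\<not> 1 / (real m + 1) \<le> c x\<close> by (subst ln_le_zero_iff, simp) linarith
      qed simp
      with 1 show ?thesis by (simp add: ennreal_neg)
    qed
  qed
  have rli: "(\<integral>x. ln_cut m x \<partial>M) = enn2real P - enn2real (N m)" for m
    using real_lebesgue_integral_def[OF int[of m]] unfolding Pm N_def .
  have Pfin: "P \<noteq> \<infinity>" using int[of 0] unfolding real_integrable_def Pm by simp
  have Nfin: "N m \<noteq> \<infinity>" for m using int[of m] unfolding real_integrable_def N_def by simp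
  have Nlim: "N \<longlonglongrightarrow> Ninf"
  proof -
    \<comment> \<open>The comparison \<open>c x \<le> 0\<close> replaces \<open>c x = 0\<close>
      because convergence is shown at every point of the type, and off \<open>S\<close> the function
      \<open>c\<close> may be negative.\<close>
    define u where "u x = (if c x \<le> 0 then \<infinity> else ennreal (max 0 (- ln (c x))))" for x
    have "Ninf = (\<integral>\<^sup>+x. u x \<partial>M)" unfolding Ninf_def u_def
      by (rule nn_integral_cong) (use c_nonneg space_M in \<open>auto simp: order_antisym_conv\<close>)
    moreover have "(\<lambda>m. \<integral>\<^sup>+x. ennreal (- ln_cut m x) \<partial>M) \<longlonglongrightarrow> (\<integral>\<^sup>+x. u x \<partial>M)"
    proof (rule nn_integral_LIMSEQ)
      show "incseq (\<lambda>m x. ennreal (- ln_cut m x))" unfolding incseq_def le_fun_def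
        using ln_cut_mono by (auto intro!: ennreal_leI)
      show "(\<lambda>x. ennreal (- ln_cut m x)) \<in> borel_measurable M" for m by measurable
      show "(\<lambda>m. ennreal (- ln_cut m x)) \<longlonglongrightarrow> u x" for x
      proof (cases "c x \<le> 0")
        case True
        have "1 / (real m + 1) \<ge> c x" for m using True by (rule order_trans) simp
        hence eq: "- ln_cut m x = ln (real m + 1)" for m unfolding ln_cut_def by (simp add: max_absorb2 ln_div)
        have "filterlim (\<lambda>m. ln (real m + 1)) at_top sequentially" by real_asymp
        hence "(\<lambda>m. ennreal (ln (real m + 1))) \<longlonglongrightarrow> \<infinity>" by (simp add: ennreal_tendsto_top_eq_at_top)
        thus ?thesis unfolding eq u_def using True by simp
      next
        case False
        hence cp: "c x > 0" by simp
        have "\<forall>\<^sub>F m in sequentially. 1 / (real m + 1) < c x" using cp by real_asymp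
        hence "\<forall>\<^sub>F m in sequentially. ennreal (- ln_cut m x) = u x"
        proof eventually_elim
          case (elim m)
          hence "ln_cut m x = ln (c x)" unfolding ln_cut_def by (simp add: max_absorb1)
          thus ?case unfolding u_def using False by (simp add: max_def ennreal_neg)
        qed
        thus ?thesis by (rule tendsto_eventually)
      qed
    qed
    ultimately show ?thesis unfolding N_def[abs_def] by simp
  qed
  have fin: "ereal (enn2real y) = enn2ereal y" if "y \<noteq> \<infinity>" for y
    using that by (cases y) (auto simp: enn2ereal_ennreal)
  have eq: "ereal (\<integral>x. ln_cut m x \<partial>M) = enn2ereal P - enn2ereal (N m)" for m
    unfolding rli fin[OF Pfin, symmetric] fin[OF Nfin, symmetric] by simp
  have "(\<lambda>m. enn2ereal (N m)) \<longlonglongrightarrow> enn2ereal Ninf"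
    using Nlim by simp
  hence "(\<lambda>m. enn2ereal P - enn2ereal (N m)) \<longlonglongrightarrow> enn2ereal P - enn2ereal Ninf"
    using Pfin by (intro tendsto_diff_ereal_general tendsto_const) (auto simp: fin[OF Pfin, symmetric])
  moreover have il: "integral_ln M c = enn2ereal P - enn2ereal Ninf" unfolding integral_ln_def P_def Ninf_def ..
  ultimately show "(\<lambda>m. ereal (\<integral>x. ln_cut m x \<partial>M)) \<longlonglongrightarrow> integral_ln M c" unfolding eq by simp
  show "integral_ln M c \<noteq> \<infinity>"
    unfolding il fin[OF Pfin, symmetric] by (cases "enn2ereal Ninf") (use enn2ereal_nonneg[of Ninf] in auto)
qed

lemma ks_eq_ks_real: "invariant_system S d \<phi> e \<theta> M \<Longrightarrow> ks_entropy M \<phi> = ereal (ks_real M)"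
  unfolding ks_real_def by (rule invariant_system.ks_finite)

lemma pressure_tendsto:
  assumes M: "invariant_system S d \<phi> e \<theta> M"
  shows "(\<lambda>m. ereal (ks_real M + (\<integral>x. ln_cut m x \<partial>M))) \<longlonglongrightarrow> integral_ln M c + ks_entropy M \<phi>"
proof -
  have "(\<lambda>m. ereal (\<integral>x. ln_cut m x \<partial>M) + ereal (ks_real M)) \<longlonglongrightarrow> integral_ln M c + ereal (ks_real M)"
    by (intro tendsto_add_ereal_general1 integral_ln_cut_tendsto(1)[OF M] tendsto_const) auto
  thus ?thesis unfolding ks_eq_ks_real[OF M] by (simp add: add.commute)
qed

lemma pressure_le:
  assumes M: "invariant_system S d \<phi> e \<theta> M"
  shows "integral_ln M c + ks_entropy M \<phi> \<le> ln_ereal (rad c)"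
proof -
  have le: "integral_ln M c + ks_entropy M \<phi> \<le> ereal (ln \<rho>)" if \<rho>: "\<rho> > rad c" for \<rho>
  proof -
    obtain m0 where m0: "ks_real M + (\<integral>x. ln_cut m0 x \<partial>M) \<le> ln \<rho>" using ks_real_upper[OF \<rho>] M by blast
    have "ks_real M + (\<integral>x. ln_cut m x \<partial>M) \<le> ln \<rho>" if "m \<ge> m0" for m
      using integral_ln_cut_mono[OF M that] m0 by linarith
    thus ?thesis by (intro LIMSEQ_le_const2[OF pressure_tendsto[OF M]] exI[of _ m0]) auto
  qed
  show ?thesis
  proof (cases "rad c = 0")
    case True
    \<comment> \<open>Every positive rate lies above \<open>rad c = 0\<close>, in particular
      \<open>exp B\<close> for an arbitrary real \<open>B\<close>.\<close>
    have "integral_ln M c + ks_entropy M \<phi> \<le> ereal B" for B using le[of "exp B"] True by simp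
    hence "integral_ln M c + ks_entropy M \<phi> = - \<infinity>" by (rule ereal_bot)
    thus ?thesis by (rule ord_eq_le_trans) simp
  next
    case False
    hence r: "rad c > 0" using rad_nonneg by simp
    have "integral_ln M c + ks_entropy M \<phi> \<le> ereal (ln (rad c)) + ereal \<epsilon>" if "\<epsilon> > 0" for \<epsilon>
      using le[of "rad c * exp \<epsilon>"] r that by (simp add: ln_mult)
    hence "integral_ln M c + ks_entropy M \<phi> \<le> ereal (ln (rad c))" by (rule ereal_le_epsilon2)
    thus ?thesis using False by (simp add: ln_ereal_def)
  qed
qed

lemma equilibrium_pressure:
  assumes eq: "equilibrium M" and r: "rad c > 0"
  shows "integral_ln M c + ks_entropy M \<phi> = ln_ereal (rad c)"
proof (rule antisym)
  have M: "invariant_system S d \<phi> e \<theta> M" using eq unfolding equilibrium_def by blast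
  show "integral_ln M c + ks_entropy M \<phi> \<le> ln_ereal (rad c)" by (rule pressure_le[OF M])
  have "ereal (ln (rad c)) \<le> integral_ln M c + ks_entropy M \<phi>"
    using eq unfolding equilibrium_def by (intro LIMSEQ_le_const[OF pressure_tendsto[OF M]]) auto
  thus "ln_ereal (rad c) \<le> integral_ln M c + ks_entropy M \<phi>" using r by (simp add: ln_ereal_def)
qed

end

text \<open>For the weight 1 the iterates count the points of fibres. The fibre over the
  \<open>n\<close>-th image of a point contains that point, so the counts do not decay even if the
  map is not onto; the growth rate is at least 1 and the existence theorem applies.\<close>

lemma (in expanding_system) ex_ergodic: "ergodic_measures mtopology \<phi> \<noteq> {}"
proof -
  interpret one: transfer_system S d \<phi> e \<theta> "\<lambda>_. 1" by unfold_locales auto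
  have "rad (\<lambda>_. 1) \<ge> 1"
    unfolding rad_def
  proof (rule cInf_greatest)
    show "{\<rho>. 0 < \<rho> \<and> growth (\<lambda>_. 1) \<rho>} \<noteq> {}" using one.growth_ex by blast
    fix \<rho> assume "\<rho> \<in> {\<rho>. 0 < \<rho> \<and> growth (\<lambda>_. 1) \<rho>}"
    then obtain C where \<rho>: "\<rho> > 0" and C: "\<forall>n. \<forall>y\<in>S. one.L1 n y \<le> C * \<rho> ^ n" unfolding growth_def by blast
    obtain x where x: "x \<in> S" using nonempty by blast
    have ge: "1 \<le> C * \<rho> ^ n" for n
    proof -
      let ?y = "(\<phi> ^^ n) x"
      have yS: "?y \<in> S" by (rule iter_S[OF x])
      have "one.L1 n ?y = real (card (fib n ?y))" by (simp add: Lop_iter_eq[OF yS] orbit_prod_def)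
      moreover have "card (fib n ?y) > 0" using finite_fib x by (auto simp: card_gt_0_iff fib_def)
      ultimately have "1 \<le> one.L1 n ?y" by simp
      also have "\<dots> \<le> C * \<rho> ^ n" using C yS by blast
      finally show ?thesis .
    qed
    show "1 \<le> \<rho>"
    proof (rule ccontr)
      assume "\<not> 1 \<le> \<rho>"
      hence "(\<lambda>n. C * \<rho> ^ n) \<longlonglongrightarrow> C * 0" using \<rho> by (intro tendsto_intros LIMSEQ_power_zero) auto
      hence "(1::real) \<le> C * 0" by (rule LIMSEQ_le_const) (use ge in auto)
      thus False by simp
    qed
  qed
  hence "rad (\<lambda>_. 1) > 0" by simp
  from one.ex_ergodic_equilibrium[OF this] show ?thesis by blast
qed

theorem (in transfer_system) variational_principle:
  shows "(\<forall>\<mu>\<in>invariant_measures mtopology \<phi>. ks_entropy \<mu> \<phi> < \<infinity>)"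
    and "\<exists>\<mu>\<in>ergodic_measures mtopology \<phi>. integral_ln \<mu> c + ks_entropy \<mu> \<phi> = ln_ereal (spectral_radius (CX mtopology) RC)"
    and "\<forall>\<mu>\<in>invariant_measures mtopology \<phi>. integral_ln \<mu> c + ks_entropy \<mu> \<phi> \<le> ln_ereal (spectral_radius (CX mtopology) RC)"
proof -
  show "(\<forall>\<mu>\<in>invariant_measures mtopology \<phi>. ks_entropy \<mu> \<phi> < \<infinity>)"
  proof
    fix \<mu> assume "\<mu> \<in> invariant_measures mtopology \<phi>"
    hence "invariant_system S d \<phi> e \<theta> \<mu>" using invariant_system_iff by blast
    thus "ks_entropy \<mu> \<phi> < \<infinity>" by (simp add: ks_eq_ks_real)
  qed
  show le: "\<forall>\<mu>\<in>invariant_measures mtopology \<phi>. integral_ln \<mu> c + ks_entropy \<mu> \<phi> \<le> ln_ereal (spectral_radius (CX mtopology) RC)"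
    unfolding spectral_radius_eq using pressure_le invariant_system_iff by blast
  show "\<exists>\<mu>\<in>ergodic_measures mtopology \<phi>. integral_ln \<mu> c + ks_entropy \<mu> \<phi> = ln_ereal (spectral_radius (CX mtopology) RC)"
  \<comment> \<open>If the radius is 0, the upper bound is -\<infinity>, and any ergodic measure
    attains it.\<close>
  proof (cases "rad c = 0")
    case True
    obtain \<mu> where \<mu>: "\<mu> \<in> ergodic_measures mtopology \<phi>" using ex_ergodic by blast
    hence "\<mu> \<in> invariant_measures mtopology \<phi>" unfolding ergodic_measures_def by blast
    with le have "integral_ln \<mu> c + ks_entropy \<mu> \<phi> \<le> ln_ereal (spectral_radius (CX mtopology) RC)" by blast
    hence "integral_ln \<mu> c + ks_entropy \<mu> \<phi> = ln_ereal (spectral_radius (CX mtopology) RC)"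
      unfolding spectral_radius_eq True by (simp add: ln_ereal_def)
    with \<mu> show ?thesis by blast
  next
    case False
    hence r: "rad c > 0" using rad_nonneg by simp
    from ex_ergodic_equilibrium[OF r] obtain \<mu> where "equilibrium \<mu>" "\<mu> \<in> ergodic_measures mtopology \<phi>" by blast
    with equilibrium_pressure[OF _ r] show ?thesis unfolding spectral_radius_eq by blast
  qed
qed

theorem mainTheorem4:
  fixes X :: "'a topology" and \<phi> :: "'a \<Rightarrow> 'a" and c :: "'a \<Rightarrow> real"
  assumes "compact_space X" and "metrizable_space X" and "topspace X \<noteq> {}"
    and "continuous_map X X \<phi>" and "open_map X X \<phi>" and "expanding X \<phi>"
    and "continuous_map X euclideanreal c" and "\<forall>x\<in>topspace X. c x \<ge> 0"
  shows "(\<forall>\<mu>\<in>invariant_measures X \<phi>. ks_entropy \<mu> \<phi> < \<infinity>)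
    \<and> (\<exists>\<mu>\<in>invariant_measures X \<phi>.
          integral_ln \<mu> c + ks_entropy \<mu> \<phi> = ln_ereal (spectral_radius (CX X) (RPF X \<phi> c)))
    \<and> (\<forall>\<mu>\<in>invariant_measures X \<phi>.
          integral_ln \<mu> c + ks_entropy \<mu> \<phi> \<le> ln_ereal (spectral_radius (CX X) (RPF X \<phi> c)))
    \<and> (\<exists>\<mu>\<in>ergodic_measures X \<phi>.
          integral_ln \<mu> c + ks_entropy \<mu> \<phi> = ln_ereal (spectral_radius (CX X) (RPF X \<phi> c)))
    \<and> (\<forall>\<mu>\<in>ergodic_measures X \<phi>.
          integral_ln \<mu> c + ks_entropy \<mu> \<phi> \<le> ln_ereal (spectral_radius (CX X) (RPF X \<phi> c)))"
proof -
  obtain d e \<theta> where d: "Metric_space (topspace X) d" "Metric_space.mtopology (topspace X) d = X"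
    and e: "e > 0" "\<theta> > 1" "\<forall>x\<in>topspace X. \<forall>y\<in>topspace X. d x y < e \<longrightarrow> d (\<phi> x) (\<phi> y) \<ge> \<theta> * d x y"
    using assms(6) unfolding expanding_def by blast
  interpret Metric_space "topspace X" d by (rule d(1))
  interpret transfer_system "topspace X" d \<phi> e \<theta> c
  proof unfold_locales
    show "compact_space mtopology" "continuous_map mtopology mtopology \<phi>" "open_map mtopology mtopology \<phi>"
      "continuous_map mtopology euclideanreal c" using assms d(2) by simp_all
  qed (use assms e in auto)
  have sub: "ergodic_measures X \<phi> \<subseteq> invariant_measures X \<phi>" unfolding ergodic_measures_def by blast
  note V = variational_principle[unfolded d(2)]
  show ?thesis using V sub by blast
qed

end
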